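(* For every $\alpha\in(0,1)$ the following identities of maps on $\mathcal P(\mathbb R_+)$ hold: $$\tilde\Omega\circ\mathbf S_\alpha=\mathbf P_{1/\alpha}\circ\tilde\Omega,\qquad \Theta\circ\mathbf F_\alpha=\mathbf P_{1/\alpha}\circ\Theta,\qquad \Xi\circ\mathbf B_\alpha=\mathbf P_{1/\alpha}\circ\Xi.$$
   Context: $\mathbb R_+=[0,\infty)$ and $\mathcal P(\mathbb R_+)$ is the set of Borel probability measures on $\mathbb R_+$. For a measure $\nu$ on $\mathbb R_+$ and $c\in\mathbb R$, $\nu^c=\mathbf P_c(\nu)$ is the push-forward of $\nu$ by $x\mapsto x^c$ (for $c<0$ used only when $\nu(\{0\})=0$). $\circledast$ is the classical multiplicative convolution: $\mu\circledast\nu$ is the law of $XY$ for independent $X\sim\mu$, $Y\sim\nu$. Free multiplicative convolution $\boxtimes$: for $\mu\in\mathcal P(\mathbb R_+)\setminus\{\delta_0\}$ let $\psi_\mu(t)=\int_{\mathbb R_+}\frac{tu}{1-tu}\,d\mu(u)$, $t<0$, a bijection from $(-\infty,0)$ onto $(-1+\mu(\{0\}),0)$, and $S_\mu(t)=\frac{1+t}t\psi_\mu^{-1}(t)$ on $(-1+\mu(\{0\}),0)$. For $\mu,\nu\ne\delta_0$, $\mu\boxtimes\nu$ is characterized by $S_{\mu\boxtimes\nu}=S_\mu S_\nu$ on $(-1+\max\{\mu(\{0\}),\nu(\{0\})\},0)$; and $\mu\boxtimes\delta_0=\delta_0\boxtimes\mu=\delta_0$. For $t\ge1$ and $\mu\neq\delta_0$,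 $\mu^{\boxtimes t}\in\mathcal P(\mathbb R_+)$ is the measure with $S_{\mu^{\boxtimes t}}=(S_\mu)^t$ on $(-1+\mu(\{0\}),0)$, and $\delta_0^{\boxtimes t}=\delta_0$. $\Phi(\mu)$ is the weak limit of $(\mu^{\boxtimes n})^{1/n}$ as $n\to\infty$ (which exists for every $\mu\in\mathcal P(\mathbb R_+)$). $\pi$ is the standard Marchenko--Pastur law $\frac{\sqrt{x(4-x)}}{2\pi x}\mathbf 1_{(0,4)}(x)\,dx$ (the $\pi$ in the denominator is the number), and $\mathbf e$ is the exponential distribution with density $e^{-x}\mathbf 1_{(0,\infty)}(x)$. For $\mu\in\mathcal P(\mathbb R_+)$: $\Theta(\mu)=\Phi(\pi^{-1}\boxtimes\mu)$, $\Xi(\mu)=\Phi(\pi^{-1}\boxtimes\pi\boxtimes\mu)$, $\tilde\Omega(\mu)=\mathbf e^{-1}\circledast\mu$. For $\alpha\in(0,1)$: $\mathbf s_\alpha$ is the positive (classical) stable law, with $\log\int_{\mathbb R_+}e^{tu}\,d\mathbf s_\alpha(u)=-(-t)^\alpha$ for $t\le0$; $\mathbf f_\alpha$ is the positive free stable law, the element of $\mathcal P(\mathbb R_+)$ with $S$-transform $S_{\mathbf f_\alpha}(t)=(-t)^{\frac{1-\alpha}\alpha}$, $t\in(-1,0)$; $\mathbf b_\alpha$ is the positive boolean stable law, with density $\frac{\sin\pi\alpha}{\pi}\cdot\frac{x^{\alpha-1}}{x^{2\alpha}+2x^\alpha\cos\pi\alpha+1}\mathbf 1_{(0,\infty)}(x)$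 (here $\pi$ is the number). For $\nu\in\mathcal P(\mathbb R_+)$ put $$\mathbf S_\alpha(\nu)=\mathbf s_\alpha\circledast\nu^{1/\alpha},\qquad \mathbf F_\alpha(\nu)=\mathbf f_\alpha\boxtimes\nu^{\boxtimes1/\alpha},\qquad \mathbf B_\alpha(\nu)=\mathbf b_\alpha\circledast\nu^{1/\alpha}.$$ *)

theory Defs
  imports "HOL-Probability.Probability"
begin

(* Probability measures on [0,\<infinity>) are encoded as Borel probability measures on the
   real line that give mass 1 to [0,\<infinity>). *)
definition prob_Rplus :: "real measure set" where
  "prob_Rplus = {\<mu>. real_distribution \<mu> \<and> measure \<mu> {0..} = 1}"

abbreviation delta0 :: "real measure" where
  "delta0 \<equiv> return borel 0"

(* In HOL, 0 powr c = 0 for every c.  This is the usual value for c > 0; for c < 0 the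
   push-forward is only meaningful when \<nu> has no atom at 0, and c = 0 is never used. *)
definition pow_push :: "real \<Rightarrow> real measure \<Rightarrow> real measure" where
  "pow_push c \<nu> = distr \<nu> borel (\<lambda>x. x powr c)"

definition mult_conv :: "real measure \<Rightarrow> real measure \<Rightarrow> real measure"
    (infixl "\<circledast>" 70) where
  "\<mu> \<circledast> \<nu> = distr (\<mu> \<Otimes>\<^sub>M \<nu>) borel (\<lambda>(x, y). x * y)"


subsection \<open>S-transform and free multiplicative convolution\<close>

definition psi_transform :: "real measure \<Rightarrow> real \<Rightarrow> real" where
  "psi_transform \<mu> t = (LINT u|\<mu>. t * u / (1 - t * u))"

definition S_dom :: "real measure \<Rightarrow> real set" where
  "S_dom \<mu> = {-1 + measure \<mu> {0} <..< 0}"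

(* Meaningful for t in S_dom \<mu>, the image of the negative half-line under psi_transform \<mu>
   (\<mu> in prob_Rplus, \<mu> different from delta0). *)
definition S_transform :: "real measure \<Rightarrow> real \<Rightarrow> real" where
  "S_transform \<mu> t = (1 + t) / t * the_inv_into {..<0} (psi_transform \<mu>) t"

(* The measure whose S-transform is given by g on the interval (a,0).  The inclusion in S_dom
   says that the S-transform is defined on all of (a,0); without it the equation could involve
   values of S_transform outside its domain. *)
definition measure_of_S :: "real \<Rightarrow> (real \<Rightarrow> real) \<Rightarrow> real measure" where
  "measure_of_S a g = (THE \<rho>. \<rho> \<in> prob_Rplus \<and> \<rho> \<noteq> delta0 \<and> {a<..<0} \<subseteq> S_dom \<rho> \<and>
     (\<forall>t\<in>{a<..<0}. S_transform \<rho> t = g t))"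

definition free_mult_conv :: "real measure \<Rightarrow> real measure \<Rightarrow> real measure"
    (infixl "\<boxtimes>" 70) where
  "\<mu> \<boxtimes> \<nu> = (if \<mu> = delta0 \<or> \<nu> = delta0 then delta0
     else measure_of_S (-1 + max (measure \<mu> {0}) (measure \<nu> {0}))
            (\<lambda>t. S_transform \<mu> t * S_transform \<nu> t))"

(* Intended for real exponents r \<ge> 1. *)
definition free_mult_pow :: "real measure \<Rightarrow> real \<Rightarrow> real measure" where
  "free_mult_pow \<mu> r = (if \<mu> = delta0 then delta0
     else measure_of_S (-1 + measure \<mu> {0}) (\<lambda>t. S_transform \<mu> t powr r))"

(* Weak limit of the 1/n-th push-forwards of the n-th free powers, indexed by n = Suc k so that
   n \<ge> 1 throughout. *)
definition Phi :: "real measure \<Rightarrow> real measure" where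
  "Phi \<mu> = (THE \<rho>. \<rho> \<in> prob_Rplus \<and>
     weak_conv_m (\<lambda>k. pow_push (1 / real (Suc k)) (free_mult_pow \<mu> (real (Suc k)))) \<rho>)"


subsection \<open>Special laws\<close>

definition marchenko_pastur :: "real measure" where
  "marchenko_pastur = density lborel
     (\<lambda>x. ennreal (if 0 < x \<and> x < 4 then sqrt (x * (4 - x)) / (2 * pi * x) else 0))"

definition exp_law :: "real measure" where
  "exp_law = density lborel (\<lambda>x. ennreal (exponential_density 1 x))"

definition stable_law :: "real \<Rightarrow> real measure" where
  "stable_law \<alpha> = (THE \<rho>. \<rho> \<in> prob_Rplus \<and>
     (\<forall>t\<le>0. ln (LINT u|\<rho>. exp (t * u)) = - ((- t) powr \<alpha>)))"

definition free_stable_law :: "real \<Rightarrow> real measure" where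
  "free_stable_law \<alpha> = measure_of_S (-1) (\<lambda>t. (- t) powr ((1 - \<alpha>) / \<alpha>))"

definition boolean_stable_law :: "real \<Rightarrow> real measure" where
  "boolean_stable_law \<alpha> = density lborel
     (\<lambda>x. ennreal (if 0 < x
        then sin (pi * \<alpha>) / pi *
             (x powr (\<alpha> - 1) / (x powr (2 * \<alpha>) + 2 * x powr \<alpha> * cos (pi * \<alpha>) + 1))
        else 0))"


subsection \<open>The maps on probability measures on the half-line\<close>

definition Theta :: "real measure \<Rightarrow> real measure" where
  "Theta \<mu> = Phi (pow_push (-1) marchenko_pastur \<boxtimes> \<mu>)"

definition Xi :: "real measure \<Rightarrow> real measure" where
  "Xi \<mu> = Phi (pow_push (-1) marchenko_pastur \<boxtimes> marchenko_pastur \<boxtimes> \<mu>)"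

definition Omega_tilde :: "real measure \<Rightarrow> real measure" where
  "Omega_tilde \<mu> = pow_push (-1) exp_law \<circledast> \<mu>"

definition S_map :: "real \<Rightarrow> real measure \<Rightarrow> real measure" where
  "S_map \<alpha> \<nu> = stable_law \<alpha> \<circledast> pow_push (1 / \<alpha>) \<nu>"

definition F_map :: "real \<Rightarrow> real measure \<Rightarrow> real measure" where
  "F_map \<alpha> \<nu> = free_stable_law \<alpha> \<boxtimes> free_mult_pow \<nu> (1 / \<alpha>)"

definition B_map :: "real \<Rightarrow> real measure \<Rightarrow> real measure" where
  "B_map \<alpha> \<nu> = boolean_stable_law \<alpha> \<circledast> pow_push (1 / \<alpha>) \<nu>"

end

(* A positive function on (0,oo) is called complete Bernstein (predicate cbf) if it is a positive
   multiple of an average of the kernels s / ((1 - x) s + x), 0 <= x <= 1.  Besides sums and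
   pointwise limits this class is closed under f -> s / f (by partial fractions), hence under
   harmonic and geometric means, powers with exponent in [0,1], composition, and inversion of
   s B(s) for B in the class.

   Put R(s) = 1 + psi(-s), the integral of 1 / (1 + s u) against mu (written stj mu s); then
   S(R(s) - 1) = s R(s) / (1 - R(s)).  The functions 1 - R, 1 / R and s R / (1 - R) are complete
   Bernstein, and for such a B composing R with the inverse of s B(s) multiplies the
   S-transform by B.  This yields all the free convolutions and powers that occur, without
   complex analysis.

   Phi(mu) is the image of the uniform law on (0,1) under t -> 1 / S(t - 1), extended by 0 for
   t <= mu{0}; so Phi turns a power of the S-transform into the same power map, which gives the
   identity for Theta because S(t) = -t for the inverse of the Marchenko-Pastur law.  For Xi it
   gives the distribution function x -> R(1/x), and for Omega-tilde the distribution function is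
   the Laplace transform at 1/x.  The boolean and classical stable laws act on these functions
   by s -> s^alpha. *)

theory Submission
  imports Defs "HOL-Complex_Analysis.Complex_Analysis"
begin

section \<open>Laws on the unit interval\<close>

text \<open>Free convolutions and powers are given by definite descriptions, so nothing can be said
  about them before a law with the required S-transform has been exhibited. This existence question,
  rather than the identities, shapes the proof. The classical answer goes through analytic self-maps
  of the upper half-plane; here compactness replaces it. The kernel parameter runs over the closed
  interval [0,1], so that the functions 1 (x = 0) and s (x = 1) are kernels themselves, the
  representing laws form a compact set, and a pointwise limit that is positive at 1 stays in the
  class. Closure properties are therefore proved for finitely many atoms, or by an iteration that
  stays in the class, and then carried to the limit. Since only exponents in [0,1] preserve the
  class, larger powers of an S-transform are built in several steps, each applied to the law
  obtained in the step before. Contour integration remains in one place: a residue computation for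
  the Stieltjes integral of the boolean stable density.\<close>

definition unit_dist :: "real measure \<Rightarrow> bool" where
  "unit_dist \<sigma> \<longleftrightarrow> real_distribution \<sigma> \<and> (AE x in \<sigma>. x \<in> {0..1})"

lemma unit_dist_AE: "unit_dist \<sigma> \<Longrightarrow> (\<And>x. x \<in> {0..1} \<Longrightarrow> P x) \<Longrightarrow> AE x in \<sigma>. P x"
  unfolding unit_dist_def by (erule conjE, erule eventually_mono) blast

lemma unit_dist_integrable:
  fixes f :: "real \<Rightarrow> real"
  assumes "unit_dist \<sigma>" and [measurable]: "f \<in> borel_measurable borel" and "continuous_on {0..1} f"
  shows "integrable \<sigma> f"
proof -
  interpret real_distribution \<sigma> using assms by (simp add: unit_dist_def)
  have "compact (f ` {0..1})" using assms(3) by (intro compact_continuous_image) auto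
  then obtain B where "\<And>x. x \<in> {0..1} \<Longrightarrow> norm (f x) \<le> B"
    unfolding bounded_iff[of "f ` {0..1}"] using compact_imp_bounded bounded_iff by (metis image_eqI)
  then have "AE x in \<sigma>. norm (f x) \<le> B"
    using assms(1) unfolding unit_dist_def by auto
  then show ?thesis by (intro integrable_const_bound) auto
qed

text \<open>Retraction of the line onto [0,1]. Composing with it turns a function that is continuous
  on [0,1] into a bounded continuous test function on the whole line.\<close>

abbreviation clamp01 :: "real \<Rightarrow> real" where "clamp01 x \<equiv> max 0 (min 1 x)"

lemma isCont_clamp01:
  fixes f :: "real \<Rightarrow> real"
  assumes "continuous_on {0..1} f"
  shows "isCont (\<lambda>x. f (clamp01 x)) x"
proof -
  have "continuous_on UNIV (\<lambda>x. f (clamp01 x))"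
    by (rule continuous_on_compose2[OF assms]) (auto intro!: continuous_intros)
  then show ?thesis by (simp add: continuous_on_eq_continuous_at)
qed

text \<open>Prokhorov's theorem: a common bounded interval gives tightness, hence a weakly
  convergent subsequence. Test functions need continuity on [0,1] only, because composing with
  \<open>clamp01\<close> changes nothing almost surely.\<close>

lemma unit_dist_compact:
  assumes U: "\<And>n. unit_dist (\<sigma> n)"
  obtains r :: "nat \<Rightarrow> nat" and \<tau> where "strict_mono r" "unit_dist \<tau>"
    "\<forall>f\<in>borel_measurable borel. continuous_on {0..1} f \<longrightarrow>
      (\<lambda>n. (LINT x|\<sigma> (r n). f x)) \<longlonglongrightarrow> (LINT x|\<tau>. f x :: real)"
proof -
  interpret S: real_distribution "\<sigma> n" for n using U by (simp add: unit_dist_def)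
  \<comment> \<open>Tightness is phrased with half-open intervals, so the left end has to lie
    strictly below 0.\<close>
  have m1: "measure (\<sigma> n) {-1<..1} = 1" for n
  proof -
    have "AE x in \<sigma> n. x \<in> {-1<..1}" using U[of n] unfolding unit_dist_def by auto
    then show ?thesis by (subst S.prob_eq_1) auto
  qed
  have "tight \<sigma>" unfolding tight_def
    using S.real_distribution_axioms m1 by (intro conjI allI impI exI[of _ "-1::real"] exI[of _ "1::real"]) auto
  from tight_imp_convergent_subsubsequence[OF this strict_mono_id]
  obtain r M where r: "strict_mono r" and "real_distribution M" and w: "weak_conv_m (\<lambda>n. \<sigma> (r n)) M"
    by (auto simp: o_def)
  interpret M: real_distribution M by fact
  have conv: "(\<lambda>n. (LINT x|\<sigma> (r n). g x)) \<longlonglongrightarrow> (LINT x|M. g x :: real)"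
    if "\<And>x. isCont g x" "\<And>x. norm (g x) \<le> B" for g :: "real \<Rightarrow> real" and B
    by (rule weak_conv_imp_integral_bdd_continuous_conv[OF S.real_distribution_axioms \<open>real_distribution M\<close> w that(1)])
       (use that in auto)
  \<comment> \<open>Distance to [0,1], cut off at 1 to be bounded. Its integrals vanish along the
    sequence, hence also in the limit, so the limit law lives on [0,1] too.\<close>
  define h where "h x = min 1 \<bar>x - clamp01 x\<bar>" for x :: real
  have hc: "isCont h x" for x unfolding h_def by (intro continuous_intros)
  have hm[measurable]: "h \<in> borel_measurable borel" 
    unfolding h_def by measurable
  have "(\<lambda>n. (LINT x|\<sigma> (r n). h x)) \<longlonglongrightarrow> (LINT x|M. h x)"
    by (rule conv[OF hc, of 1]) (auto simp: h_def)
  moreover have "(LINT x|\<sigma> (r n). h x) = 0" for n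
  proof -
    have "AE x in \<sigma> (r n). h x = 0" using U[of "r n"] unfolding unit_dist_def h_def by auto
    then show ?thesis by (rule integral_eq_zero_AE)
  qed
  ultimately have "(LINT x|M. h x) = 0" by (simp add: LIMSEQ_const_iff)
  moreover have "integrable M h" by (rule M.integrable_const_bound[of _ 1]) (auto simp: h_def)
  ultimately have "AE x in M. h x = 0"
    by (subst (asm) integral_nonneg_eq_0_iff_AE) (auto simp: h_def)
  then have AEM: "AE x in M. x \<in> {0..1}" by eventually_elim (auto simp: h_def min_def max_def split: if_splits)
  then have UM: "unit_dist M" by (simp add: unit_dist_def \<open>real_distribution M\<close>)
  show ?thesis
  proof (rule that[OF r UM], intro ballI impI)
    fix f :: "real \<Rightarrow> real" assume [measurable]: "f \<in> borel_measurable borel" and c: "continuous_on {0..1} f"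
    have "compact (f ` {0..1})" using c by (intro compact_continuous_image) auto
    then obtain B where B: "\<And>x. x \<in> {0..1} \<Longrightarrow> norm (f x) \<le> B"
      using compact_imp_bounded bounded_iff by (metis image_eqI)
    have "(\<lambda>n. (LINT x|\<sigma> (r n). f (clamp01 x))) \<longlonglongrightarrow> (LINT x|M. f (clamp01 x))"
      by (rule conv[OF isCont_clamp01[OF c], of B]) (rule B, auto)
    moreover have "(LINT x|N. f (clamp01 x)) = (LINT x|N. f x)" if "unit_dist N" for N
    proof -
      interpret N: real_distribution N using that by (simp add: unit_dist_def)
      show ?thesis
        by (rule integral_cong_AE) (use that in \<open>auto simp: unit_dist_def\<close>)
    qed
    ultimately show "(\<lambda>n. (LINT x|\<sigma> (r n). f x)) \<longlonglongrightarrow> (LINT x|M. f x)" using U UM by simp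
  qed
qed

text \<open>Moment problem on a compact interval: polynomials approximate every continuous function
  uniformly (Weierstrass), in particular cos and sin, so the characteristic functions agree.\<close>

lemma unit_dist_eqI:
  assumes U: "unit_dist \<sigma>" "unit_dist \<tau>"
    and mom: "\<And>k::nat. (LINT x|\<sigma>. x ^ k) = (LINT x|\<tau>. x ^ k)"
  shows "\<sigma> = \<tau>"
proof -
  interpret S: real_distribution \<sigma> using U by (simp add: unit_dist_def)
  interpret T: real_distribution \<tau> using U by (simp add: unit_dist_def)
  have ip: "integrable N (\<lambda>x. x ^ k)" if "unit_dist N" for N and k :: nat
    using that by (rule unit_dist_integrable) (auto intro!: continuous_intros)
  have eq: "(LINT x|\<sigma>. f x) = (LINT x|\<tau>. f x)"
    if [measurable]: "f \<in> borel_measurable borel" and c: "continuous_on {0..1} f" for f :: "real \<Rightarrow> real"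
  proof (rule ccontr)
    assume ne: "(LINT x|\<sigma>. f x) \<noteq> (LINT x|\<tau>. f x)"
    \<comment> \<open>A third of the gap: the two approximation errors add up to at most 2 e, less
      than the gap 3 e.\<close>
    define e where "e = \<bar>(LINT x|\<sigma>. f x) - (LINT x|\<tau>. f x)\<bar> / 3"
    have e: "e > 0" using ne by (simp add: e_def)
    obtain p where p: "real_polynomial_function p" "\<And>x. x \<in> {0..1} \<Longrightarrow> \<bar>f x - p x\<bar> < e"
      using Stone_Weierstrass_real_polynomial_function[OF _ c e] by auto
    then obtain a n where pa: "p = (\<lambda>x. \<Sum>i\<le>n. a i * x ^ i)"
      using real_polynomial_function_iff_sum by auto
    have pm[measurable]: "p \<in> borel_measurable borel" by (simp add: pa)
    have pe: "(LINT x|\<sigma>. p x) = (LINT x|\<tau>. p x)"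
      using ip[OF U(1)] ip[OF U(2)] mom unfolding pa by (simp add: integral_sum)
    have close: "\<bar>(LINT x|N. f x) - (LINT x|N. p x)\<bar> \<le> e" if "unit_dist N" for N
    proof -
      interpret N: real_distribution N using that by (simp add: unit_dist_def)
      have i: "integrable N f" "integrable N p"
        using that by (auto intro!: unit_dist_integrable c continuous_intros simp: pa)
      have "\<bar>(LINT x|N. f x) - (LINT x|N. p x)\<bar> = \<bar>LINT x|N. f x - p x\<bar>" using i by simp
      also have "\<dots> \<le> (LINT x|N. \<bar>f x - p x\<bar>)" by (rule integral_abs_bound)
      also have "\<dots> \<le> (LINT x|N. e)"
      proof (rule integral_mono_AE)
        show "AE x in N. \<bar>f x - p x\<bar> \<le> e" using that p(2) unfolding unit_dist_def
          by (auto intro: less_imp_le)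
      qed (use i in auto)
      also have "\<dots> = e" using N.prob_space by simp
      finally show ?thesis .
    qed
    from close[OF U(1)] close[OF U(2)] pe e show False unfolding e_def by (auto simp: abs_if split: if_splits)
  qed
  have "char \<sigma> t = char \<tau> t" for t
  proof -
    have *: "char N t = Complex (LINT x|N. cos (t*x)) (LINT x|N. sin (t*x))" if "unit_dist N" for N
    proof -
      interpret N: real_distribution N using that by (simp add: unit_dist_def)
      have i: "integrable N (\<lambda>x. iexp (t * x))" by (rule N.integrable_iexp) auto
      have "Re (char N t) = (LINT x|N. Re (iexp (t*x)))" "Im (char N t) = (LINT x|N. Im (iexp (t*x)))"
        unfolding char_def using i by simp_all
      then show ?thesis by (intro complex_eqI) (simp_all add: Re_exp Im_exp)
    qed
    show ?thesis using U by (simp add: * eq continuous_intros)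
  qed
  then show ?thesis using Levy_uniqueness[OF S.real_distribution_axioms T.real_distribution_axioms] by auto
qed

section \<open>Complete Bernstein functions\<close>

definition kern :: "real \<Rightarrow> real \<Rightarrow> real" where
  "kern s x = s / ((1 - x) * s + x)"

lemma kern_denom_pos: "0 < s \<Longrightarrow> x \<in> {0..1} \<Longrightarrow> 0 < (1 - x) * s + (x::real)"
  by (cases "x = 0") (auto intro!: add_nonneg_pos)

lemma kern_measurable[measurable]: "kern s \<in> borel_measurable borel"
  unfolding kern_def by measurable

lemma kern_continuous: "0 < s \<Longrightarrow> continuous_on {0..1} (kern s)"
  unfolding kern_def using kern_denom_pos by (intro continuous_intros) (metis less_irrefl)

lemma kern_one [simp]: "kern 1 x = 1"
  by (simp add: kern_def)

lemma kern_pos: "0 < s \<Longrightarrow> x \<in> {0..1} \<Longrightarrow> 0 < kern s x"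
  unfolding kern_def using kern_denom_pos[of s x] by simp

lemma kern_mono:
  assumes "0 < s" "s \<le> t" "x \<in> {0..1}"
  shows "kern s x \<le> kern t x" "kern t x / t \<le> kern s x / s"
proof -
  have d: "0 < (1 - x) * s + x" "0 < (1 - x) * t + x" using kern_denom_pos assms by auto
  have "(1 - x) * s \<le> (1 - x) * t" using assms by (intro mult_left_mono) auto
  then show "kern t x / t \<le> kern s x / s"
    using assms d by (auto simp: kern_def intro!: divide_left_mono)
  have "x * s \<le> x * t" using assms by (intro mult_left_mono) auto
  then show "kern s x \<le> kern t x"
    using d by (simp add: kern_def divide_simps) (simp add: algebra_simps)
qed

text \<open>All kernels equal 1 at s = 1; monotonicity of \<open>kern s x\<close> and of its
  quotient by s then traps each kernel between 1 and s. The bound makes averages of kernels strictly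
  positive.\<close>

lemma kern_ge: "0 < s \<Longrightarrow> x \<in> {0..1} \<Longrightarrow> min 1 s \<le> kern s x"
  using kern_mono[of s 1 x] kern_mono[of 1 s x] by (auto simp: min_def)

lemma unit_dist_integrable_kern: "unit_dist \<sigma> \<Longrightarrow> 0 < s \<Longrightarrow> integrable \<sigma> (kern s)"
  by (rule unit_dist_integrable) (auto intro: kern_continuous)

text \<open>Complete Bernstein functions: the kernels are the weighted harmonic means of \<open>1\<close> and \<open>s\<close>.\<close>

definition cbf :: "(real \<Rightarrow> real) \<Rightarrow> bool" where
  "cbf f \<longleftrightarrow> (\<exists>c \<sigma>. 0 < c \<and> unit_dist \<sigma> \<and> (\<forall>s>0. f s = c * (LINT x|\<sigma>. kern s x)))"

lemma cbf_cong: "cbf f \<Longrightarrow> (\<And>s. 0 < s \<Longrightarrow> f s = g s) \<Longrightarrow> cbf g"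
  unfolding cbf_def by metis

lemma cbf_pos:
  assumes "cbf f" "0 < s"
  shows "0 < f s"
proof -
  obtain c \<sigma> where c: "0 < c" "unit_dist \<sigma>" "\<forall>s>0. f s = c * (LINT x|\<sigma>. kern s x)"
    using assms(1) unfolding cbf_def by auto
  interpret real_distribution \<sigma> using c by (simp add: unit_dist_def)
  have "min 1 s \<le> expectation (kern s)"
    by (intro integral_ge_const unit_dist_integrable_kern unit_dist_AE[OF c(2)] kern_ge c(2) assms(2))
  then show ?thesis using c assms by auto
qed

lemma cbf_mono:
  assumes "cbf f" "0 < s" "s \<le> t"
  shows "f s \<le> f t" "f t / t \<le> f s / s"
proof -
  obtain c \<sigma> where c: "0 < c" "unit_dist \<sigma>" "\<forall>s>0. f s = c * (LINT x|\<sigma>. kern s x)"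
    using assms(1) unfolding cbf_def by auto
  have "(LINT x|\<sigma>. kern s x) \<le> (LINT x|\<sigma>. kern t x)"
    using c(2) assms by (intro integral_mono_AE unit_dist_integrable_kern unit_dist_AE[OF c(2)] kern_mono(1)) auto
  then show "f s \<le> f t" using c assms by auto
  have "(LINT x|\<sigma>. kern t x / t) \<le> (LINT x|\<sigma>. kern s x / s)"
    using c(2) assms
    by (intro integral_mono_AE integrable_divide unit_dist_integrable_kern unit_dist_AE[OF c(2)] kern_mono(2)) auto
  then have "(LINT x|\<sigma>. kern t x) / t \<le> (LINT x|\<sigma>. kern s x) / s" by simp
  then have "c * ((LINT x|\<sigma>. kern t x) / t) \<le> c * ((LINT x|\<sigma>. kern s x) / s)"
    using c by (intro mult_left_mono) auto
  then show "f t / t \<le> f s / s" using c assms by (auto simp: algebra_simps)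
qed

lemma cbf_scale:
  assumes "cbf f" "0 < a"
  shows "cbf (\<lambda>s. a * f s)"
proof -
  obtain c \<sigma> where "0 < c" "unit_dist \<sigma>" "\<forall>s>0. f s = c * (LINT x|\<sigma>. kern s x)"
    using assms(1) unfolding cbf_def by auto
  then show ?thesis unfolding cbf_def using assms(2)
    by (intro exI[of _ "a * c"] exI[of _ \<sigma>]) auto
qed

lemma cbf_kern:
  assumes "x \<in> {0..1}"
  shows "cbf (\<lambda>s. kern s x)"
proof -
  have "unit_dist (return borel x)"
    unfolding unit_dist_def using assms
    by (auto simp: real_distribution_def real_distribution_axioms_def prob_space_return AE_return)
  then show ?thesis unfolding cbf_def
    by (intro exI[of _ 1] exI[of _ "return borel x"]) (auto simp: integral_return)
qed

lemma cbf_id: "cbf (\<lambda>s. s)"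
  using cbf_kern[of 1] by (simp add: kern_def)

lemma cbf_const: "0 < a \<Longrightarrow> cbf (\<lambda>s. a)"
  using cbf_scale[OF cbf_kern[of 0]] by (rule cbf_cong) (auto simp: kern_def)

text \<open>The mixture is obtained by first tossing a coin of bias \<open>p\<close> and then
  drawing from one of the two laws.\<close>

lemma unit_dist_mixture:
  assumes U: "unit_dist \<sigma>" "unit_dist \<tau>" and p: "p \<in> {0..1}"
  obtains \<rho> where "unit_dist \<rho>"
    "\<And>s. 0 < s \<Longrightarrow> (LINT x|\<rho>. kern s x) = p * (LINT x|\<sigma>. kern s x) + (1 - p) * (LINT x|\<tau>. kern s x)"
proof -
  interpret S: real_distribution \<sigma> using U by (simp add: unit_dist_def)
  interpret T: real_distribution \<tau> using U by (simp add: unit_dist_def)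
  define \<rho> where "\<rho> = measure_pmf (bernoulli_pmf p) \<bind> (\<lambda>b. if b then \<sigma> else \<tau>)"
  have meas: "(\<lambda>b. if b then \<sigma> else \<tau>) \<in> measurable (measure_pmf (bernoulli_pmf p)) (subprob_algebra borel)"
    using S.subprob_space_axioms T.subprob_space_axioms by (auto simp: space_subprob_algebra)
  have nn: "(\<integral>\<^sup>+x. f x \<partial>\<rho>) = p * (\<integral>\<^sup>+x. f x \<partial>\<sigma>) + (1 - p) * (\<integral>\<^sup>+x. f x \<partial>\<tau>)"
    if "f \<in> borel_measurable borel" for f
    unfolding \<rho>_def using p
    by (subst nn_integral_bind[OF that meas]) (simp add: nn_integral_bernoulli_pmf mult.commute)
  have sets[measurable_cong, simp]: "sets \<rho> = sets borel"
    unfolding \<rho>_def by (rule sets_bind[of _ _ borel]) auto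
  have em: "emeasure \<rho> A = p * emeasure \<sigma> A + (1 - p) * emeasure \<tau> A" if "A \<in> sets borel" for A
    using nn[of "indicator A"] that by simp
  have s1: "emeasure \<rho> UNIV = 1"
    using em[of UNIV] S.emeasure_space_1 T.emeasure_space_1 p by (simp flip: ennreal_plus)
  have rd: "real_distribution \<rho>"
    unfolding real_distribution_def real_distribution_axioms_def
    using s1 sets_eq_imp_space_eq[OF sets] by (auto intro!: prob_spaceI)
  then interpret R: real_distribution \<rho> .
  have "emeasure \<rho> (- {0..1}) = p * emeasure \<sigma> (- {0..1}) + (1 - p) * emeasure \<tau> (- {0..1})" by (rule em) auto
  also have "emeasure \<sigma> (- {0..1}) = 0" using U(1) by (subst (asm) unit_dist_def, subst (asm) AE_iff_measurable[OF _ refl]) (auto simp: Compl_eq)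
  also have "emeasure \<tau> (- {0..1}) = 0" using U(2) by (subst (asm) unit_dist_def, subst (asm) AE_iff_measurable[OF _ refl]) (auto simp: Compl_eq)
  finally have "emeasure \<rho> (- {0..1}) = 0" by simp
  then have ud: "unit_dist \<rho>" unfolding unit_dist_def using rd
    by (auto intro!: AE_I[where N="- {0..1}"])
  show ?thesis
  proof (rule that[OF ud])
    fix s :: real assume s: "0 < s"
    have nnk: "(\<integral>\<^sup>+x. ennreal (kern s x) \<partial>N) = ennreal (LINT x|N. kern s x)" "0 \<le> (LINT x|N. kern s x)" if "unit_dist N" for N
    proof -
      have AE: "AE x in N. 0 \<le> kern s x"
        by (intro unit_dist_AE[OF that] less_imp_le kern_pos s)
      show "(\<integral>\<^sup>+x. ennreal (kern s x) \<partial>N) = ennreal (LINT x|N. kern s x)"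
        using AE by (intro nn_integral_eq_integral unit_dist_integrable_kern that s)
      show "0 \<le> (LINT x|N. kern s x)" using AE by (rule integral_nonneg_AE)
    qed
    have "ennreal (LINT x|\<rho>. kern s x) = ennreal (p * (LINT x|\<sigma>. kern s x) + (1 - p) * (LINT x|\<tau>. kern s x))"
      using nn[of "\<lambda>x. ennreal (kern s x)"] p by (simp add: nnk ud U ennreal_mult ennreal_plus)
    then show "(LINT x|\<rho>. kern s x) = p * (LINT x|\<sigma>. kern s x) + (1 - p) * (LINT x|\<tau>. kern s x)"
      using p nnk(2)[OF ud] nnk(2)[OF U(1)] nnk(2)[OF U(2)] by (subst (asm) ennreal_inj) auto
  qed
qed

lemma cbf_add:
  assumes "cbf f" "cbf g"
  shows "cbf (\<lambda>s. f s + g s)"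
proof -
  obtain c \<sigma> where f: "0 < c" "unit_dist \<sigma>" "\<forall>s>0. f s = c * (LINT x|\<sigma>. kern s x)"
    using assms(1) unfolding cbf_def by auto
  obtain d \<tau> where g: "0 < d" "unit_dist \<tau>" "\<forall>s>0. g s = d * (LINT x|\<tau>. kern s x)"
    using assms(2) unfolding cbf_def by auto
  have "c / (c + d) \<in> {0..1}" using f g by auto
  from unit_dist_mixture[OF f(2) g(2) this] obtain \<rho> where \<rho>: "unit_dist \<rho>"
    "\<And>s. 0 < s \<Longrightarrow> (LINT x|\<rho>. kern s x) = c / (c + d) * (LINT x|\<sigma>. kern s x) + (1 - c / (c + d)) * (LINT x|\<tau>. kern s x)"
    by blast
  have "f s + g s = (c + d) * (LINT x|\<rho>. kern s x)" if "0 < s" for s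
  proof -
    have "1 - c / (c + d) = d / (c + d)" using f g by (simp add: field_simps)
    then show ?thesis using that f g by (simp add: \<rho>(2) distrib_left)
  qed
  then show ?thesis unfolding cbf_def using f g \<rho>(1) by (intro exI[of _ "c + d"] exI[of _ \<rho>]) auto
qed

lemma cbf_sum:
  assumes "finite X" "X \<noteq> {}" "\<And>x. x \<in> X \<Longrightarrow> cbf (f x)"
  shows "cbf (\<lambda>s. \<Sum>x\<in>X. f x s)"
  using assms by (induction X rule: finite_ne_induct) (auto intro!: cbf_add)

text \<open>Kernels are 1 at s = 1, so \<open>F n 1\<close> is the total mass and converges to
  \<open>f 1\<close>; the normalised laws converge along a subsequence by compactness. Positivity of
  \<open>f 1\<close> excludes the zero function.\<close>

lemma cbf_limit:
  assumes F: "\<And>n. cbf (F n)" and lim: "\<And>s. 0 < s \<Longrightarrow> (\<lambda>n. F n s) \<longlonglongrightarrow> f s" and pos: "0 < f 1"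
  shows "cbf f"
proof -
  have "\<exists>\<sigma>. unit_dist \<sigma> \<and> (\<forall>s>0. F n s = F n 1 * (LINT x|\<sigma>. kern s x))" for n
  proof -
    obtain c \<sigma> where f: "0 < c" "unit_dist \<sigma>" "\<forall>s>0. F n s = c * (LINT x|\<sigma>. kern s x)"
      using F[of n] unfolding cbf_def by auto
    interpret real_distribution \<sigma> using f by (simp add: unit_dist_def)
    have "F n 1 = c" using f prob_space by simp
    then show ?thesis using f by auto
  qed
  then obtain \<sigma> where \<sigma>: "\<And>n. unit_dist (\<sigma> n)" "\<And>n s. 0 < s \<Longrightarrow> F n s = F n 1 * (LINT x|\<sigma> n. kern s x)"
    by metis
  obtain r \<tau> where r: "strict_mono r" "unit_dist \<tau>"
    "\<forall>f\<in>borel_measurable borel. continuous_on {0..1} f \<longrightarrow>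
      (\<lambda>n. (LINT x|\<sigma> (r n). f x)) \<longlonglongrightarrow> (LINT x|\<tau>. f x :: real)"
    by (rule unit_dist_compact[of \<sigma>, OF \<sigma>(1)])
  have "f s = f 1 * (LINT x|\<tau>. kern s x)" if s: "0 < s" for s
  proof -
    have "(\<lambda>n. F (r n) 1 * (LINT x|\<sigma> (r n). kern s x)) \<longlonglongrightarrow> f 1 * (LINT x|\<tau>. kern s x)"
      using LIMSEQ_subseq_LIMSEQ[OF lim r(1), of 1] r(3)[rule_format, OF kern_measurable kern_continuous[OF s]]
      by (intro tendsto_mult) (auto simp: o_def)
    moreover have "(\<lambda>n. F (r n) s) \<longlonglongrightarrow> f s"
      using LIMSEQ_subseq_LIMSEQ[OF lim[OF s] r(1)] by (simp add: o_def)
    ultimately show ?thesis using \<sigma>(2)[OF s] LIMSEQ_unique by simp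
  qed
  then show ?thesis unfolding cbf_def using r(2) pos
    by (intro exI[of _ "f 1"] exI[of _ \<tau>] conjI allI impI) blast+
qed

text \<open>Atoms strictly between 0 and 1 correspond to finite positive poles u = x / (1 - x),
  which is what the partial fraction argument for reciprocals can handle.\<close>

lemma unit_dist_discretize:
  assumes "unit_dist \<sigma>"
  obtains X :: "nat \<Rightarrow> real set" and p :: "nat \<Rightarrow> real \<Rightarrow> real" where
    "\<forall>n. finite (X n) \<and> X n \<noteq> {} \<and> X n \<subseteq> {0<..<1} \<and> (\<forall>x\<in>X n. 0 < p n x) \<and> (\<Sum>x\<in>X n. p n x) = 1"
    "\<forall>g\<in>borel_measurable borel. continuous_on {0..1} g \<longrightarrow>
      (\<lambda>n. \<Sum>x\<in>X n. p n x * g x) \<longlonglongrightarrow> (LINT x|\<sigma>. g x)"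
proof -
  interpret S: real_distribution \<sigma> using assms by (simp add: unit_dist_def)
  \<comment> \<open>The floor lies in 0..n; adding 1 and dividing by n + 2 keeps the grid point away
    from both 0 and 1.\<close>
  define y where "y n x = (real_of_int \<lfloor>real n * clamp01 x\<rfloor> + 1) / (real n + 2)" for n x
  define Y where "Y n = (\<lambda>k. (real_of_int k + 1) / (real n + 2)) ` {0..int n}" for n
  define p where "p n z = measure \<sigma> (y n -` {z})" for n z
  define X where "X n = {z \<in> Y n. p n z > 0}" for n
  have ym[measurable]: "y n \<in> borel_measurable borel" for n unfolding y_def by measurable
  have yY: "y n x \<in> Y n" for n x
  proof -
    have "\<lfloor>real n * clamp01 x\<rfloor> \<in> {0..int n}"
      using mult_left_mono[of "clamp01 x" 1 "real n"] by (auto simp: floor_le_iff)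
    then show ?thesis by (auto simp: y_def Y_def)
  qed
  have Y01: "Y n \<subseteq> {0<..<1}" for n by (auto simp: Y_def field_simps)
  have fin: "finite (Y n)" for n by (simp add: Y_def)
  have yset: "y n -` {z} \<in> sets borel" for n z using measurable_sets[OF ym, of "{z}" n] by simp
  have int: "(LINT x|\<sigma>. g (y n x)) = (\<Sum>x\<in>X n. p n x * g x)" for g n
  proof -
    have "(LINT x|\<sigma>. g (y n x)) = (LINT x|\<sigma>. (\<Sum>z\<in>Y n. indicator (y n -` {z}) x * g z))"
    proof (intro Bochner_Integration.integral_cong refl)
      fix x
      have "(\<Sum>z\<in>Y n. indicator (y n -` {z}) x * g z) = (\<Sum>z\<in>Y n. if z = y n x then g z else 0)"
        by (intro sum.cong) (auto simp: indicator_def)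
      then show "g (y n x) = (\<Sum>z\<in>Y n. indicator (y n -` {z}) x * g z)" using fin yY by simp
    qed
    also have "\<dots> = (\<Sum>z\<in>Y n. p n z * g z)"
    proof (subst Bochner_Integration.integral_sum)
      show "integrable \<sigma> (\<lambda>x. indicator (y n -` {z}) x * g z)" for z
        using yset by (intro integrable_mult_left integrable_real_indicator) (auto simp: S.emeasure_eq_measure)
      have "(LINT x|\<sigma>. indicator (y n -` {z}) x) = p n z" for z using yset by (simp add: p_def)
      then show "(\<Sum>z\<in>Y n. LINT x|\<sigma>. indicator (y n -` {z}) x * g z) = (\<Sum>z\<in>Y n. p n z * g z)" by simp
    qed
    also have "\<dots> = (\<Sum>z\<in>X n. p n z * g z)"
      by (rule sum.mono_neutral_right) (auto simp: X_def fin p_def zero_less_measure_iff)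
    finally show ?thesis .
  qed
  have s1: "(\<Sum>x\<in>X n. p n x) = 1" for n
    using int[of "\<lambda>_. 1" n] S.prob_space by simp
  have ylim: "(\<lambda>n. y n x) \<longlonglongrightarrow> x" if "x \<in> {0..1}" for x
  proof -
    have bd: "\<bar>y n x - x\<bar> \<le> 2 / (real n + 2)" for n
    proof -
      have c: "clamp01 x = x" using that by auto
      have "real n * x - 1 < \<lfloor>real n * x\<rfloor>" "\<lfloor>real n * x\<rfloor> \<le> real n * x" by linarith+
      then have "\<bar>\<lfloor>real n * x\<rfloor> + 1 - x * (real n + 2)\<bar> \<le> 2"
        using that unfolding abs_le_iff distrib_left mult.commute[of x "real n"] atLeastAtMost_iff by linarith
      moreover have "y n x - x = (\<lfloor>real n * x\<rfloor> + 1 - x * (real n + 2)) / (real n + 2)"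
        unfolding y_def c by (simp add: field_simps)
      ultimately show ?thesis by (simp add: abs_divide divide_right_mono)
    qed
    have l: "(\<lambda>n. 2 / (real n + 2)) \<longlonglongrightarrow> 0" by real_asymp
    show ?thesis
      by (rule LIM_zero_cancel, rule Lim_null_comparison[OF _ l], rule always_eventually) (simp add: bd)
  qed
  show ?thesis
  proof (rule that[of X p], intro allI conjI ballI)
    fix n
    show "finite (X n)" using fin by (simp add: X_def)
    show "X n \<noteq> {}" using s1[of n] by auto
    show "X n \<subseteq> {0<..<1}" using Y01 by (auto simp: X_def)
    show "(\<Sum>x\<in>X n. p n x) = 1" by (rule s1)
    show "x \<in> X n \<Longrightarrow> 0 < p n x" for x by (simp add: X_def)
  next
    show "\<forall>g\<in>borel_measurable borel. continuous_on {0..1} g \<longrightarrow>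
      (\<lambda>n. \<Sum>x\<in>X n. p n x * g x) \<longlonglongrightarrow> (LINT x|\<sigma>. g x)"
    proof (intro ballI impI)
      fix g :: "real \<Rightarrow> real" assume [measurable]: "g \<in> borel_measurable borel" and c: "continuous_on {0..1} g"
      have "compact (g ` {0..1})" using c by (intro compact_continuous_image) auto
      then obtain B where B: "\<And>x. x \<in> {0..1} \<Longrightarrow> norm (g x) \<le> B"
        using compact_imp_bounded bounded_iff by (metis image_eqI)
      have y01: "y n x \<in> {0..1}" for n x using yY[of n x] Y01[of n] by auto
      have "(\<lambda>n. (LINT x|\<sigma>. g (y n x))) \<longlonglongrightarrow> (LINT x|\<sigma>. g x)"
      proof (rule integral_dominated_convergence[where w="\<lambda>_. B"])
        show "AE x in \<sigma>. (\<lambda>n. g (y n x)) \<longlonglongrightarrow> g x"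
          by (rule unit_dist_AE[OF assms], rule continuous_on_tendsto_compose[OF c ylim]) (use y01 in auto)
        show "AE x in \<sigma>. norm (g (y n x)) \<le> B" for n using B[OF y01] by auto
      qed auto
      then show "(\<lambda>n. \<Sum>x\<in>X n. p n x * g x) \<longlonglongrightarrow> (LINT x|\<sigma>. g x)" by (simp add: int)
    qed
  qed
qed

section \<open>Reciprocals s / f(s) by partial fractions\<close>

lemma partial_fractions_distinct_roots:
  fixes M P :: "real poly"
  assumes fin: "finite R" and card: "card R = degree M" and M0: "M \<noteq> 0" and deg: "degree P \<le> degree M"
    and root: "\<And>r. r \<in> R \<Longrightarrow> poly M r = 0" and simple: "\<And>r. r \<in> R \<Longrightarrow> poly (pderiv M) r \<noteq> 0"
    and s: "poly M s \<noteq> 0"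
  shows "poly P s / poly M s =
    coeff P (degree M) / lead_coeff M + (\<Sum>r\<in>R. poly P r / poly (pderiv M) r / (s - r))"
proof -
  \<comment> \<open>\<open>M\<close> without the linear factor of r; by the product rule its value
    at r is the derivative of \<open>M\<close> there.\<close>
  define K where "K r = M div [:-r, 1:]" for r
  define a where "a r = poly P r / poly (pderiv M) r" for r
  define c where "c = coeff P (degree M) / lead_coeff M"
  have MK: "M = [:-r, 1:] * K r" if "r \<in> R" for r
    using root[OF that] unfolding K_def poly_eq_0_iff_dvd by (rule dvd_mult_div_cancel[symmetric])
  have Kr: "poly (K r) r = poly (pderiv M) r" if "r \<in> R" for r
    by (subst MK[OF that], subst pderiv_mult) (simp add: pderiv_pCons)
  have Kr': "poly (K r) r' = 0" if "r \<in> R" "r' \<in> R" "r \<noteq> r'" for r r'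
    using root[OF that(2)] MK[OF that(1)] that(3)
    by (metis add.inverse_inverse eq_neg_iff_add_eq_0 mult_eq_0_iff poly_mult poly_pCons poly_0 mult.right_neutral add_0_right mult_zero_right)
  have Kdeg: "degree (K r) < degree M" if "r \<in> R" for r
  proof -
    have "K r \<noteq> 0" using MK[OF that] M0 by auto
    then have "degree M = 1 + degree (K r)" by (subst MK[OF that], subst degree_mult_eq) auto
    then show ?thesis by simp
  qed
  \<comment> \<open>Lagrange interpolation: \<open>D\<close> vanishes at all points of
    \<open>R\<close>, and the choice of \<open>c\<close> cancels the coefficient of degree
    \<open>degree M\<close>. A polynomial of smaller degree with that many zeros is 0.\<close>
  define D where "D = P - smult c M - (\<Sum>r\<in>R. smult (a r) (K r))"
  have D_root: "poly D r = 0" if "r \<in> R" for r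
  proof -
    have "(\<Sum>r'\<in>R. a r' * poly (K r') r) = (\<Sum>r'\<in>R. if r' = r then poly P r else 0)"
      by (intro sum.cong) (auto simp: a_def Kr simple Kr' that)
    then show ?thesis using that fin root[OF that] by (simp add: D_def poly_sum)
  qed
  have "D = 0"
  proof (rule ccontr)
    assume "D \<noteq> 0"
    have "degree (\<Sum>r\<in>R. smult (a r) (K r)) \<le> degree M"
      using Kdeg by (intro degree_sum_le fin) (meson degree_smult_le less_imp_le order_trans)
    then have dD: "degree D \<le> degree M" unfolding D_def
      using deg by (intro degree_diff_le) (auto intro: order_trans[OF degree_smult_le])
    have "coeff D (degree M) = coeff P (degree M) - c * lead_coeff M - (\<Sum>r\<in>R. a r * coeff (K r) (degree M))"
      by (simp add: D_def coeff_sum)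
    also have "(\<Sum>r\<in>R. a r * coeff (K r) (degree M)) = 0"
      using Kdeg by (intro sum.neutral) (auto simp: coeff_eq_0)
    finally have "coeff D (degree M) = 0" using M0 by (simp add: c_def)
    with dD \<open>D \<noteq> 0\<close> have "degree D < degree M" using leading_coeff_0_iff le_neq_implies_less by metis
    moreover have "card R \<le> card {x. poly D x = 0}"
      using D_root poly_roots_finite[OF \<open>D \<noteq> 0\<close>] by (intro card_mono) auto
    ultimately show False using card_poly_roots_bound[OF \<open>D \<noteq> 0\<close>] card by simp
  qed
  then have "poly D s = 0" by simp
  then have "poly P s = c * poly M s + (\<Sum>r\<in>R. a r * poly (K r) s)"
    by (simp add: D_def poly_sum)
  moreover have "a r * poly (K r) s = poly M s * (a r / (s - r))" if "r \<in> R" for r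
  proof -
    have "s \<noteq> r" using root[OF that] s by auto
    moreover have "poly M s = (s - r) * poly (K r) s" by (subst MK[OF that]) (simp add: left_diff_distrib)
    ultimately show ?thesis by simp
  qed
  ultimately have "poly P s = poly M s * (c + (\<Sum>r\<in>R. a r / (s - r)))"
    by (simp add: sum_distrib_left distrib_left mult.commute)
  then show ?thesis using s by (simp add: a_def c_def)
qed

text \<open>Up to the factor 1 / (1 + v) this is the kernel with parameter x = v / (1 + v).\<close>

lemma cbf_ratio: "0 \<le> v \<Longrightarrow> cbf (\<lambda>s. s / (s + v))"
proof -
  assume v: "0 \<le> v"
  then have "v / (1 + v) \<in> {0..1}" by auto
  from cbf_scale[OF cbf_kern[OF this], of "1 / (1 + v)"] v
  have "cbf (\<lambda>s. 1 / (1 + v) * kern s (v / (1 + v)))" by auto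
  then show ?thesis
  proof (rule cbf_cong)
    fix s :: real assume "0 < s"
    have "1 - v / (1 + v) = 1 / (1 + v)" using v by (simp add: field_simps)
    then have "(1 - v / (1 + v)) * s + v / (1 + v) = (s + v) / (1 + v)"
      by (simp add: add_divide_distrib)
    then show "1 / (1 + v) * kern s (v / (1 + v)) = s / (s + v)"
      using v by (simp add: kern_def)
  qed
qed

text \<open>The zeros of \<open>M\<close> interlace the poles \<open>-u\<close>; at a zero \<open>\<rho>\<close> the residue of \<open>P / M\<close> is
  \<open>1 / f' \<rho> > 0\<close>.\<close>

lemma cbf_recip_atomic:
  fixes U :: "real set" and p :: "real \<Rightarrow> real"
  assumes fin: "finite U" and ne: "U \<noteq> {}" and pos: "\<And>u. u \<in> U \<Longrightarrow> 0 < u" "\<And>u. u \<in> U \<Longrightarrow> 0 < p u"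
  defines "f \<equiv> \<lambda>s. \<Sum>u\<in>U. p u * (s / (s + u))"
  shows "cbf (\<lambda>s. s / f s - s / (\<Sum>u\<in>U. p u))"
proof -
  \<comment> \<open>These polynomials write \<open>f\<close> as \<open>M / P\<close>:
    \<open>P\<close> has the zeros -u, \<open>L u\<close> omits one of them, and \<open>M\<close>
    has the extra zero 0 because every summand of \<open>f\<close> vanishes there.\<close>
  define P where "P = (\<Prod>u\<in>U. [:u, 1:])"
  define L where "L u = (\<Prod>w\<in>U - {u}. [:w, 1:])" for u
  define N where "N = (\<Sum>u\<in>U. smult (p u) (L u))"
  define M where "M = [:0, 1:] * N"
  have sp: "0 < (\<Sum>u\<in>U. p u)" using fin ne pos by (intro sum_pos) auto
  have Pp: "poly P x = (\<Prod>u\<in>U. x + u)" for x by (simp add: P_def poly_prod add.commute)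
  have Lp: "poly (L u) x = (\<Prod>w\<in>U - {u}. x + w)" for x u by (simp add: L_def poly_prod add.commute)
  have degL: "degree (L u) = card U - 1" "lead_coeff (L u) = 1" if "u \<in> U" for u
  proof -
    show "degree (L u) = card U - 1" using fin that by (auto simp: L_def degree_prod_eq_sum_degree)
    show "lead_coeff (L u) = 1" unfolding L_def lead_coeff_prod by simp
  qed
  have degP: "degree P = card U" "lead_coeff P = 1"
  proof -
    show "degree P = card U" using fin by (auto simp: P_def degree_prod_eq_sum_degree)
    show "lead_coeff P = 1" unfolding P_def lead_coeff_prod by simp
  qed
  have cU: "card U > 0" using fin ne by (simp add: card_gt_0_iff)
  have "coeff N (card U - 1) = (\<Sum>u\<in>U. p u)"
    unfolding N_def coeff_sum using degL by (intro sum.cong) auto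
  moreover have "degree N \<le> card U - 1"
    unfolding N_def using degL by (intro degree_sum_le fin) auto
  ultimately have dN: "degree N = card U - 1" using sp by (intro antisym le_degree) auto
  with \<open>coeff N (card U - 1) = _\<close> have degN: "degree N = card U - 1" "lead_coeff N = (\<Sum>u\<in>U. p u)"
    by simp_all
  then have N0: "N \<noteq> 0" using sp by auto
  have degM: "degree M = card U" "lead_coeff M = (\<Sum>u\<in>U. p u)"
  proof -
    show dM: "degree M = card U" unfolding M_def using N0 degN cU by (auto simp: degree_mult_eq)
    show "lead_coeff M = (\<Sum>u\<in>U. p u)"
      using degN by (simp add: M_def lead_coeff_mult del: mult_pCons_left)
  qed
  have M0: "M \<noteq> 0" unfolding M_def using N0 by simp
  have Mf: "poly M x = f x * poly P x" if "\<And>u. u \<in> U \<Longrightarrow> x + u \<noteq> 0" for x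
  proof -
    have "p u * (x / (x + u)) * poly P x = x * (p u * poly (L u) x)" if u: "u \<in> U" for u
    proof -
      have "poly P x = (x + u) * poly (L u) x" unfolding Pp Lp using prod.remove[OF fin u] .
      then show ?thesis using \<open>\<And>u. u \<in> U \<Longrightarrow> x + u \<noteq> 0\<close>[OF u] by simp
    qed
    then show ?thesis by (simp add: M_def N_def f_def poly_sum sum_distrib_left sum_distrib_right)
  qed
  have Nu: "poly N (-u) = p u * (\<Prod>w\<in>U - {u}. w - u)" if "u \<in> U" for u
  proof -
    have "(\<Sum>v\<in>U. p v * poly (L v) (-u)) = (\<Sum>v\<in>U. if v = u then p u * poly (L u) (-u) else 0)"
    proof (intro sum.cong refl)
      fix v assume "v \<in> U"
      have "v \<noteq> u \<Longrightarrow> poly (L v) (-u) = 0" unfolding Lp using that fin by (intro prod_zero) auto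
      then show "p v * poly (L v) (-u) = (if v = u then p u * poly (L u) (-u) else 0)" by auto
    qed
    then show ?thesis using that fin by (simp add: N_def poly_sum Lp)
  qed
  \<comment> \<open>The next larger element of \<open>U\<close>; a zero of \<open>N\<close> is
    sought in each gap between neighbouring poles.\<close>
  define nx where "nx u = Min {w \<in> U. u < w}" for u
  have nx: "nx u \<in> U" "u < nx u" "\<And>w. w \<in> U \<Longrightarrow> u < w \<Longrightarrow> nx u \<le> w" if "u \<in> U - {Max U}" for u
  proof -
    have "u < Max U" using that fin by (metis DiffD1 DiffD2 Max_ge insertI1 order.not_eq_order_implies_strict)
    then have "{w \<in> U. u < w} \<noteq> {}" using Max_in[OF fin ne] by auto
    then have "nx u \<in> {w \<in> U. u < w}" unfolding nx_def using fin by (intro Min_in) auto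
    then show "nx u \<in> U" "u < nx u" by auto
    show "\<And>w. w \<in> U \<Longrightarrow> u < w \<Longrightarrow> nx u \<le> w" unfolding nx_def using fin by (intro Min_le) auto
  qed
  \<comment> \<open>In the product of the two values of \<open>N\<close>, the factors belonging to
    any third pole w have equal signs, since w does not lie between u and its successor. The two
    factors that compare u with its successor have opposite signs, so \<open>N\<close> changes
    sign.\<close>
  have "\<exists>v. u < v \<and> v < nx u \<and> poly N (-v) = 0" if u: "u \<in> U - {Max U}" for u
  proof -
    note n = nx[OF u]
    have "(\<Prod>w\<in>U - {u}. w - u) = (nx u - u) * (\<Prod>w\<in>U - {u, nx u}. w - u)"
      using n u fin by (subst prod.remove[of _ "nx u"]) (auto simp: Diff_insert2[symmetric] insert_commute)
    moreover have "(\<Prod>w\<in>U - {nx u}. w - nx u) = (u - nx u) * (\<Prod>w\<in>U - {u, nx u}. w - nx u)"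
      using n u fin by (subst prod.remove[of _ u]) (auto simp: Diff_insert2[symmetric] insert_commute)
    ultimately have "poly N (-u) * poly N (-nx u) =
      (p u * p (nx u) * (\<Prod>w\<in>U - {u, nx u}. (w - u) * (w - nx u))) * ((nx u - u) * (u - nx u))"
      using u n by (simp add: Nu prod.distrib)
    moreover have "0 < p u * p (nx u) * (\<Prod>w\<in>U - {u, nx u}. (w - u) * (w - nx u))"
    proof (rule mult_pos_pos[OF mult_pos_pos prod_pos])
      fix w assume w: "w \<in> U - {u, nx u}"
      show "0 < (w - u) * (w - nx u)"
      proof (cases "w < u")
        case True
        then show ?thesis using n by (intro mult_neg_neg) auto
      next
        case False
        then have "nx u < w" using w n(3)[of w] by (auto simp: less_le)
        then show ?thesis using n by auto
      qed
    qed (use u n pos in auto)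
    moreover have "(nx u - u) * (u - nx u) < 0" using n by (intro mult_pos_neg) auto
    ultimately have "poly N (-nx u) * poly N (-u) < 0" by (metis mult_pos_neg mult.commute)
    from poly_IVT[OF _ this] n obtain x where "x > -nx u" "x < -u" "poly N x = 0" by auto
    then show ?thesis by (intro exI[of _ "-x"]) auto
  qed
  then obtain v where v: "\<And>u. u \<in> U - {Max U} \<Longrightarrow> u < v u" "\<And>u. u \<in> U - {Max U} \<Longrightarrow> v u < nx u"
    "\<And>u. u \<in> U - {Max U} \<Longrightarrow> poly N (- v u) = 0" by metis
  have vmono: "v u < v w" if "u \<in> U - {Max U}" "w \<in> U - {Max U}" "u < w" for u w
    using v(2)[OF that(1)] v(1)[OF that(2)] nx(3)[OF that(1) _ that(3)] that by auto
  have vinj: "inj_on v (U - {Max U})"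
    by (rule linorder_inj_onI') (use vmono in \<open>metis less_irrefl\<close>)
  \<comment> \<open>The zero at 0 and one zero per gap make \<open>card U\<close> zeros, the degree
    of \<open>M\<close>; hence these are all of them.\<close>
  define R where "R = insert 0 ((\<lambda>u. - v u) ` (U - {Max U}))"
  have vpos: "0 < v u" if "u \<in> U - {Max U}" for u using v(1)[OF that] pos that by fastforce
  have finR: "finite R" using fin by (simp add: R_def)
  have "0 \<notin> (\<lambda>u. - v u) ` (U - {Max U})" using vpos by fastforce
  moreover have "card ((\<lambda>u. - v u) ` (U - {Max U})) = card U - 1"
    using vinj fin ne by (subst card_image) (auto simp: inj_on_def)
  ultimately have cardR: "card R = degree M"
    using fin cU by (simp add: R_def degM)
  have rootR: "poly M r = 0" if "r \<in> R" for r using that v(3) by (auto simp: R_def M_def)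
  have Rle: "r \<le> 0" if "r \<in> R" for r using that vpos by (fastforce simp: R_def)
  have RU: "r + w \<noteq> 0" if "r \<in> R" "w \<in> U" for r w
  proof
    assume "r + w = 0"
    then have "r = - w" "r \<noteq> 0" using pos(1)[OF that(2)] by auto
    then have "r \<in> (\<lambda>u. - v u) ` (U - {Max U})" using that(1) unfolding R_def by blast
    then obtain u where "u \<in> U - {Max U}" "r = - v u" by blast
    then have u: "u \<in> U - {Max U}" "v u = w" using \<open>r = - w\<close> by auto
    then show False using v(1,2)[OF u(1)] nx(3)[OF u(1) that(2)] by auto
  qed
  have RP: "poly P r \<noteq> 0" if "r \<in> R" for r unfolding Pp using RU[OF that] fin by auto
  define f' where "f' r = (\<Sum>u\<in>U. p u * (u / (r + u)\<^sup>2))" for r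
  have f'pos: "0 < f' r" if "r \<in> R" for r
    unfolding f'_def using fin ne pos RU[OF that] by (intro sum_pos) auto
  have dM: "poly (pderiv M) r = f' r * poly P r" if r: "r \<in> R" for r
  proof -
    \<comment> \<open>The equation \<open>M = f P\<close> holds off the poles only. This open set is
      a neighbourhood of r, which suffices to compare derivatives; since f r = 0, the term with the
      derivative of \<open>P\<close> drops out.\<close>
    define S where "S = - (uminus ` U)"
    have S: "open S" "r \<in> S" "\<And>x u. x \<in> S \<Longrightarrow> u \<in> U \<Longrightarrow> x + u \<noteq> 0"
      unfolding S_def using fin RU[OF r]
      by (auto intro!: finite_imp_closed simp: open_closed) (metis add.right_inverse add.commute image_eqI eq_neg_iff_add_eq_0)+
    have f0: "f r = 0" using Mf[of r] RU[OF r] rootR[OF r] RP[OF r] by auto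
    have "(f has_field_derivative f' r) (at r)"
      unfolding f_def f'_def
    proof (intro DERIV_sum)
      fix u assume u: "u \<in> U"
      show "((\<lambda>s. p u * (s / (s + u))) has_field_derivative p u * (u / (r + u)\<^sup>2)) (at r)"
        using RU[OF r u] by (auto intro!: derivative_eq_intros simp: power2_eq_square distrib_left)
    qed
    then have "((\<lambda>x. f x * poly P x) has_field_derivative f' r * poly P r + f r * poly (pderiv P) r) (at r)"
      by (auto intro!: derivative_eq_intros simp: f0)
    then have "(poly M has_field_derivative f' r * poly P r + f r * poly (pderiv P) r) (at r)"
      by (rule DERIV_cong_ev[THEN iffD1, rotated -1, OF _ refl _ refl])
         (use S in \<open>auto intro!: eventually_nhds_in_open[THEN eventually_mono] simp: Mf\<close>)
    from DERIV_unique[OF poly_DERIV this] f0 show ?thesis by simp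
  qed
  \<comment> \<open>The constant term of the expansion of \<open>P / M\<close> is the reciprocal of
    the sum of the weights. It yields exactly the linear term that is subtracted, and the rest is a
    positive combination of functions s / (s + v) with v = -r.\<close>
  have eq: "s / f s - s / (\<Sum>u\<in>U. p u) = (\<Sum>r\<in>R. 1 / f' r * (s / (s + (- r))))" if s: "0 < s" for s
  proof -
    have sU: "\<And>u. u \<in> U \<Longrightarrow> s + u \<noteq> 0" using pos s by (metis add_pos_pos less_irrefl)
    have P0: "poly P s \<noteq> 0" unfolding Pp using sU fin by auto
    have fp: "0 < f s" unfolding f_def using fin ne pos s by (intro sum_pos) (auto intro!: mult_pos_pos divide_pos_pos add_pos_pos)
    have Ms: "poly M s = f s * poly P s" by (rule Mf[OF sU])
    have "poly P s / poly M s = coeff P (degree M) / lead_coeff M + (\<Sum>r\<in>R. poly P r / poly (pderiv M) r / (s - r))"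
      by (rule partial_fractions_distinct_roots[OF finR cardR M0 _ rootR])
         (use dM RP f'pos degP degM P0 fp Ms in \<open>auto simp: less_le\<close>)
    also have "poly P s / poly M s = 1 / f s" using Ms P0 by simp
    also have "coeff P (degree M) / lead_coeff M = 1 / (\<Sum>u\<in>U. p u)" using degP degM by simp
    also have "(\<Sum>r\<in>R. poly P r / poly (pderiv M) r / (s - r)) = (\<Sum>r\<in>R. 1 / f' r / (s - r))"
      using dM RP by (intro sum.cong) auto
    finally have "s * (1 / f s) - s * (1 / (\<Sum>u\<in>U. p u)) = s * (\<Sum>r\<in>R. 1 / f' r / (s - r))"
      by (simp add: distrib_left)
    then show ?thesis by (simp add: sum_distrib_left mult.commute)
  qed
  have "cbf (\<lambda>s. \<Sum>r\<in>R. 1 / f' r * (s / (s + (- r))))"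
    using finR f'pos Rle by (intro cbf_sum cbf_scale cbf_ratio) (auto simp: R_def)
  then show ?thesis by (rule cbf_cong) (simp add: eq)
qed

text \<open>With u = x / (1 - x) one has (1 - x) \<open>kern s x\<close> = s / (s + u), so atoms in
  (0,1) become poles and the atomic case applies.\<close>

lemma cbf_recip_atomic':
  fixes X :: "real set" and w :: "real \<Rightarrow> real"
  assumes fin: "finite X" and ne: "X \<noteq> {}" and X: "X \<subseteq> {0<..<1}" and pos: "\<And>x. x \<in> X \<Longrightarrow> 0 < w x"
  shows "cbf (\<lambda>s. s / (\<Sum>x\<in>X. w x * ((1 - x) * kern s x)) - s / (\<Sum>x\<in>X. w x))"
proof -
  define U where "U = (\<lambda>x. x / (1 - x)) ` X"
  have inj: "inj_on (\<lambda>x. x / (1 - x)) X"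
  proof (rule inj_onI)
    fix x y assume xy: "x \<in> X" "y \<in> X" "x / (1 - x) = y / (1 - y)"
    then have "x < 1" "y < 1" using X by auto
    with xy(3) show "x = y" by (simp add: field_simps)
  qed
  have inv: "u / (1 + u) = x" if "x \<in> X" and "u = x / (1 - x)" for x u
  proof -
    have "x < 1" using that X by auto
    then have "1 + u = 1 / (1 - x)" using that by (simp add: field_simps)
    then show ?thesis using that \<open>x < 1\<close> by simp
  qed
  have s1: "(\<Sum>u\<in>U. w (u / (1 + u)) * (s / (s + u))) = (\<Sum>x\<in>X. w x * ((1 - x) * kern s x))" for s
    unfolding U_def
  proof (subst sum.reindex[OF inj], intro sum.cong refl, unfold o_def)
    fix x assume x: "x \<in> X"
    then have "x < 1" using X by auto
    then have "s + x / (1 - x) = ((1 - x) * s + x) / (1 - x)" by (simp add: field_simps)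
    then show "w (x / (1 - x) / (1 + x / (1 - x))) * (s / (s + x / (1 - x))) = w x * ((1 - x) * kern s x)"
      unfolding inv[OF x refl] by (simp add: kern_def)
  qed
  have s2: "(\<Sum>u\<in>U. w (u / (1 + u))) = (\<Sum>x\<in>X. w x)"
    unfolding U_def by (subst sum.reindex[OF inj], intro sum.cong refl) (simp add: inv[OF _ refl] del: divide_divide_eq_left)
  have "cbf (\<lambda>s. s / (\<Sum>u\<in>U. w (u / (1 + u)) * (s / (s + u))) - s / (\<Sum>u\<in>U. w (u / (1 + u))))"
    using fin ne X pos by (intro cbf_recip_atomic) (auto simp: U_def inv[OF _ refl] simp del: divide_divide_eq_left)
  then show ?thesis unfolding s1 s2 .
qed

text \<open>Discretise, apply the atomic case, add the linear term back and pass to the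
  limit.\<close>

lemma cbf_recip:
  assumes "cbf f"
  shows "cbf (\<lambda>s. s / f s)"
proof -
  obtain c \<sigma> where c: "0 < c" "unit_dist \<sigma>" "\<forall>s>0. f s = c * (LINT x|\<sigma>. kern s x)"
    using assms(1) unfolding cbf_def by auto
  obtain X :: "nat \<Rightarrow> real set" and p :: "nat \<Rightarrow> real \<Rightarrow> real" where X':
    "\<forall>n. finite (X n) \<and> X n \<noteq> {} \<and> X n \<subseteq> {0<..<1} \<and> (\<forall>x\<in>X n. 0 < p n x) \<and> (\<Sum>x\<in>X n. p n x) = 1"
    "\<forall>g\<in>borel_measurable borel. continuous_on {0..1} g \<longrightarrow>
      (\<lambda>n::nat. \<Sum>x\<in>X n. p n x * g x) \<longlonglongrightarrow> (LINT x|\<sigma>. g x)"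
    by (rule unit_dist_discretize[OF c(2)])
  then have X: "finite (X n)" "X n \<noteq> {}" "X n \<subseteq> {0<..<1}" "x \<in> X n \<Longrightarrow> 0 < p n x"
    "(\<Sum>x\<in>X n. p n x) = 1" for n x by auto
  note lim = X'(2)[rule_format]
  \<comment> \<open>Dividing by 1 - x compensates the factor 1 - x of the atomic case. The sum of
    these weights may diverge as atoms approach 1, but it cancels in s / \<open>F n s\<close> before
    the limit is taken.\<close>
  define w where "w n x = c * p n x / (1 - x)" for n x
  have wpos: "0 < w n x" if "x \<in> X n" for n x using X(3)[of n] X(4)[OF that] that c by (auto simp: w_def)
  define F where "F n s = (\<Sum>x\<in>X n. w n x * ((1 - x) * kern s x))" for n s
  have F: "F n s = c * (\<Sum>x\<in>X n. p n x * kern s x)" for n s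
    unfolding F_def sum_distrib_left
  proof (intro sum.cong refl)
    fix x assume "x \<in> X n"
    then have "x < 1" using X(3)[of n] by auto
    then show "w n x * ((1 - x) * kern s x) = c * (p n x * kern s x)" by (simp add: w_def)
  qed
  have sw: "0 < (\<Sum>x\<in>X n. w n x)" for n using X wpos by (intro sum_pos) auto
  have cb: "cbf (\<lambda>s. s / F n s)" for n
  proof -
    have "cbf (\<lambda>s. (s / F n s - s / (\<Sum>x\<in>X n. w n x)) + 1 / (\<Sum>x\<in>X n. w n x) * s)"
      unfolding F_def by (intro cbf_add cbf_recip_atomic' X wpos cbf_scale cbf_id) (use sw in auto)
    then show ?thesis by simp
  qed
  show ?thesis
  proof (rule cbf_limit[OF cb])
    fix s :: real assume s: "0 < s"
    have "(\<lambda>n. F n s) \<longlonglongrightarrow> c * (LINT x|\<sigma>. kern s x)"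
      unfolding F by (intro tendsto_intros lim kern_continuous s) auto
    then show "(\<lambda>n. s / F n s) \<longlonglongrightarrow> s / f s"
      using c s cbf_pos[OF assms s] by (intro tendsto_divide) auto
  qed (use cbf_pos[OF assms, of 1] in auto)
qed

text \<open>Here the factor 1 - x stays in the integrand, the atomic weights sum to 1, and so the
  subtracted term is exactly s for every n. With f = 1 - R the result is s R / (1 - R), the
  S-transform along R; \<open>f 1 < 1\<close> keeps the limit positive at 1.\<close>

lemma cbf_recip_minus:
  assumes "unit_dist m" and f: "\<And>s. 0 < s \<Longrightarrow> f s = (LINT x|m. (1 - x) * kern s x)"
    and pos: "\<And>s. 0 < s \<Longrightarrow> 0 < f s" and "f 1 < 1"
  shows "cbf (\<lambda>s. s / f s - s)"
proof -
  obtain X :: "nat \<Rightarrow> real set" and p :: "nat \<Rightarrow> real \<Rightarrow> real" where X':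
    "\<forall>n. finite (X n) \<and> X n \<noteq> {} \<and> X n \<subseteq> {0<..<1} \<and> (\<forall>x\<in>X n. 0 < p n x) \<and> (\<Sum>x\<in>X n. p n x) = 1"
    "\<forall>g\<in>borel_measurable borel. continuous_on {0..1} g \<longrightarrow>
      (\<lambda>n::nat. \<Sum>x\<in>X n. p n x * g x) \<longlonglongrightarrow> (LINT x|m. g x)"
    by (rule unit_dist_discretize[OF assms(1)])
  then have X: "finite (X n)" "X n \<noteq> {}" "X n \<subseteq> {0<..<1}" "x \<in> X n \<Longrightarrow> 0 < p n x"
    "(\<Sum>x\<in>X n. p n x) = 1" for n x by auto
  note lim = X'(2)[rule_format]
  show ?thesis
  proof (rule cbf_limit)
    show "cbf (\<lambda>s. s / (\<Sum>x\<in>X n. p n x * ((1 - x) * kern s x)) - s / (\<Sum>x\<in>X n. p n x))" for n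
      by (intro cbf_recip_atomic' X)
    fix s :: real assume s: "0 < s"
    have "(\<lambda>n. (\<Sum>x\<in>X n. p n x * ((1 - x) * kern s x))) \<longlonglongrightarrow> (LINT x|m. (1 - x) * kern s x)"
      by (intro lim continuous_intros kern_continuous s) auto
    then show "(\<lambda>n. s / (\<Sum>x\<in>X n. p n x * ((1 - x) * kern s x)) - s / (\<Sum>x\<in>X n. p n x)) \<longlonglongrightarrow> s / f s - s"
      unfolding X(5) using pos[OF s] f[OF s] by (intro tendsto_diff tendsto_divide) auto
  qed (use pos[of 1] \<open>f 1 < 1\<close> in auto)
qed

section \<open>Composition, means, powers and inverse functions\<close>

lemma cbf_recip_compose_kern:
  assumes g: "cbf g" and x: "x \<in> {0<..<1}"
  shows "cbf (\<lambda>s. kern (g s) x)"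
proof -
  \<comment> \<open>Extending the fraction by s / g(s) gives \<open>kern (g s) x\<close> = s / ((1 -
    x) s + x s / g(s)), which needs only a sum and two reciprocals.\<close>
  have "cbf (\<lambda>s. (1 - x) * s + x * (s / g s))"
    using x by (intro cbf_add cbf_scale cbf_id cbf_recip g) auto
  from cbf_recip[OF this] show ?thesis
  proof (rule cbf_cong)
    fix s :: real assume s: "0 < s"
    have gp: "0 < g s" by (rule cbf_pos[OF g s])
    have "(1 - x) * s + x * (s / g s) = s * ((1 - x) * g s + x) / g s"
      using gp by (simp add: field_simps)
    then show "s / ((1 - x) * s + x * (s / g s)) = kern (g s) x"
      using s gp by (simp add: kern_def)
  qed
qed

text \<open>Kernels of g are covered by the previous lemma; a general f is a limit of finite
  positive combinations of kernels.\<close>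

lemma cbf_compose:
  assumes f: "cbf f" and g: "cbf g"
  shows "cbf (\<lambda>s. f (g s))"
proof -
  obtain c \<sigma> where c: "0 < c" "unit_dist \<sigma>" "\<forall>s>0. f s = c * (LINT x|\<sigma>. kern s x)"
    using f unfolding cbf_def by auto
  obtain X :: "nat \<Rightarrow> real set" and p :: "nat \<Rightarrow> real \<Rightarrow> real" where X: 
    "\<forall>n. finite (X n) \<and> X n \<noteq> {} \<and> X n \<subseteq> {0<..<1} \<and> (\<forall>x\<in>X n. 0 < p n x) \<and> (\<Sum>x\<in>X n. p n x) = 1"
    "\<forall>g\<in>borel_measurable borel. continuous_on {0..1} g \<longrightarrow>
      (\<lambda>n::nat. \<Sum>x\<in>X n. p n x * g x) \<longlonglongrightarrow> (LINT x|\<sigma>. g x)"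
    by (rule unit_dist_discretize[OF c(2)])
  show ?thesis
  proof (rule cbf_limit)
    show "cbf (\<lambda>s. c * (\<Sum>x\<in>X n. p n x * kern (g s) x))" for n
      using X(1)[rule_format, of n] c by (intro cbf_scale cbf_sum cbf_recip_compose_kern g) blast+
    show "(\<lambda>n. c * (\<Sum>x\<in>X n. p n x * kern (g s) x)) \<longlonglongrightarrow> f (g s)" if "0 < s" for s
      using c(3)[rule_format, of "g s"] cbf_pos[OF g that]
      by (auto intro!: tendsto_intros X(2)[rule_format] kern_continuous)
  qed (use cbf_pos f g in auto)
qed

text \<open>Newton's iteration for the square root of \<open>f g\<close> only uses arithmetic and harmonic means.\<close>

lemma cbf_geometric_mean:
  assumes f: "cbf f" and g: "cbf g"
  shows "cbf (\<lambda>s. sqrt (f s * g s))"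
proof -
  define a where "a n s = ((\<lambda>a. (a + f s * g s / a) / 2) ^^ n) (f s)" for n s
  have a0: "a 0 s = f s" and aS: "a (Suc n) s = (a n s + f s * g s / a n s) / 2" for n s
    by (simp_all add: a_def)
  have cb: "cbf (a n) \<and> cbf (\<lambda>s. f s * g s / a n s)" for n
  proof (induction n)
    case 0
    have "cbf (\<lambda>s. f s * g s / a 0 s)"
      using g by (rule cbf_cong) (use cbf_pos[OF f] in \<open>force simp: a0\<close>)
    then show ?case using f by (simp add: a_def)
  next
    case (Suc n)
    \<comment> \<open>The next iterate is the arithmetic mean of \<open>a n\<close> and its partner
      \<open>h\<close>, and the next partner is their harmonic mean, formed by three reciprocals.
      Carrying both through the induction keeps the quotient f g / a in the class.\<close>
    define h where "h s = f s * g s / a n s" for s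
    have h: "cbf h" and an: "cbf (a n)" using Suc by (simp_all add: h_def[abs_def])
    have 1: "cbf (\<lambda>s. 1/2 * (a n s + h s))" by (intro cbf_scale cbf_add an h) auto
    have "cbf (\<lambda>s. s / (1/2 * (s / a n s + s / h s)))"
      by (intro cbf_scale cbf_add cbf_recip an h) auto
    then have "cbf (\<lambda>s. f s * g s / a (Suc n) s)"
    proof (rule cbf_cong)
      fix s :: real assume s: "0 < s"
      note p = cbf_pos[OF an s] cbf_pos[OF h s]
      have fg: "f s * g s = a n s * h s" using p by (simp add: h_def)
      have "a n s + h s > 0" using p by simp
      then show "s / (1/2 * (s / a n s + s / h s)) = f s * g s / a (Suc n) s"
        (is "s / (1/2 * ?d) = _")
      proof -
        have "?d = s * (a n s + h s) / (a n s * h s)" using p by (simp add: field_simps)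
        then show ?thesis unfolding aS h_def[symmetric] unfolding fg using p s by simp
      qed
    qed
    then show ?case using 1 by (simp add: aS[abs_def] h_def)
  qed
  show ?thesis
  proof (rule cbf_limit)
    show "cbf (a n)" for n using cb by blast
    fix s :: real assume s: "0 < s"
    define r where "r = sqrt (f s * g s)"
    have fg: "0 < f s" "0 < g s" using cbf_pos f g s by auto
    have r: "r > 0" "f s * g s = r * r" using fg by (auto simp: r_def)
    have ap: "0 < a n s" for n using cb cbf_pos s by blast
    have step: "a (Suc n) s - r = (a n s - r)\<^sup>2 / (2 * a n s)" for n
      unfolding aS r(2) using ap[of n] by (simp add: field_simps power2_eq_square)
    \<comment> \<open>The start f s may lie below the root; all later iterates lie above it, hence
      the shift of the index by one.\<close>
    have ge: "a (Suc n) s \<ge> r" for n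
      using step[of n] ap[of n] by (metis diff_ge_0_iff_ge divide_nonneg_pos mult_pos_pos zero_less_numeral zero_le_power2)
    have half: "a (Suc (Suc n)) s - r \<le> (a (Suc n) s - r) / 2" for n
    proof -
      have "(a (Suc n) s - r) * (a (Suc n) s - r) \<le> (a (Suc n) s - r) * a (Suc n) s"
        using ge[of n] r by (intro mult_left_mono) auto
      then show ?thesis unfolding step[of "Suc n"] using ap[of "Suc n"]
        by (simp add: divide_simps power2_eq_square)
    qed
    have bd: "a (Suc n) s - r \<le> (a 1 s - r) * (1/2) ^ n" for n
    proof (induction n)
      case (Suc n)
      then show ?case using half[of n] by simp
    qed simp
    have "(\<lambda>n. (a 1 s - r) * (1/2) ^ n) \<longlonglongrightarrow> (a 1 s - r) * 0"
      by (intro tendsto_intros LIMSEQ_power_zero) auto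
    then have l: "(\<lambda>n. (a 1 s - r) * (1/2) ^ n) \<longlonglongrightarrow> 0" by simp
    have nb: "norm (a (Suc n) s - r) \<le> (a 1 s - r) * (1/2) ^ n" for n
      using bd[of n] ge[of n] by simp
    have "(\<lambda>n. a (Suc n) s - r) \<longlonglongrightarrow> 0"
      by (rule Lim_null_comparison[OF always_eventually[OF allI] l]) (rule nb)
    then have "(\<lambda>n. a (Suc n) s) \<longlonglongrightarrow> r" by (rule LIM_zero_cancel)
    then show "(\<lambda>n. a n s) \<longlonglongrightarrow> sqrt (f s * g s)" unfolding r_def by (rule LIMSEQ_imp_Suc)
  qed (use cbf_pos[OF f, of 1] cbf_pos[OF g, of 1] in auto)
qed

text \<open>An exponent k / 2^(n+1) is the mean of i / 2^n and j / 2^n with i + j = k, so the power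
  is a geometric mean of two powers of the previous level.\<close>

lemma cbf_powr_dyadic:
  assumes f: "cbf f" and "k \<le> 2 ^ n"
  shows "cbf (\<lambda>s. f s powr (real k / 2 ^ n))"
  using assms(2)
proof (induction n arbitrary: k)
  case 0
  then consider "k = 0" | "k = 1" by force
  then show ?case
  proof cases
    case 1
    show ?thesis by (rule cbf_cong[OF cbf_const[of 1]]) (use cbf_pos[OF f] 1 in force)+
  next
    case 2
    show ?thesis by (rule cbf_cong[OF f]) (use cbf_pos[OF f] 2 in force)+
  qed
next
  case (Suc n)
  define i where "i = k div 2"
  define j where "j = k - i"
  have ij: "i \<le> 2 ^ n" "j \<le> 2 ^ n" "k = i + j" using Suc.prems by (auto simp: i_def j_def)
  from cbf_geometric_mean[OF Suc.IH[OF ij(1)] Suc.IH[OF ij(2)]]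
  show ?case
  proof (rule cbf_cong)
    fix s :: real assume "0 < s"
    then have "0 < f s" using cbf_pos[OF f] by auto
    then show "sqrt (f s powr (real i / 2 ^ n) * f s powr (real j / 2 ^ n)) = f s powr (real k / 2 ^ Suc n)"
      by (simp add: ij(3) powr_half_sqrt[symmetric] powr_powr flip: powr_add add_divide_distrib) (simp add: field_simps)
  qed
qed

text \<open>The exponent is approximated from below by its dyadic truncations.\<close>

lemma cbf_powr:
  assumes f: "cbf f" and a: "0 \<le> a" "a \<le> 1"
  shows "cbf (\<lambda>s. f s powr a)"
proof (rule cbf_limit)
  define k where "k n = nat \<lfloor>a * 2 ^ n\<rfloor>" for n :: nat
  have kr: "real (k n) = \<lfloor>a * 2 ^ n\<rfloor>" for n using a by (simp add: k_def)
  have le: "a * 2 ^ n \<le> 2 ^ n" for n using a by simp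
  have "real (k n) \<le> real (2 ^ n)" for n
    using order_trans[OF of_int_floor_le le[of n]] by (simp add: kr)
  then have "k n \<le> 2 ^ n" for n unfolding of_nat_le_iff .
  then show "cbf (\<lambda>s. f s powr (real (k n) / 2 ^ n))" for n by (rule cbf_powr_dyadic[OF f])
  have "(\<lambda>n. real (k n) / 2 ^ n - a) \<longlonglongrightarrow> 0"
  proof (rule Lim_null_comparison[OF always_eventually])
    show "(\<lambda>n. (1/2) ^ n :: real) \<longlonglongrightarrow> 0" by (intro LIMSEQ_power_zero) auto
    show "\<forall>n. norm (real (k n) / 2 ^ n - a) \<le> (1/2) ^ n"
    proof
      fix n :: nat
      have "\<bar>real (k n) - a * 2 ^ n\<bar> \<le> 1" unfolding kr by linarith
      moreover have "real (k n) / 2 ^ n - a = (real (k n) - a * 2 ^ n) / 2 ^ n" by (simp add: field_simps)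
      ultimately show "norm (real (k n) / 2 ^ n - a) \<le> (1/2) ^ n"
        by (simp add: abs_divide power_one_over divide_right_mono)
    qed
  qed
  then have "(\<lambda>n. real (k n) / 2 ^ n) \<longlonglongrightarrow> a" by (rule LIM_zero_cancel)
  then show "(\<lambda>n. f s powr (real (k n) / 2 ^ n)) \<longlonglongrightarrow> f s powr a" if "0 < s" for s
    using cbf_pos[OF f that] by (intro tendsto_powr tendsto_const) auto
qed (use cbf_pos[OF f, of 1] in auto)

text \<open>As f increases and f(t) / t decreases, f(t) lies between f(s) min(1, t / s) and f(s)
  max(1, t / s); both bounds tend to f(s).\<close>

lemma cbf_isCont:
  assumes f: "cbf f" and s: "0 < s"
  shows "isCont f s"
proof -
  have up: "f t \<le> f s * max 1 (t / s)" if "0 < t" for t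
    using cbf_mono[OF f s, of t] cbf_mono[OF f that, of s] that s cbf_pos[OF f s]
    by (cases "s \<le> t") (auto simp: field_simps max_def)
  have lo: "f s * min 1 (t / s) \<le> f t" if "0 < t" for t
    using cbf_mono[OF f s, of t] cbf_mono[OF f that, of s] that s cbf_pos[OF f s]
    by (cases "s \<le> t") (auto simp: field_simps min_def)
  have ev: "\<forall>\<^sub>F t in at s. 0 < t" using s by (intro order_tendstoD) (auto intro: tendsto_ident_at)
  have "(\<lambda>t. f s * max 1 (t / s)) \<midarrow>s\<rightarrow> f s * max 1 (s / s)" "(\<lambda>t. f s * min 1 (t / s)) \<midarrow>s\<rightarrow> f s * min 1 (s / s)"
    using s by (intro tendsto_intros; simp)+
  then have l: "(\<lambda>t. f s * max 1 (t / s)) \<midarrow>s\<rightarrow> f s" "(\<lambda>t. f s * min 1 (t / s)) \<midarrow>s\<rightarrow> f s"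
    using s by simp_all
  have "f \<midarrow>s\<rightarrow> f s"
    by (rule tendsto_sandwich[OF _ _ l(2) l(1)]) (use ev in eventually_elim, simp add: up lo)+
  then show ?thesis by (simp add: isCont_def)
qed

lemma cbf_mult_id_strict_mono:
  assumes "cbf B" "0 < v" "v < w"
  shows "v * B v < w * B w"
  using cbf_mono(1)[OF assms(1,2), of w] cbf_pos[OF assms(1,2)] assms
  by (intro mult_less_le_imp_less) auto

text \<open>The iteration \<open>w \<mapsto> sqrt (w * s / B w)\<close> halves the logarithmic distance to the solution.\<close>

lemma cbf_inverse_of_mult_id:
  assumes B: "cbf B"
  obtains \<omega> where "cbf \<omega>" "\<And>s. 0 < s \<Longrightarrow> \<omega> s * B (\<omega> s) = s"
proof -
  have "\<exists>w>0. w * B w = s" if s: "0 < s" for s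
  proof -
    \<comment> \<open>\<open>u\<close> and \<open>v\<close> bracket the solution: u \<le> 1 \<le> v
      orders the values of \<open>B\<close>, and u \<le> s / B 1 \<le> v orders the
      arguments.\<close>
    define u where "u = min 1 (s / B 1)"
    define v where "v = max 1 (s / B 1)"
    have b1: "0 < B 1" using cbf_pos[OF B] by simp
    have uv: "0 < u" "u \<le> v" "u \<le> 1" "1 \<le> v" "u \<le> s / B 1" "s / B 1 \<le> v" using b1 s by (auto simp: u_def v_def)
    have "u * B u \<le> s / B 1 * B 1" using uv cbf_mono(1)[OF B, of u 1] cbf_pos[OF B, of u] b1 s by (intro mult_mono) auto
    moreover have "s / B 1 * B 1 \<le> v * B v" using uv cbf_mono(1)[OF B, of 1 v] b1 s by (intro mult_mono) auto
    ultimately have "\<exists>w\<ge>u. w \<le> v \<and> w * B w = s"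
      using uv b1 by (intro IVT) (auto intro!: continuous_intros cbf_isCont[OF B])
    then obtain w where "u \<le> w" "w * B w = s" by blast
    then show ?thesis using uv(1) by (intro exI[of _ w]) auto
  qed
  then have "\<forall>s. \<exists>w. 0 < s \<longrightarrow> 0 < w \<and> w * B w = s" by blast
  from choice[OF this] obtain w where "\<forall>s. 0 < s \<longrightarrow> 0 < w s \<and> w s * B (w s) = s" by blast
  then have w: "\<And>s. 0 < s \<Longrightarrow> 0 < w s" "\<And>s. 0 < s \<Longrightarrow> w s * B (w s) = s" by blast+
  define a where "a n s = ((\<lambda>x. sqrt (x * (s / B x))) ^^ n) s" for n s
  have a0: "a 0 s = s" and aS: "a (Suc n) s = sqrt (a n s * (s / B (a n s)))" for n s
    by (simp_all add: a_def)
  have cb: "cbf (a n)" for n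
  proof (induction n)
    case 0
    show ?case using cbf_id by (simp add: a0[abs_def])
  next
    case (Suc n)
    show ?case unfolding aS[abs_def] by (intro cbf_geometric_mean cbf_recip Suc cbf_compose[OF B])
  qed
  have "cbf w"
  proof (rule cbf_limit[OF cb])
    fix s :: real assume s: "0 < s"
    have ap: "0 < a n s" for n using cbf_pos[OF cb s] .
    have half: "\<bar>ln (a (Suc n) s) - ln (w s)\<bar> \<le> \<bar>ln (a n s) - ln (w s)\<bar> / 2" for n
    proof -
      define x where "x = a n s"
      define y where "y = w s"
      have p: "0 < x" "0 < y" "0 < B x" "0 < B y" "y * B y = s" using ap w s cbf_pos[OF B] by (auto simp: x_def y_def)
      have "ln (a (Suc n) s) = (ln x + ln s - ln (B x)) / 2"
        unfolding aS x_def[symmetric] using p s by (simp add: ln_sqrt ln_mult ln_div)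
      moreover have "ln s = ln y + ln (B y)" using p by (simp add: ln_mult flip: p(5))
      ultimately have *: "ln (a (Suc n) s) - ln y = ((ln x - ln y) - (ln (B x) - ln (B y))) / 2" by (simp add: field_simps)
      \<comment> \<open>In logarithmic coordinates \<open>B\<close> is increasing and 1-Lipschitz,
        because B(v) and v / B(v) both increase. Hence the difference ln x - ln y is only reduced,
        never reversed, by subtracting that of ln B, and the division by 2 gives the
        contraction.\<close>
      have key: "ln (B u) \<le> ln (B v) \<and> ln (B v) - ln (B u) \<le> ln v - ln u" if "0 < u" "u \<le> v" for u v
      proof -
        have "0 < B u" "0 < B v" using that cbf_pos[OF B] by auto
        moreover have "ln (B v / v) \<le> ln (B u / u)" using cbf_mono(2)[OF B that] calculation that by (intro ln_mono) auto
        ultimately show ?thesis using cbf_mono(1)[OF B that] that by (simp add: ln_div)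
      qed
      show ?thesis unfolding x_def[symmetric] y_def[symmetric] *
        using key[OF p(1), of y] key[OF p(2), of x] p by (cases "x \<le> y") auto
    qed
    have bd: "\<bar>ln (a n s) - ln (w s)\<bar> \<le> \<bar>ln s - ln (w s)\<bar> * (1/2) ^ n" for n
    proof (induction n)
      case (Suc n)
      then show ?case using half[of n] by simp
    qed (simp add: a0)
    have "(\<lambda>n. \<bar>ln s - ln (w s)\<bar> * (1/2) ^ n) \<longlonglongrightarrow> \<bar>ln s - ln (w s)\<bar> * 0"
      by (intro tendsto_intros LIMSEQ_power_zero) auto
    then have l: "(\<lambda>n. \<bar>ln s - ln (w s)\<bar> * (1/2) ^ n) \<longlonglongrightarrow> 0" by simp
    have nb: "norm (ln (a n s) - ln (w s)) \<le> \<bar>ln s - ln (w s)\<bar> * (1/2) ^ n" for n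
      using bd[of n] by simp
    have "(\<lambda>n. ln (a n s) - ln (w s)) \<longlonglongrightarrow> 0"
      by (rule Lim_null_comparison[OF always_eventually[OF allI] l]) (rule nb)
    then have "(\<lambda>n. ln (a n s)) \<longlonglongrightarrow> ln (w s)" by (rule LIM_zero_cancel)
    from tendsto_exp[OF this] show "(\<lambda>n. a n s) \<longlonglongrightarrow> w s" using ap w(1)[OF s] by simp
  qed (use w in auto)
  from that[OF this w(2)] show ?thesis .
qed

section \<open>The transform R and free convolution\<close>

lemma prob_RplusD:
  assumes "\<mu> \<in> prob_Rplus"
  shows "real_distribution \<mu>" "AE u in \<mu>. 0 \<le> u"
proof -
  show "real_distribution \<mu>" using assms by (simp add: prob_Rplus_def)
  then interpret real_distribution \<mu> .
  have "prob {0..} = 1" using assms by (simp add: prob_Rplus_def)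
  then show "AE u in \<mu>. 0 \<le> u" by (subst (asm) prob_eq_1) auto
qed

lemma prob_RplusI:
  assumes "real_distribution \<mu>" "AE u in \<mu>. 0 \<le> u"
  shows "\<mu> \<in> prob_Rplus"
proof -
  interpret real_distribution \<mu> by fact
  have "prob {0..} = 1" using assms by (subst prob_eq_1) auto
  then show ?thesis using assms by (simp add: prob_Rplus_def)
qed

lemma prob_Rplus_distr:
  assumes "prob_space N" and [measurable]: "X \<in> borel_measurable N" and "AE x in N. 0 \<le> X x"
  shows "distr N borel X \<in> prob_Rplus"
proof -
  interpret prob_space N by fact
  show ?thesis by (intro prob_RplusI real_distribution_distr) (use assms in \<open>auto simp: AE_distr_iff\<close>)
qed

lemma delta0_prob_Rplus: "delta0 \<in> prob_Rplus"
proof -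
  have "distr delta0 borel (\<lambda>x. x) \<in> prob_Rplus"
    by (rule prob_Rplus_distr) (auto simp: prob_space_return AE_return)
  then show ?thesis by (simp add: distr_id2 cong: distr_cong)
qed

lemma real_distribution_eq_return:
  assumes "real_distribution \<mu>" "AE u in \<mu>. u = a"
  shows "\<mu> = return borel a"
proof (rule measure_eqI)
  interpret real_distribution \<mu> by fact
  show "sets \<mu> = sets (return borel a)" by simp
  fix A assume A: "A \<in> sets \<mu>"
  have "emeasure \<mu> A = emeasure \<mu> (if a \<in> A then UNIV else {})"
    by (rule emeasure_eq_AE) (use assms(2) A in \<open>auto elim!: eventually_mono\<close>)
  then show "emeasure \<mu> A = emeasure (return borel a) A"
    using A emeasure_space_1 by (auto simp: indicator_def)
qed

section \<open>The transform R of a law on the half-line\<close>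

definition stj :: "real measure \<Rightarrow> real \<Rightarrow> real" where
  "stj \<mu> s = (LINT u|\<mu>. 1 / (1 + s * u))"

lemma stj_kernel_bounds:
  fixes u :: real
  assumes "0 \<le> u" "0 \<le> s"
  shows "0 \<le> 1 / (1 + s * u)" "1 / (1 + s * u) \<le> 1"
proof -
  have "0 \<le> s * u" using assms by simp
  then show "0 \<le> 1 / (1 + s * u)" "1 / (1 + s * u) \<le> 1" by (auto simp: divide_simps)
qed

lemma stj_integrable:
  assumes "\<mu> \<in> prob_Rplus" "0 \<le> s"
  shows "integrable \<mu> (\<lambda>u. 1 / (1 + s * u))"
proof -
  interpret real_distribution \<mu> using assms(1) by (rule prob_RplusD)
  show ?thesis
    by (rule integrable_const_bound[of _ 1])
      (use prob_RplusD(2)[OF assms(1)] stj_kernel_bounds[OF _ assms(2)] in \<open>auto elim!: eventually_mono\<close>)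
qed

text \<open>The weight \<open>w\<close> may vanish somewhere, while a finite combination of kernels
  needs positive coefficients; the perturbation 1 / (n + 1) provides them and disappears in the
  limit.\<close>

lemma cbf_weighted:
  assumes m: "unit_dist m" and [measurable]: "w \<in> borel_measurable borel" and wc: "continuous_on {0..1} w"
    and w: "\<And>x. x \<in> {0..1} \<Longrightarrow> 0 \<le> w x" and f: "\<And>s. 0 < s \<Longrightarrow> f s = (LINT x|m. w x * kern s x)" and "0 < f 1"
  shows "cbf f"
proof -
  obtain X :: "nat \<Rightarrow> real set" and p :: "nat \<Rightarrow> real \<Rightarrow> real" where X: 
    "\<forall>n. finite (X n) \<and> X n \<noteq> {} \<and> X n \<subseteq> {0<..<1} \<and> (\<forall>x\<in>X n. 0 < p n x) \<and> (\<Sum>x\<in>X n. p n x) = 1"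
    "\<forall>g\<in>borel_measurable borel. continuous_on {0..1} g \<longrightarrow>
      (\<lambda>n::nat. \<Sum>x\<in>X n. p n x * g x) \<longlonglongrightarrow> (LINT x|m. g x)"
    by (rule unit_dist_discretize[OF m])
  show ?thesis
  proof (rule cbf_limit)
    show "cbf (\<lambda>s. \<Sum>x\<in>X n. (p n x * (w x + 1 / (real n + 1))) * kern s x)" for n
    proof (intro cbf_sum cbf_scale cbf_kern)
      fix x assume x: "x \<in> X n"
      then have "x \<in> {0..1}" "0 < p n x" using X(1)[rule_format, of n] by force+
      then show "x \<in> {0..1}" "0 < p n x * (w x + 1 / (real n + 1))"
        using w[of x] by (auto intro!: mult_pos_pos add_nonneg_pos)
    qed (use X(1) in auto)
    fix s :: real assume s: "0 < s"
    have "(\<lambda>n. (\<Sum>x\<in>X n. p n x * (w x * kern s x)) + 1 / (real n + 1) * (\<Sum>x\<in>X n. p n x * kern s x))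
        \<longlonglongrightarrow> (LINT x|m. w x * kern s x) + 0 * (LINT x|m. kern s x)"
      by (intro tendsto_add tendsto_mult X(2)[rule_format] continuous_intros wc kern_continuous s) (measurable, real_asymp, measurable)
    then show "(\<lambda>n. \<Sum>x\<in>X n. (p n x * (w x + 1 / (real n + 1))) * kern s x) \<longlonglongrightarrow> f s"
      by (simp add: f[OF s] sum_distrib_left sum.distrib[symmetric] algebra_simps)
  qed fact
qed

lemma unit_dist_of_Rplus:
  assumes "\<mu> \<in> prob_Rplus"
  defines "m \<equiv> distr \<mu> borel (\<lambda>u. 1 / (1 + u))"
  shows "unit_dist m"
    and "f \<in> borel_measurable borel \<Longrightarrow> (LINT x|m. f x) = (LINT u|\<mu>. f (1 / (1 + u)) :: real)"
proof -
  interpret real_distribution \<mu> using assms(1) by (rule prob_RplusD)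
  have "AE u in \<mu>. 1 / (1 + u) \<in> {0..1}"
    using prob_RplusD(2)[OF assms(1)] by (auto elim!: eventually_mono)
  then show "unit_dist m" unfolding unit_dist_def m_def by (auto simp: AE_distr_iff)
  show "f \<in> borel_measurable borel \<Longrightarrow> (LINT x|m. f x) = (LINT u|\<mu>. f (1 / (1 + u)) :: real)"
    unfolding m_def by (rule integral_distr) auto
qed

text \<open>Under x = 1 / (1 + u) the weights x and 1 - x turn the kernel into the integrands of s
  R(s) and of 1 - R(s), so both are weighted averages of kernels over one law on [0,1].\<close>

lemma kern_Rplus:
  assumes "0 \<le> u" "0 < s"
  shows "1 / (1 + u) * kern s (1 / (1 + u)) = s * (1 / (1 + s * u))"
    and "(1 - 1 / (1 + u)) * kern s (1 / (1 + u)) = 1 - 1 / (1 + s * u)"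
proof -
  have p: "0 < 1 + s * u" using assms by (intro add_pos_nonneg) auto
  have "(1 - 1 / (1 + u)) * s + 1 / (1 + u) = (1 + s * u) / (1 + u)"
    using assms by (simp add: field_simps)
  then have k: "kern s (1 / (1 + u)) = s * (1 + u) / (1 + s * u)" by (simp add: kern_def)
  show "1 / (1 + u) * kern s (1 / (1 + u)) = s * (1 / (1 + s * u))" unfolding k using assms by simp
  have q: "1 - 1 / (1 + s * u) = s * u / (1 + s * u)" using p by (simp add: field_simps)
  have "1 - 1 / (1 + u) = u / (1 + u)" using assms by (simp add: field_simps)
  then show "(1 - 1 / (1 + u)) * kern s (1 / (1 + u)) = 1 - 1 / (1 + s * u)"
    unfolding k using assms q by simp
qed

lemma stj_le_1:
  assumes "\<mu> \<in> prob_Rplus" "0 \<le> s"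
  shows "stj \<mu> s \<le> 1"
proof -
  interpret real_distribution \<mu> using assms(1) by (rule prob_RplusD)
  show ?thesis unfolding stj_def
    by (rule integral_le_const[OF stj_integrable[OF assms]])
       (use prob_RplusD(2)[OF assms(1)] stj_kernel_bounds[OF _ assms(2)] in \<open>auto elim!: eventually_mono\<close>)
qed

text \<open>The integrand decreases strictly in s unless u = 0; equality of the integrals would
  force u = 0 almost surely.\<close>

lemma stj_strict_antimono:
  assumes \<mu>: "\<mu> \<in> prob_Rplus" "\<mu> \<noteq> delta0" and s: "0 \<le> s" "s < t"
  shows "stj \<mu> t < stj \<mu> s"
proof -
  interpret real_distribution \<mu> using \<mu>(1) by (rule prob_RplusD)
  note i = stj_integrable[OF \<mu>(1), of s] stj_integrable[OF \<mu>(1), of t]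
  have pos: "0 \<le> 1 / (1 + s * u) - 1 / (1 + t * u)" if "0 \<le> u" for u
    using that s by (auto intro!: divide_left_mono mult_right_mono mult_pos_pos add_pos_nonneg)
  have z: "u = 0" if "0 \<le> u" "1 / (1 + s * u) - 1 / (1 + t * u) = 0" for u
  proof -
    have "0 < 1 + s * u" "0 < 1 + t * u" using that(1) s by (auto intro!: add_pos_nonneg)
    moreover have "1 / (1 + s * u) = 1 / (1 + t * u)" using that(2) by simp
    ultimately show ?thesis using s by (simp only: divide_cancel_left) simp
  qed
  have nn: "AE u in \<mu>. 0 \<le> 1 / (1 + s * u) - 1 / (1 + t * u)"
    using prob_RplusD(2)[OF \<mu>(1)] by eventually_elim (rule pos)
  have "stj \<mu> s - stj \<mu> t = (LINT u|\<mu>. 1 / (1 + s * u) - 1 / (1 + t * u))"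
    unfolding stj_def using i s by simp
  moreover have "0 \<le> (LINT u|\<mu>. 1 / (1 + s * u) - 1 / (1 + t * u))" using nn by (rule integral_nonneg_AE)
  moreover have "(LINT u|\<mu>. 1 / (1 + s * u) - 1 / (1 + t * u)) \<noteq> 0"
  proof
    assume "(LINT u|\<mu>. 1 / (1 + s * u) - 1 / (1 + t * u)) = 0"
    then have "AE u in \<mu>. 1 / (1 + s * u) - 1 / (1 + t * u) = 0"
      using i s nn by (subst (asm) integral_nonneg_eq_0_iff_AE) auto
    then have "AE u in \<mu>. u = 0" using prob_RplusD(2)[OF \<mu>(1)] by eventually_elim (rule z)
    then show False using real_distribution_eq_return[OF prob_RplusD(1)[OF \<mu>(1)]] \<mu>(2) by auto
  qed
  ultimately show ?thesis by linarith
qed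

lemma stj_0:
  assumes "\<mu> \<in> prob_Rplus"
  shows "stj \<mu> 0 = 1"
proof -
  interpret real_distribution \<mu> using assms by (rule prob_RplusD)
  show ?thesis using prob_space by (simp add: stj_def)
qed

lemma stj_pos_less_1:
  assumes \<mu>: "\<mu> \<in> prob_Rplus" "\<mu> \<noteq> delta0" and s: "0 < s"
  shows "0 < stj \<mu> s" "stj \<mu> s < 1"
proof -
  have "0 \<le> stj \<mu> (s + 1)"
    unfolding stj_def using prob_RplusD(2)[OF \<mu>(1)] stj_kernel_bounds[of _ "s + 1"] s
    by (intro integral_nonneg_AE) (auto elim!: eventually_mono)
  then show "0 < stj \<mu> s" using stj_strict_antimono[OF \<mu>, of s "s + 1"] s by simp
  show "stj \<mu> s < 1" using stj_strict_antimono[OF \<mu>, of 0 s] s stj_0[OF \<mu>(1)] by simp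
qed

text \<open>The first two are weighted averages of kernels. The third is s / (1 - R) - s, obtained
  from \<open>cbf_recip_minus\<close>, and the fourth is the reciprocal of s R.\<close>

lemma stj_cbf:
  assumes \<mu>: "\<mu> \<in> prob_Rplus" "\<mu> \<noteq> delta0"
  shows "cbf (\<lambda>s. s * stj \<mu> s)" "cbf (\<lambda>s. 1 - stj \<mu> s)" "cbf (\<lambda>s. s * stj \<mu> s / (1 - stj \<mu> s))"
    "cbf (\<lambda>s. 1 / stj \<mu> s)"
proof -
  interpret real_distribution \<mu> using \<mu>(1) by (rule prob_RplusD)
  note U = unit_dist_of_Rplus[OF \<mu>(1)]
  note AE = prob_RplusD(2)[OF \<mu>(1)]
  have e1: "s * stj \<mu> s = (LINT x|distr \<mu> borel (\<lambda>u. 1 / (1 + u)). x * kern s x)" if s: "0 < s" for s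
  proof -
    have "(LINT x|distr \<mu> borel (\<lambda>u. 1 / (1 + u)). x * kern s x) = (LINT u|\<mu>. s * (1 / (1 + s * u)))"
    proof (subst U(2), measurable, rule integral_cong_AE)
      show "AE u in \<mu>. 1 / (1 + u) * kern s (1 / (1 + u)) = s * (1 / (1 + s * u))"
        using AE by eventually_elim (rule kern_Rplus[OF _ s])
    qed auto
    also have "\<dots> = s * stj \<mu> s" unfolding stj_def by (rule integral_mult_right_zero)
    finally show ?thesis by simp
  qed
  have e2: "1 - stj \<mu> s = (LINT x|distr \<mu> borel (\<lambda>u. 1 / (1 + u)). (1 - x) * kern s x)" if s: "0 < s" for s
  proof -
    have "(LINT x|distr \<mu> borel (\<lambda>u. 1 / (1 + u)). (1 - x) * kern s x) = (LINT u|\<mu>. 1 - 1 / (1 + s * u))"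
    proof (subst U(2), measurable, rule integral_cong_AE)
      show "AE u in \<mu>. (1 - 1 / (1 + u)) * kern s (1 / (1 + u)) = 1 - 1 / (1 + s * u)"
        using AE by eventually_elim (rule kern_Rplus[OF _ s])
    qed auto
    also have "\<dots> = 1 - stj \<mu> s"
      unfolding stj_def using stj_integrable[OF \<mu>(1), of s] s prob_space by simp
    finally show ?thesis by simp
  qed
  show c1: "cbf (\<lambda>s. s * stj \<mu> s)"
    by (rule cbf_weighted[OF U(1) _ _ _ e1]) (use stj_pos_less_1[OF \<mu>] in \<open>auto intro!: continuous_intros\<close>)
  show "cbf (\<lambda>s. 1 - stj \<mu> s)"
    by (rule cbf_weighted[OF U(1) _ _ _ e2]) (use stj_pos_less_1[OF \<mu>] in \<open>auto intro!: continuous_intros\<close>)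
  have "cbf (\<lambda>s. s / (1 - stj \<mu> s) - s)"
    by (rule cbf_recip_minus[OF U(1) e2]) (use stj_pos_less_1[OF \<mu>] in auto)
  then show "cbf (\<lambda>s. s * stj \<mu> s / (1 - stj \<mu> s))"
  proof (rule cbf_cong)
    fix s :: real assume "0 < s"
    then have "1 - stj \<mu> s \<noteq> 0" using stj_pos_less_1[OF \<mu>] by force
    then show "s / (1 - stj \<mu> s) - s = s * stj \<mu> s / (1 - stj \<mu> s)" by (simp add: field_simps)
  qed
  show "cbf (\<lambda>s. 1 / stj \<mu> s)" by (rule cbf_cong[OF cbf_recip[OF c1]]) auto
qed

lemma stj_isCont:
  assumes \<mu>: "\<mu> \<in> prob_Rplus" "\<mu> \<noteq> delta0" and s: "0 < s"
  shows "isCont (stj \<mu>) s"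
proof -
  have "isCont (\<lambda>s. 1 - (1 - stj \<mu> s)) s"
    by (intro continuous_intros cbf_isCont[OF stj_cbf(2)[OF \<mu>] s])
  then show ?thesis by simp
qed

text \<open>Dominated convergence: as s grows the integrand becomes the indicator of 0. With
  continuity, R therefore runs through the interval from the atom at 0 to 1, which is the domain of
  the S-transform shifted by 1.\<close>

lemma stj_limits:
  assumes \<mu>: "\<mu> \<in> prob_Rplus"
  shows "(\<lambda>n. stj \<mu> (1 / (real n + 1))) \<longlonglongrightarrow> 1"
    and "(\<lambda>n. stj \<mu> (real n + 1)) \<longlonglongrightarrow> measure \<mu> {0}"
proof -
  interpret real_distribution \<mu> using \<mu>(1) by (rule prob_RplusD)
  note AE = prob_RplusD(2)[OF \<mu>(1)]
  have bd: "AE u in \<mu>. norm (1 / (1 + s * u)) \<le> 1" if "0 \<le> s" for s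
    using AE by eventually_elim (use stj_kernel_bounds[OF _ that] in auto)
  have "(\<lambda>n. stj \<mu> (1 / (real n + 1))) \<longlonglongrightarrow> (LINT u|\<mu>. 1)"
    unfolding stj_def
  proof (rule integral_dominated_convergence[where w="\<lambda>_. 1"])
    show "AE u in \<mu>. (\<lambda>n. 1 / (1 + 1 / (real n + 1) * u)) \<longlonglongrightarrow> 1"
    proof (rule AE_I2)
      fix u :: real
      have "(\<lambda>n. 1 / (1 + 1 / (real n + 1) * u)) \<longlonglongrightarrow> 1 / (1 + 0 * u)"
        by (intro tendsto_divide tendsto_add tendsto_mult tendsto_const) (real_asymp, simp)
      then show "(\<lambda>n. 1 / (1 + 1 / (real n + 1) * u)) \<longlonglongrightarrow> 1" by simp
    qed
    show "AE u in \<mu>. norm (1 / (1 + 1 / (real n + 1) * u)) \<le> 1" for n by (rule bd) simp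
  qed auto
  then show "(\<lambda>n. stj \<mu> (1 / (real n + 1))) \<longlonglongrightarrow> 1" using prob_space by simp
  have "(\<lambda>n. stj \<mu> (real n + 1)) \<longlonglongrightarrow> (LINT u|\<mu>. indicator {0} u)"
    unfolding stj_def
  proof (rule integral_dominated_convergence[where w="\<lambda>_. 1"])
    show "AE u in \<mu>. (\<lambda>n. 1 / (1 + (real n + 1) * u)) \<longlonglongrightarrow> indicator {0} u"
      using AE
    proof eventually_elim
      case (elim u)
      show ?case
      proof (cases "u = 0")
        case False
        then have "0 < u" using elim by simp
        then have "(\<lambda>n. 1 / (1 + (real n + 1) * u)) \<longlonglongrightarrow> 0" by real_asymp
        then show ?thesis using False by simp
      qed simp
    qed
    show "AE u in \<mu>. norm (1 / (1 + (real n + 1) * u)) \<le> 1" for n by (rule bd) simp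
  qed auto
  then show "(\<lambda>n. stj \<mu> (real n + 1)) \<longlonglongrightarrow> measure \<mu> {0}" by simp
qed

lemma stj_greater_atom:
  assumes \<mu>: "\<mu> \<in> prob_Rplus" "\<mu> \<noteq> delta0" and s: "0 < s"
  shows "measure \<mu> {0} < stj \<mu> s"
proof -
  obtain N where N: "real N > s + 1" using reals_Archimedean2 by blast
  have "measure \<mu> {0} \<le> stj \<mu> (s + 1)"
  proof (rule LIMSEQ_le_const2[OF stj_limits(2)[OF \<mu>(1)]], intro exI allI impI)
    fix n assume "N \<le> n"
    then show "stj \<mu> (real n + 1) \<le> stj \<mu> (s + 1)"
      using N s by (intro less_imp_le stj_strict_antimono[OF \<mu>]) auto
  qed
  also have "\<dots> < stj \<mu> s" using s by (intro stj_strict_antimono[OF \<mu>]) auto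
  finally show ?thesis .
qed

lemma stj_surj:
  assumes \<mu>: "\<mu> \<in> prob_Rplus" "\<mu> \<noteq> delta0" and t: "measure \<mu> {0} < t" "t < 1"
  obtains s where "0 < s" "stj \<mu> s = t"
proof -
  obtain i where i: "t < stj \<mu> (1 / (real i + 1))"
    using order_tendstoD(1)[OF stj_limits(1)[OF \<mu>(1)] t(2)] eventually_sequentially by auto
  obtain j where j: "stj \<mu> (real j + 1) < t"
    using order_tendstoD(2)[OF stj_limits(2)[OF \<mu>(1)] t(1)] eventually_sequentially by auto
  have "1 / (real i + 1) \<le> real j + 1"
  proof -
    have "1 / (real i + 1) \<le> 1" by simp
    then show ?thesis by linarith
  qed
  then have "\<exists>x\<ge>1 / (real i + 1). x \<le> real j + 1 \<and> stj \<mu> x = t"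
    using i j by (intro IVT2) (auto intro!: stj_isCont[OF \<mu>] intro: less_le_trans[of 0 "1 / (real i + 1)"])
  then obtain x where "1 / (real i + 1) \<le> x" "stj \<mu> x = t" by blast
  moreover have "0 < 1 / (real i + 1)" by simp
  ultimately show ?thesis using that less_le_trans by blast
qed

lemma stj_inj:
  assumes \<mu>: "\<mu> \<in> prob_Rplus" "\<mu> \<noteq> delta0" and "0 < s" "0 < t" "stj \<mu> s = stj \<mu> t"
  shows "s = t"
  using stj_strict_antimono[OF \<mu>, of s t] stj_strict_antimono[OF \<mu>, of t s] assms(3-)
  by (cases s t rule: linorder_cases) auto

section \<open>Existence and uniqueness of a law with given R\<close>

lemma stj_exists:
  assumes cb: "cbf (\<lambda>s. s * G s)" and le: "\<And>s. 0 < s \<Longrightarrow> G s \<le> 1"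
    and sup: "\<And>\<epsilon>. 0 < \<epsilon> \<Longrightarrow> \<exists>s>0. 1 - \<epsilon> < G s"
  obtains \<mu> where "\<mu> \<in> prob_Rplus" "\<And>s. 0 < s \<Longrightarrow> stj \<mu> s = G s"
proof -
  obtain c \<sigma> where c: "0 < c" "unit_dist \<sigma>" "\<And>s. 0 < s \<Longrightarrow> s * G s = c * (LINT x|\<sigma>. kern s x)"
    using cb unfolding cbf_def by auto
  interpret S: real_distribution \<sigma> using c by (simp add: unit_dist_def)
  \<comment> \<open>The kernel divided by s, so that \<open>G\<close> itself is \<open>c\<close>
    times the average of \<open>k s\<close>. For x > 0 it has the finite limit 1 / x at s =
    0.\<close>
  define k where "k s x = 1 / ((1 - x) * s + x)" for s x :: real
  have km[measurable]: "k s \<in> borel_measurable borel" for s unfolding k_def by measurable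
  have kk: "kern s x = s * k s x" for s x by (simp add: kern_def k_def)
  have ki: "integrable \<sigma> (k s)" if "0 < s" for s
    using unit_dist_integrable_kern[OF c(2) that] that unfolding kk[abs_def] by simp
  have G: "G s = c * (LINT x|\<sigma>. k s x)" if "0 < s" for s
    using c(3)[OF that] that unfolding kk by simp
  have kpos: "0 < k s x" if "0 < s" "x \<in> {0..1}" for s x
    using kern_denom_pos[OF that] by (simp add: k_def)
  have kanti: "k t x \<le> k s x" if "0 < s" "s \<le> t" "x \<in> {0..1}" for s t x
    using that kern_denom_pos[of s x] kern_denom_pos[of t x] unfolding k_def
    by (intro divide_left_mono add_right_mono mult_left_mono mult_pos_pos) auto
  have Ganti: "G t \<le> G s" if "0 < s" "s \<le> t" for s t
    using that c(1) unfolding G[OF that(1)] G[OF less_le_trans[OF that]]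
    by (intro mult_left_mono integral_mono_AE ki unit_dist_AE[OF c(2)] kanti) auto
  have atom: "measure \<sigma> {0} = 0"
  proof (rule ccontr)
    assume "measure \<sigma> {0} \<noteq> 0"
    then have p: "0 < measure \<sigma> {0}" by (simp add: zero_less_measure_iff)
    \<comment> \<open>At x = 0 the function \<open>k s\<close> is 1 / s, so an atom there
      contributes c times its mass over s to \<open>G s\<close>. For this s the contribution is 2,
      against \<open>G s\<close> \<le> 1.\<close>
    define s where "s = c * measure \<sigma> {0} / 2"
    have s: "0 < s" using p c by (simp add: s_def)
    have "(LINT x|\<sigma>. 1 / s * indicator {0} x) \<le> (LINT x|\<sigma>. k s x)"
    proof (intro integral_mono_AE ki s unit_dist_AE[OF c(2)])
      show "1 / s * indicator {0} x \<le> k s x" if "x \<in> {0..1}" for x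
        using kpos[OF s that] by (cases "x = 0") (auto simp: k_def)
    qed (auto intro!: integrable_mult_right integrable_real_indicator simp: S.emeasure_eq_measure)
    then have "c * (measure \<sigma> {0} / s) \<le> G s" unfolding G[OF s] using c by (intro mult_left_mono) auto
    then show False using le[OF s] p c by (simp add: s_def)
  qed
  have AE0: "AE x in \<sigma>. 0 < x \<and> x \<le> 1"
  proof -
    have "AE x in \<sigma>. x \<noteq> 0" using atom by (intro AE_I[of _ _ "{0}"]) (auto simp: S.emeasure_eq_measure)
    moreover have "AE x in \<sigma>. x \<in> {0..1}" using c(2) by (simp add: unit_dist_def)
    ultimately show ?thesis by eventually_elim auto
  qed
  have lim: "(\<lambda>n. G (1 / (real n + 1))) \<longlonglongrightarrow> 1"
  proof (rule LIMSEQ_I)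
    fix \<epsilon> :: real assume "0 < \<epsilon>"
    then obtain s where s: "0 < s" "1 - \<epsilon> < G s" using sup by blast
    obtain N where N: "1 / s < real N" using reals_Archimedean2 by blast
    have "norm (G (1 / (real n + 1)) - 1) < \<epsilon>" if "N \<le> n" for n
    proof -
      have "1 / s \<le> real n + 1" using N that by linarith
      then have "1 / (real n + 1) \<le> s" using s by (simp add: field_simps)
      from Ganti[OF _ this] s le[of "1 / (real n + 1)"] show ?thesis by simp
    qed
    then show "\<exists>no. \<forall>n\<ge>no. norm (G (1 / (real n + 1)) - 1) < \<epsilon>" by blast
  qed
  \<comment> \<open>Monotone convergence along s = 1 / (n + 1): \<open>k s\<close> increases to 1 /
    x while the integrals \<open>G s / c\<close> tend to 1 / c. Thus the density c / x has total
    mass 1.\<close>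
  have hbi: "has_bochner_integral \<sigma> (\<lambda>x. 1 / x) (1 / c)"
  proof (rule has_bochner_integral_monotone_convergence)
    show "integrable \<sigma> (k (1 / (real n + 1)))" for n by (rule ki) simp
    show "AE x in \<sigma>. mono (\<lambda>n. k (1 / (real n + 1)) x)"
    proof (rule unit_dist_AE[OF c(2)], rule monoI)
      fix x :: real and i j :: nat assume "x \<in> {0..1}" "i \<le> j"
      then show "k (1 / (real i + 1)) x \<le> k (1 / (real j + 1)) x"
        by (intro kanti) (auto intro!: divide_left_mono)
    qed
    show "AE x in \<sigma>. (\<lambda>n. k (1 / (real n + 1)) x) \<longlonglongrightarrow> 1 / x"
      using AE0
    proof eventually_elim
      case (elim x)
      have "(\<lambda>n. k (1 / (real n + 1)) x) \<longlonglongrightarrow> 1 / ((1 - x) * 0 + x)"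
        unfolding k_def by (intro tendsto_intros) (real_asymp, use elim in auto)
      then show ?case by simp
    qed
    have "(\<lambda>n. G (1 / (real n + 1)) / c) \<longlonglongrightarrow> 1 / c" using c by (intro tendsto_divide lim) auto
    then show "(\<lambda>n. LINT x|\<sigma>. k (1 / (real n + 1)) x) \<longlonglongrightarrow> 1 / c" using c by (simp add: G)
  qed auto
  define D where "D = density \<sigma> (\<lambda>x. ennreal (c / x))"
  have AEc: "AE x in \<sigma>. 0 \<le> c / x" using AE0 c by (auto elim!: eventually_mono)
  have "has_bochner_integral \<sigma> (\<lambda>x. c * (1 / x)) (c * (1 / c))"
    by (rule has_bochner_integral_mult_right) (use hbi in auto)
  then have "(\<integral>\<^sup>+x. ennreal (c / x) \<partial>\<sigma>) = ennreal 1"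
    using AEc c by (subst nn_integral_eq_integral) (auto simp: has_bochner_integral_iff)
  then have "emeasure D (space D) = 1" by (simp add: D_def emeasure_density)
  then interpret D: prob_space D by (rule prob_spaceI)
  have Dset: "sets D = sets borel" by (simp add: D_def)
  note Dset[measurable_cong]
  have DI: "AE x in D. P x" if "\<And>x. 0 < x \<Longrightarrow> x \<le> 1 \<Longrightarrow> P x" for P
    unfolding D_def by (subst AE_density, simp, rule eventually_mono[OF AE0]) (auto intro: that)
  \<comment> \<open>The inverse of u to 1 / (1 + u), the substitution that relates R to
    kernels.\<close>
  define \<mu> where "\<mu> = distr D borel (\<lambda>x. (1 - x) / x)"
  show ?thesis
  proof (rule that[of \<mu>])
    show "\<mu> \<in> prob_Rplus"
      unfolding \<mu>_def by (rule prob_Rplus_distr[OF D.prob_space_axioms]) (auto intro: DI)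
    fix s :: real assume s: "0 < s"
    have "stj \<mu> s = (LINT x|D. 1 / (1 + s * ((1 - x) / x)))"
      unfolding stj_def \<mu>_def by (subst integral_distr) auto
    also have "\<dots> = (LINT x|\<sigma>. c / x * (1 / (1 + s * ((1 - x) / x))))"
      unfolding D_def using AEc by (subst integral_density) auto
    also have "\<dots> = (LINT x|\<sigma>. c * k s x)"
    proof (rule integral_cong_AE)
      show "AE x in \<sigma>. c / x * (1 / (1 + s * ((1 - x) / x))) = c * k s x"
        using AE0
      proof eventually_elim
        case (elim x)
        then have "1 + s * ((1 - x) / x) = ((1 - x) * s + x) / x" by (simp add: field_simps)
        then show ?case using elim by (simp add: k_def)
      qed
    qed auto
    also have "\<dots> = G s" by (simp add: G[OF s])
    finally show "stj \<mu> s = G s" .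
  qed
qed

text \<open>With y = u / (1 + u) one has 1 / (1 + (1 - x) u) = (1 - y) / (1 - x y), so R(1 - x) is a
  power series in x whose coefficients are differences of consecutive moments of y. Equal transforms
  give equal moments, and these determine the law of y on [0,1].\<close>

lemma prob_Rplus_eqI_stj:
  assumes \<mu>: "\<mu> \<in> prob_Rplus" and \<nu>: "\<nu> \<in> prob_Rplus"
    and eq: "\<And>s. 0 < s \<Longrightarrow> stj \<mu> s = stj \<nu> s"
  shows "\<mu> = \<nu>"
proof -
  define a where "a N k = (LINT u|N. (1 - u / (1 + u)) * (u / (1 + u)) ^ k)" for N :: "real measure" and k :: nat
  have y01: "0 \<le> u / (1 + u)" "u / (1 + u) \<le> 1" "u / (1 + u) < 1" "1 - u / (1 + u) = 1 / (1 + u)" if "0 \<le> u" for u :: real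
    using that by (auto simp: field_simps)
  have series: "(\<lambda>k. a N k * x ^ k) sums stj N (1 - x)" if N: "N \<in> prob_Rplus" and x: "\<bar>x\<bar> < 1" for N x
  proof -
    interpret real_distribution N using N by (rule prob_RplusD)
    note AE = prob_RplusD(2)[OF N]
    define f where "f k u = (1 - u / (1 + u)) * (u / (1 + u)) ^ k * x ^ k" for k :: nat and u :: real
    have fm[measurable]: "f k \<in> borel_measurable borel" for k unfolding f_def by measurable
    have nf: "\<bar>f k u\<bar> \<le> \<bar>x\<bar> ^ k" if "0 \<le> u" for k u
    proof -
      have "\<bar>1 - z\<bar> * \<bar>z\<bar> ^ k * \<bar>x\<bar> ^ k \<le> 1 * 1 * \<bar>x\<bar> ^ k" if "0 \<le> z" "z \<le> 1" for z :: real
        by (intro mult_mono power_le_one) (use that in auto)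
      from this[OF y01(1,2)[OF that]]
      show ?thesis by (simp add: f_def abs_mult power_abs)
    qed
    have fi: "integrable N (f k)" for k
      by (rule integrable_const_bound[of _ "\<bar>x\<bar> ^ k"]) (use AE in \<open>auto elim!: eventually_mono intro: nf\<close>)
    have gs: "summable (\<lambda>k. \<bar>x\<bar> ^ k)" using x by (intro summable_geometric) auto
    have "(\<lambda>k. LINT u|N. f k u) sums (LINT u|N. (\<Sum>k. f k u))"
    proof (rule sums_integral[OF fi])
      show "AE u in N. summable (\<lambda>k. norm (f k u))"
        using AE by eventually_elim (rule summable_comparison_test'[OF gs, of 0], simp add: nf)
      show "summable (\<lambda>k. LINT u|N. norm (f k u))"
      proof (rule summable_comparison_test'[OF gs, of 0])
        fix k
        have "(LINT u|N. norm (f k u)) \<le> \<bar>x\<bar> ^ k"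
          by (rule integral_le_const) (use fi AE in \<open>auto elim!: eventually_mono intro: nf\<close>)
        then show "norm (LINT u|N. norm (f k u)) \<le> \<bar>x\<bar> ^ k" by simp
      qed
    qed
    also have "(LINT u|N. (\<Sum>k. f k u)) = stj N (1 - x)"
      unfolding stj_def
    proof (rule integral_cong_AE)
      show "AE u in N. (\<Sum>k. f k u) = 1 / (1 + (1 - x) * u)"
        using AE
      proof eventually_elim
        case (elim u)
        define y where "y = u / (1 + u)"
        have "\<bar>y * x\<bar> < 1"
        proof -
          have "\<bar>y\<bar> \<le> 1" using y01(1,2)[OF elim] unfolding y_def by linarith
          then have "\<bar>y\<bar> * \<bar>x\<bar> \<le> 1 * \<bar>x\<bar>" by (intro mult_right_mono) auto
          then show ?thesis using x by (simp add: abs_mult)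
        qed
        then have "(\<lambda>k. (1 - y) * (y * x) ^ k) sums ((1 - y) * (1 / (1 - y * x)))"
          by (intro sums_mult geometric_sums) auto
        then have "(\<Sum>k. f k u) = (1 - y) * (1 / (1 - y * x))"
          unfolding f_def y_def[symmetric] by (simp add: sums_iff power_mult_distrib mult.assoc)
        also have "1 - y = 1 / (1 + u)" using y01(4)[OF elim] by (simp add: y_def)
        also have "1 - y * x = (1 + (1 - x) * u) / (1 + u)" using elim by (simp add: y_def field_simps)
        finally show ?case using elim by simp
      qed
    qed auto
    also have "(\<lambda>k. LINT u|N. f k u) = (\<lambda>k. a N k * x ^ k)"
      by (simp add: f_def a_def)
    finally show ?thesis .
  qed
  have aeq: "a \<mu> k = a \<nu> k" for k
  proof (rule ccontr)
    define d where "d k = a \<mu> k - a \<nu> k" for k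
    have sd: "(\<lambda>k. d k * x ^ k) sums 0" if "\<bar>x\<bar> < 1" for x
      using sums_diff[OF series[OF \<mu> that] series[OF \<nu> that]] eq[of "1 - x"] that
      by (simp add: d_def left_diff_distrib)
    assume "a \<mu> k \<noteq> a \<nu> k"
    then have dk: "d k \<noteq> 0" by (simp add: d_def)
    have "d 0 = 0" using sd[of 0] by (simp add: powser_sums_zero_iff)
    then have "k > 0" using dk by (cases k) auto
    \<comment> \<open>Zeros of a nonzero power series are isolated, but this one vanishes on the
      whole unit disc. The argument is centred at a zero of the series, so the constant coefficient
      was settled first.\<close>
    show False
    proof (rule powser_0_nonzero[of 1 0 d "\<lambda>_. 0" k])
      fix s :: real assume s: "0 < s" "\<And>z::real. z \<in> cball 0 s - {0} \<Longrightarrow> (0::real) \<noteq> 0"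
      from s(2)[of s] s(1) show False by auto
    qed (use sd dk \<open>k > 0\<close> in auto)
  qed
  have mom: "(LINT u|\<mu>. (u / (1 + u)) ^ k) = (LINT u|\<nu>. (u / (1 + u)) ^ k)" for k
  proof (induction k)
    case 0
    show ?case using \<mu> \<nu> prob_RplusD(1) by (simp add: real_distribution_def prob_space.prob_space)
  next
    case (Suc k)
    have *: "a N k = (LINT u|N. (u / (1 + u)) ^ k) - (LINT u|N. (u / (1 + u)) ^ Suc k)"
      if N: "N \<in> prob_Rplus" for N
    proof -
      interpret real_distribution N using N by (rule prob_RplusD)
      have i: "integrable N (\<lambda>u. (u / (1 + u)) ^ k)" for k
        by (rule integrable_const_bound[of _ 1])
           (use prob_RplusD(2)[OF N] y01 in \<open>auto elim!: eventually_mono simp: power_abs intro!: power_le_one\<close>)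
      have "a N k = (LINT u|N. (u / (1 + u)) ^ k - (u / (1 + u)) ^ Suc k)"
        unfolding a_def by (simp only: left_diff_distrib mult_1_left power_Suc)
      also have "\<dots> = (LINT u|N. (u / (1 + u)) ^ k) - (LINT u|N. (u / (1 + u)) ^ Suc k)"
        by (rule Bochner_Integration.integral_diff[OF i i])
      finally show ?thesis .
    qed
    show ?case using *[OF \<mu>] *[OF \<nu>] aeq[of k] Suc by simp
  qed
  have U: "unit_dist (distr N borel (\<lambda>u. u / (1 + u)))" if N: "N \<in> prob_Rplus" for N
  proof -
    interpret real_distribution N using N by (rule prob_RplusD)
    show ?thesis unfolding unit_dist_def
      using prob_RplusD(2)[OF N] y01 by (auto simp: AE_distr_iff elim!: eventually_mono)
  qed
  have "distr \<mu> borel (\<lambda>u. u / (1 + u)) = distr \<nu> borel (\<lambda>u. u / (1 + u))"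
    using U[OF \<mu>] U[OF \<nu>] prob_RplusD(1)[OF \<mu>] prob_RplusD(1)[OF \<nu>] mom
    by (intro unit_dist_eqI) (auto simp: integral_distr real_distribution_def real_distribution_axioms_def)
  moreover have "distr (distr N borel (\<lambda>u. u / (1 + u))) borel (\<lambda>y. y / (1 - y)) = N" if N: "N \<in> prob_Rplus" for N
  proof -
    interpret real_distribution N using N by (rule prob_RplusD)
    have "distr (distr N borel (\<lambda>u. u / (1 + u))) borel (\<lambda>y. y / (1 - y)) =
        distr N borel (\<lambda>u. u / (1 + u) / (1 - u / (1 + u)))"
      by (subst distr_distr) (auto simp: o_def)
    also have "\<dots> = distr N borel (\<lambda>u. u)"
    proof (rule distr_cong_AE)
      show "AE u in N. u / (1 + u) / (1 - u / (1 + u)) = u"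
        using prob_RplusD(2)[OF N] by eventually_elim (simp add: y01)
    qed auto
    also have "\<dots> = N" by (rule distr_id2) simp
    finally show ?thesis .
  qed
  ultimately show ?thesis using \<mu> \<nu> by metis
qed

section \<open>S-transforms and the laws they prescribe\<close>

lemma psi_transform_stj:
  assumes "\<mu> \<in> prob_Rplus" "0 \<le> s"
  shows "psi_transform \<mu> (- s) = stj \<mu> s - 1"
proof -
  interpret real_distribution \<mu> using assms(1) by (rule prob_RplusD)
  have "psi_transform \<mu> (- s) = (LINT u|\<mu>. 1 / (1 + s * u) - 1)"
    unfolding psi_transform_def
  proof (rule integral_cong_AE)
    show "AE u in \<mu>. - s * u / (1 - - s * u) = 1 / (1 + s * u) - 1"
      using prob_RplusD(2)[OF assms(1)]
    proof eventually_elim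
      case (elim u)
      then have "1 + s * u \<noteq> 0" using assms(2) by (metis add_pos_nonneg less_irrefl mult_nonneg_nonneg zero_less_one)
      then show ?case by (simp add: field_simps)
    qed
  qed auto
  also have "\<dots> = stj \<mu> s - 1"
    unfolding stj_def using stj_integrable[OF assms] prob_space by simp
  finally show ?thesis .
qed

text \<open>Strict monotonicity of R makes psi injective, and its inverse takes R(s) - 1 to
  -s.\<close>

lemma S_transform_stj:
  assumes \<mu>: "\<mu> \<in> prob_Rplus" "\<mu> \<noteq> delta0" and s: "0 < s"
  shows "S_transform \<mu> (stj \<mu> s - 1) = s * stj \<mu> s / (1 - stj \<mu> s)"
proof -
  have "inj_on (psi_transform \<mu>) {..<0}"
  proof (rule inj_onI)
    fix x y :: real assume "x \<in> {..<0}" "y \<in> {..<0}" "psi_transform \<mu> x = psi_transform \<mu> y"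
    then show "x = y"
      using psi_transform_stj[OF \<mu>(1), of "- x"] psi_transform_stj[OF \<mu>(1), of "- y"]
        stj_inj[OF \<mu>, of "- x" "- y"] by auto
  qed
  then have "the_inv_into {..<0} (psi_transform \<mu>) (stj \<mu> s - 1) = - s"
    using s psi_transform_stj[OF \<mu>(1), of s] by (intro the_inv_into_f_eq) auto
  then show ?thesis using stj_pos_less_1[OF \<mu> s] by (simp add: S_transform_def divide_simps) (simp add: algebra_simps)
qed

text \<open>Relational substitute for \<open>measure_of_S\<close>. The atom \<open>m\<close> at 0 is
  part of it because it fixes the interval on which the S-transform lives; \<open>g\<close> is
  constrained on that interval only.\<close>

definition has_S :: "real measure \<Rightarrow> real \<Rightarrow> (real \<Rightarrow> real) \<Rightarrow> bool" where
  "has_S \<mu> m g \<longleftrightarrow> \<mu> \<in> prob_Rplus \<and> \<mu> \<noteq> delta0 \<and> measure \<mu> {0} = m \<and>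
     (\<forall>t\<in>{- 1 + m<..<0}. S_transform \<mu> t = g t)"

text \<open>Every t of the interval has the form R(s) - 1, so an identity along this curve is
  enough.\<close>

lemma has_SI_stj:
  assumes "\<mu> \<in> prob_Rplus" "\<mu> \<noteq> delta0" "measure \<mu> {0} = m"
    and "\<And>s. 0 < s \<Longrightarrow> s * stj \<mu> s / (1 - stj \<mu> s) = g (stj \<mu> s - 1)"
  shows "has_S \<mu> m g"
  unfolding has_S_def
proof (intro conjI ballI)
  fix t assume "t \<in> {- 1 + m<..<0}"
  then obtain s where "0 < s" "stj \<mu> s = t + 1"
    using stj_surj[OF assms(1,2), of "t + 1"] assms(3) by (metis add_less_cancel_right diff_add_cancel greaterThanLessThan_iff add_0 add.commute uminus_add_conv_diff less_diff_eq)
  then show "S_transform \<mu> t = g t"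
    using S_transform_stj[OF assms(1,2), of s] assms(4)[of s] by simp
qed (use assms in auto)

lemma has_S_self: "\<mu> \<in> prob_Rplus \<Longrightarrow> \<mu> \<noteq> delta0 \<Longrightarrow> has_S \<mu> (measure \<mu> {0}) (S_transform \<mu>)"
  by (simp add: has_S_def)

lemma has_S_stj:
  assumes "has_S \<mu> m g" "0 < s"
  shows "g (stj \<mu> s - 1) = s * stj \<mu> s / (1 - stj \<mu> s)" "stj \<mu> s - 1 \<in> {- 1 + m<..<0}"
proof -
  have \<mu>: "\<mu> \<in> prob_Rplus" "\<mu> \<noteq> delta0" "measure \<mu> {0} = m" using assms by (auto simp: has_S_def)
  show *: "stj \<mu> s - 1 \<in> {- 1 + m<..<0}"
    using stj_pos_less_1[OF \<mu>(1,2) assms(2)] stj_greater_atom[OF \<mu>(1,2) assms(2)] \<mu>(3) by auto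
  show "g (stj \<mu> s - 1) = s * stj \<mu> s / (1 - stj \<mu> s)"
    using S_transform_stj[OF \<mu>(1,2) assms(2)] assms(1) * by (simp add: has_S_def)
qed

lemma has_S_pos:
  assumes "has_S \<mu> m g" "t \<in> {- 1 + m<..<0}"
  obtains s where "0 < s" "t = stj \<mu> s - 1" "0 < g t"
proof -
  have \<mu>: "\<mu> \<in> prob_Rplus" "\<mu> \<noteq> delta0" "measure \<mu> {0} = m" using assms by (auto simp: has_S_def)
  obtain s where s: "0 < s" "stj \<mu> s = t + 1"
    using stj_surj[OF \<mu>(1,2), of "t + 1"] assms(2) \<mu>(3) by auto
  have "0 < s * stj \<mu> s / (1 - stj \<mu> s)"
    using stj_pos_less_1[OF \<mu>(1,2) s(1)] s(1) by (intro divide_pos_pos mult_pos_pos) auto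
  then have "0 < g (stj \<mu> s - 1)" unfolding has_S_stj(1)[OF assms(1) s(1)] .
  then have "0 < g t" using s by simp
  then show ?thesis using that[of s] s by simp
qed

lemma has_S_cong: "has_S \<mu> m g \<Longrightarrow> (\<And>t. t \<in> {- 1 + m<..<0} \<Longrightarrow> g t = g' t) \<Longrightarrow> has_S \<mu> m g'"
  by (auto simp: has_S_def)

text \<open>From S(R(s) - 1) = s R(s) / (1 - R(s)) the argument s is recovered from the value R(s),
  so S determines R. A competitor takes the value R(s) at some s', by the inclusion in its
  \<open>S_dom\<close>, and equal S-transforms give s' = s.\<close>

lemma measure_of_S_eqI:
  assumes \<rho>: "has_S \<rho> m g"
  shows "measure_of_S (- 1 + m) g = \<rho>"
  unfolding measure_of_S_def
proof (rule the_equality)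
  have r: "\<rho> \<in> prob_Rplus" "\<rho> \<noteq> delta0" "measure \<rho> {0} = m" using assms by (auto simp: has_S_def)
  show "\<rho> \<in> prob_Rplus \<and> \<rho> \<noteq> delta0 \<and> {- 1 + m<..<0} \<subseteq> S_dom \<rho> \<and> (\<forall>t\<in>{- 1 + m<..<0}. S_transform \<rho> t = g t)"
    using \<rho> by (auto simp: has_S_def S_dom_def)
  fix \<nu> assume n: "\<nu> \<in> prob_Rplus \<and> \<nu> \<noteq> delta0 \<and> {- 1 + m<..<0} \<subseteq> S_dom \<nu> \<and> (\<forall>t\<in>{- 1 + m<..<0}. S_transform \<nu> t = g t)"
  show "\<nu> = \<rho>"
  proof (rule prob_Rplus_eqI_stj)
    fix s :: real assume s: "0 < s"
    define t where "t = stj \<rho> s - 1"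
    have t: "t \<in> {- 1 + m<..<0}" unfolding t_def by (rule has_S_stj(2)[OF \<rho> s])
    then have "t \<in> S_dom \<nu>" using n by auto
    then obtain s' where s': "0 < s'" "stj \<nu> s' = t + 1"
      using stj_surj[of \<nu> "t + 1"] n by (auto simp: S_dom_def)
    have "s * stj \<rho> s / (1 - stj \<rho> s) = s' * stj \<nu> s' / (1 - stj \<nu> s')"
      using has_S_stj(1)[OF \<rho> s] S_transform_stj[of \<nu> s'] n s' t by (auto simp: t_def)
    moreover have "stj \<nu> s' = stj \<rho> s" using s' by (simp add: t_def)
    ultimately have "s = s'" using stj_pos_less_1[OF r(1,2) s] by simp
    then show "stj \<nu> s = stj \<rho> s" using \<open>stj \<nu> s' = stj \<rho> s\<close> by simp
  qed (use n r in auto)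
qed

text \<open>If \<open>\<omega>\<close> inverts \<open>w \<mapsto> w * B w\<close>, then \<open>stj \<mu> \<circ> \<omega>\<close> is again of the form \<open>stj \<rho>\<close>.\<close>

lemma has_S_mult_cbf:
  assumes \<mu>: "has_S \<mu> m g" and B: "cbf B"
    and E: "\<And>s. 0 < s \<Longrightarrow> B s = E (stj \<mu> s - 1)"
  obtains \<rho> where "has_S \<rho> m (\<lambda>t. g t * E t)"
proof -
  have m: "\<mu> \<in> prob_Rplus" "\<mu> \<noteq> delta0" "measure \<mu> {0} = m" using \<mu> by (auto simp: has_S_def)
  obtain \<omega> where \<omega>: "cbf \<omega>" "\<And>s. 0 < s \<Longrightarrow> \<omega> s * B (\<omega> s) = s"
    using cbf_inverse_of_mult_id[OF B] by blast
  have \<omega>pos: "0 < \<omega> s" if "0 < s" for s using cbf_pos[OF \<omega>(1) that] .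
  have \<omega>inv: "\<omega> (w * B w) = w" if "0 < w" for w
  proof -
    have "0 < w * B w" using cbf_pos[OF B that] that by simp
    then have "\<omega> (w * B w) * B (\<omega> (w * B w)) = w * B w" "0 < \<omega> (w * B w)" using \<omega>(2) \<omega>pos by auto
    then show ?thesis
      using cbf_mult_id_strict_mono[OF B, of w "\<omega> (w * B w)"] cbf_mult_id_strict_mono[OF B, of "\<omega> (w * B w)" w] that
      by (cases w "\<omega> (w * B w)" rule: linorder_cases) auto
  qed
  \<comment> \<open>1 / R is in the class, hence so is its composition with \<open>\<omega>\<close>,
    and the reciprocal of that is s R(\<omega>(s)).\<close>
  have "cbf (\<lambda>s. s * stj \<mu> (\<omega> s))"
    by (rule cbf_cong[OF cbf_recip[OF cbf_compose[OF stj_cbf(4)[OF m(1,2)] \<omega>(1)]]]) simp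
  then obtain \<rho> where r: "\<rho> \<in> prob_Rplus" "\<And>s. 0 < s \<Longrightarrow> stj \<rho> s = stj \<mu> (\<omega> s)"
  proof (rule stj_exists)
    show "stj \<mu> (\<omega> s) \<le> 1" if "0 < s" for s using stj_le_1[OF m(1)] \<omega>pos[OF that] by auto
    fix \<epsilon> :: real assume "0 < \<epsilon>"
    then have "1 - \<epsilon> < 1" by simp
    from order_tendstoD(1)[OF stj_limits(1)[OF m(1)] this]
    obtain n where "1 - \<epsilon> < stj \<mu> (1 / (real n + 1))" by (auto simp: eventually_sequentially)
    moreover have "0 < 1 / (real n + 1)" by simp
    ultimately show "\<exists>s>0. 1 - \<epsilon> < stj \<mu> (\<omega> s)"
      using \<omega>inv cbf_pos[OF B] by (metis mult_pos_pos)
  qed blast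
  have r0: "\<rho> \<noteq> delta0"
  proof
    assume "\<rho> = delta0"
    then have "stj \<rho> 1 = 1" by (simp add: stj_def integral_return)
    then show False using r(2)[of 1] stj_pos_less_1(2)[OF m(1,2) \<omega>pos[of 1]] by simp
  qed
  have rw: "stj \<rho> (w * B w) = stj \<mu> w" if "0 < w" for w
    using r(2)[of "w * B w"] \<omega>inv[OF that] that cbf_pos[OF B that] by simp
  \<comment> \<open>Both transforms take the same values, read along w B(w) in one direction and
    along \<omega>(s) in the other, and the atom at 0 is the limit at infinity; so the two atoms
    coincide.\<close>
  have "measure \<rho> {0} \<le> m"
    unfolding m(3)[symmetric]
  proof (rule LIMSEQ_le_const[OF stj_limits(2)[OF m(1)]], intro exI allI impI)
    fix n :: nat
    have "0 < (real n + 1) * B (real n + 1)" using cbf_pos[OF B, of "real n + 1"] by simp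
    from stj_greater_atom[OF r(1) r0 this] rw[of "real n + 1"]
    show "measure \<rho> {0} \<le> stj \<mu> (real n + 1)" by simp
  qed
  moreover have "m \<le> measure \<rho> {0}"
  proof (rule LIMSEQ_le_const[OF stj_limits(2)[OF r(1)]], intro exI allI impI)
    fix n :: nat
    show "m \<le> stj \<rho> (real n + 1)"
      using stj_greater_atom[OF m(1,2) \<omega>pos[of "real n + 1"]] r(2)[of "real n + 1"] m(3) by simp
  qed
  ultimately have rm: "measure \<rho> {0} = m" by simp
  have "has_S \<rho> m (\<lambda>t. g t * E t)"
  proof (rule has_SI_stj[OF r(1) r0 rm])
    fix s :: real assume s: "0 < s"
    have "g (stj \<mu> (\<omega> s) - 1) * E (stj \<mu> (\<omega> s) - 1) = \<omega> s * B (\<omega> s) * stj \<mu> (\<omega> s) / (1 - stj \<mu> (\<omega> s))"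
      using has_S_stj(1)[OF \<mu> \<omega>pos[OF s]] E[OF \<omega>pos[OF s]] by simp
    then show "s * stj \<rho> s / (1 - stj \<rho> s) = g (stj \<rho> s - 1) * E (stj \<rho> s - 1)"
      by (simp add: r(2)[OF s] \<omega>(2)[OF s])
  qed
  then show ?thesis using that by blast
qed

text \<open>At t = R - 1 the factor -t is 1 - R, whose powers stay in the class for exponents up to
  1. The exponent \<open>c\<close> is split into equal parts of that size, and each part uses 1 - R
  of the law built so far.\<close>

lemma has_S_mult_neg_powr:
  assumes "has_S \<mu> m g" "0 \<le> c"
  obtains \<rho> where "has_S \<rho> m (\<lambda>t. g t * (- t) powr c)"
proof -
  have step: "\<exists>\<rho>. has_S \<rho> m (\<lambda>t. f t * (- t) powr a)" if \<nu>: "has_S \<nu> m f" and a: "0 \<le> a" "a \<le> 1" for \<nu> f a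
  proof -
    have m: "\<nu> \<in> prob_Rplus" "\<nu> \<noteq> delta0" using \<nu> by (auto simp: has_S_def)
    obtain \<rho> where "has_S \<rho> m (\<lambda>t. f t * (- t) powr a)"
      by (rule has_S_mult_cbf[OF \<nu> cbf_powr[OF stj_cbf(2)[OF m] a], of "\<lambda>t. (- t) powr a"]) auto
    then show ?thesis by blast
  qed
  \<comment> \<open>The added 1 keeps \<open>n\<close> positive when c = 0.\<close>
  define n where "n = nat \<lceil>c\<rceil> + 1"
  have n: "c \<le> real n" "0 < n" unfolding n_def using assms(2) by linarith+
  have "\<exists>\<rho>. has_S \<rho> m (\<lambda>t. g t * (- t) powr (c / real n * real k))" for k
  proof (induction k)
    case 0
    have "has_S \<mu> m (\<lambda>t. g t * (- t) powr (c / real n * real 0))"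
      using assms(1) by (rule has_S_cong) auto
    then show ?case by blast
  next
    case (Suc k)
    then obtain \<rho> where "has_S \<rho> m (\<lambda>t. g t * (- t) powr (c / real n * real k))" by blast
    from step[OF this, of "c / real n"] n assms(2)
    obtain \<rho>' where "has_S \<rho>' m (\<lambda>t. g t * (- t) powr (c / real n * real k) * (- t) powr (c / real n))"
      by auto
    then have "has_S \<rho>' m (\<lambda>t. g t * (- t) powr (c / real n * real (Suc k)))"
      by (rule has_S_cong) (auto simp: powr_add[symmetric] distrib_left add.commute)
    then show ?case by blast
  qed
  from this[of n] n show ?thesis using that by auto
qed

text \<open>The factor is 1 / R at t = R - 1. It is the S-transform of the Marchenko-Pastur law, so
  this supplies the free convolution with that law.\<close>

lemma has_S_divide_one_plus:
  assumes "has_S \<mu> m g"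
  obtains \<rho> where "has_S \<rho> m (\<lambda>t. g t * (1 / (1 + t)))"
proof -
  have m: "\<mu> \<in> prob_Rplus" "\<mu> \<noteq> delta0" using assms by (auto simp: has_S_def)
  show ?thesis
    by (rule has_S_mult_cbf[OF assms stj_cbf(4)[OF m], of "\<lambda>t. 1 / (1 + t)"]) (auto intro: that)
qed

text \<open>The S-transform along R is itself in the class, so multiplying by its powers up to 1
  yields exponents in [1,2]. Larger exponents are halved until they fall below 2; squaring, the case
  a = 1, then undoes each halving.\<close>

lemma has_S_powr:
  assumes "has_S \<mu> m g" "1 \<le> r"
  obtains \<rho> where "has_S \<rho> m (\<lambda>t. g t powr r)"
proof -
  have step: "\<exists>\<rho>. has_S \<rho> m (\<lambda>t. f t powr (1 + a))" if \<nu>: "has_S \<nu> m f" and a: "0 \<le> a" "a \<le> 1" for \<nu> f a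
  proof -
    have m: "\<nu> \<in> prob_Rplus" "\<nu> \<noteq> delta0" using \<nu> by (auto simp: has_S_def)
    obtain \<rho> where "has_S \<rho> m (\<lambda>t. f t * f t powr a)"
      by (rule has_S_mult_cbf[OF \<nu> cbf_powr[OF stj_cbf(3)[OF m] a], of "\<lambda>t. f t powr a"])
        (auto simp: has_S_stj(1)[OF \<nu>])
    then have "has_S \<rho> m (\<lambda>t. f t powr (1 + a))"
    proof (rule has_S_cong)
      fix t assume "t \<in> {- 1 + m<..<0}"
      then have "0 < f t" using has_S_pos[OF \<nu>] by metis
      then show "f t * f t powr a = f t powr (1 + a)" by (simp add: powr_add)
    qed
    then show ?thesis by blast
  qed
  have "1 \<le> r \<Longrightarrow> r \<le> 2 ^ n \<Longrightarrow> \<exists>\<rho>. has_S \<rho> m (\<lambda>t. g t powr r)" for n r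
  proof (induction n arbitrary: r)
    case 0
    then show ?case using step[OF assms(1), of 0] by auto
  next
    case (Suc n)
    show ?case
    proof (cases "r \<le> 2")
      case True
      then show ?thesis using step[OF assms(1), of "r - 1"] Suc.prems by auto
    next
      case False
      then obtain \<rho> where \<rho>: "has_S \<rho> m (\<lambda>t. g t powr (r / 2))" using Suc.IH[of "r / 2"] Suc.prems by auto
      from step[OF this, of 1] show ?thesis by (auto simp: powr_powr)
    qed
  qed
  moreover obtain n where "r < 2 ^ n" using real_arch_pow[of 2 r] by auto
  ultimately show ?thesis using assms(2) that less_imp_le by blast
qed

lemma free_mult_pow_has_S:
  assumes "has_S \<mu> m g" "1 \<le> r"
  shows "has_S (free_mult_pow \<mu> r) m (\<lambda>t. g t powr r)"
proof -
  obtain \<rho> where \<rho>: "has_S \<rho> m (\<lambda>t. g t powr r)" by (rule has_S_powr[OF assms])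
  have m: "\<mu> \<noteq> delta0" "measure \<mu> {0} = m" using assms by (auto simp: has_S_def)
  have "has_S \<rho> m (\<lambda>t. S_transform \<mu> t powr r)"
    using \<rho> by (rule has_S_cong) (use assms in \<open>auto simp: has_S_def\<close>)
  from measure_of_S_eqI[OF this] \<rho> m show ?thesis by (simp add: free_mult_pow_def)
qed

text \<open>Existence of a law with the product as S-transform enters as the hypothesis
  \<open>ex\<close>, supplied in each application by one of the constructions above. The first
  factor has no atom at 0, so the maximum of the two atoms is \<open>m\<close>.\<close>

lemma free_mult_conv_has_S:
  assumes \<mu>: "has_S \<mu> 0 g" and \<nu>: "has_S \<nu> m h" and ex: "has_S \<rho> m (\<lambda>t. g t * h t)"
  shows "has_S (\<mu> \<boxtimes> \<nu>) m (\<lambda>t. g t * h t)"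
proof -
  have m: "\<mu> \<noteq> delta0" "measure \<mu> {0} = 0" "\<nu> \<noteq> delta0" "measure \<nu> {0} = m" "0 \<le> m"
    using assms by (auto simp: has_S_def)
  have "has_S \<rho> m (\<lambda>t. S_transform \<mu> t * S_transform \<nu> t)"
    using ex by (rule has_S_cong) (use \<mu> \<nu> \<open>0 \<le> m\<close> in \<open>auto simp: has_S_def\<close>)
  from measure_of_S_eqI[OF this] ex m show ?thesis by (simp add: free_mult_conv_def max_def)
qed

section \<open>The limit map\<close>

lemma weak_conv_m_unique:
  assumes "\<And>n. real_distribution (M n)" "real_distribution N" "real_distribution N'"
    and "weak_conv_m M N" "weak_conv_m M N'"
  shows "N = N'"
proof (rule Levy_uniqueness[OF assms(2,3)], rule ext)
  fix t
  show "char N t = char N' t"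
    using levy_continuity1[OF assms(1,2,4), of t] levy_continuity1[OF assms(1,3,5), of t] LIMSEQ_unique by blast
qed

lemma pow_push_prob_Rplus:
  assumes "\<mu> \<in> prob_Rplus"
  shows "pow_push c \<mu> \<in> prob_Rplus"
proof -
  interpret real_distribution \<mu> using assms by (rule prob_RplusD)
  show ?thesis unfolding pow_push_def by (rule prob_Rplus_distr) (auto intro: prob_space_axioms)
qed

lemma pow_push_delta0: "pow_push c delta0 = delta0"
  unfolding pow_push_def by (subst distr_return) auto

lemma cdf_prob_Rplus_neg:
  assumes "\<mu> \<in> prob_Rplus" "x < 0"
  shows "cdf \<mu> x = 0"
proof -
  interpret real_distribution \<mu> using assms(1) by (rule prob_RplusD)
  have "AE u in \<mu>. u \<notin> {..x}" using prob_RplusD(2)[OF assms(1)] by eventually_elim (use assms(2) in auto)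
  then have "prob {..x} = prob {}" by (intro measure_eq_AE) auto
  then show ?thesis by (simp add: cdf_def)
qed

lemma Phi_eqI:
  assumes D: "D \<in> prob_Rplus"
    and M: "\<And>k. free_mult_pow \<mu> (real (Suc k)) \<in> prob_Rplus"
    and w: "weak_conv_m (\<lambda>k. pow_push (1 / real (Suc k)) (free_mult_pow \<mu> (real (Suc k)))) D"
  shows "Phi \<mu> = D"
  unfolding Phi_def
proof (rule the_equality)
  show "D \<in> prob_Rplus \<and> weak_conv_m (\<lambda>k. pow_push (1 / real (Suc k)) (free_mult_pow \<mu> (real (Suc k)))) D"
    using D w by simp
  fix \<rho> assume \<rho>: "\<rho> \<in> prob_Rplus \<and> weak_conv_m (\<lambda>k. pow_push (1 / real (Suc k)) (free_mult_pow \<mu> (real (Suc k)))) \<rho>"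
  show "\<rho> = D"
    by (rule weak_conv_m_unique[OF prob_RplusD(1)[OF pow_push_prob_Rplus[OF M]] prob_RplusD(1) prob_RplusD(1)])
       (use \<rho> D w in auto)
qed

lemma Phi_delta0: "Phi delta0 = delta0"
  by (rule Phi_eqI) (auto simp: free_mult_pow_def pow_push_delta0 delta0_prob_Rplus weak_conv_m_def weak_conv_def)

abbreviation unif01 :: "real measure" where "unif01 \<equiv> restrict_space lborel {0<..<1}"

lemma prob_space_unif01: "prob_space unif01"
  by (auto simp add: emeasure_restrict_space space_restrict_space intro!: prob_spaceI)

lemma measure_unif01:
  assumes "A \<subseteq> {0<..<1}"
  shows "measure unif01 A = measure lborel A"
  using assms by (intro measure_restrict_space) auto

definition quantile_S :: "real \<Rightarrow> (real \<Rightarrow> real) \<Rightarrow> real \<Rightarrow> real" where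
  "quantile_S m g t = (if t \<le> m then 0 else 1 / g (t - 1))"

context
  fixes \<mu> :: "real measure" and m :: real and g :: "real \<Rightarrow> real"
  assumes S: "has_S \<mu> m g"
begin

lemma has_S_Rplus: "\<mu> \<in> prob_Rplus" "\<mu> \<noteq> delta0" "measure \<mu> {0} = m"
  using S by (auto simp: has_S_def)

lemma quantile_S_pos: "m < t \<Longrightarrow> t < 1 \<Longrightarrow> 0 < quantile_S m g t"
  using has_S_pos[OF S, of "t - 1"] by (auto simp: quantile_S_def)

lemma quantile_S_nonneg: "t < 1 \<Longrightarrow> 0 \<le> quantile_S m g t"
  using quantile_S_pos[of t] by (cases "t \<le> m") (auto simp: quantile_S_def)

text \<open>The level t = R(w) decreases in w, whereas S(t - 1) = w R(w) / (1 - R(w)) is in the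
  class and does not decrease; hence 1 / S grows with t.\<close>

lemma quantile_S_mono:
  assumes "t \<le> t'" "t' < 1"
  shows "quantile_S m g t \<le> quantile_S m g t'"
proof (cases "t \<le> m")
  case True
  then show ?thesis using quantile_S_nonneg[OF assms(2)] by (simp add: quantile_S_def)
next
  case False
  note \<mu> = has_S_Rplus
  obtain w where w: "0 < w" "stj \<mu> w = t" using stj_surj[OF \<mu>(1,2), of t] False assms \<mu>(3) by auto
  obtain w' where w': "0 < w'" "stj \<mu> w' = t'" using stj_surj[OF \<mu>(1,2), of t'] False assms \<mu>(3) by auto
  have "w' \<le> w" using stj_strict_antimono[OF \<mu>(1,2), of w w'] w w' assms by force
  from cbf_mono(1)[OF stj_cbf(3)[OF \<mu>(1,2)] w'(1) this]
  have "g (t' - 1) \<le> g (t - 1)" using has_S_stj(1)[OF S w(1)] has_S_stj(1)[OF S w'(1)] w w' by simp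
  moreover have "0 < g (t' - 1)" using has_S_pos[OF S, of "t' - 1"] False assms by auto
  ultimately show ?thesis using False assms by (auto simp: quantile_S_def intro!: divide_left_mono mult_pos_pos)
qed

lemma quantile_S_measurable: "quantile_S m g \<in> borel_measurable unif01"
proof -
  have "mono_on {0<..<1} (quantile_S m g)" by (auto intro!: mono_onI quantile_S_mono)
  then have "quantile_S m g \<in> borel_measurable (restrict_space borel {0<..<1})"
    by (rule borel_measurable_mono_on_fnc)
  then show ?thesis by (simp cong: measurable_cong_sets add: sets_restrict_space)
qed

lemma distr_quantile_S_prob_Rplus: "distr unif01 borel (quantile_S m g) \<in> prob_Rplus"
  by (rule prob_Rplus_distr[OF prob_space_unif01 quantile_S_measurable])
     (auto simp: space_restrict_space intro!: AE_I2 quantile_S_nonneg)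

lemma cdf_quantile_S:
  "cdf (distr unif01 borel (quantile_S m g)) x = measure lborel {t \<in> {0<..<1}. quantile_S m g t \<le> x}"
    "{t \<in> {0<..<1}. quantile_S m g t \<le> x} \<in> sets lborel"
proof -
  have e: "quantile_S m g -` {..x} \<inter> space unif01 = {t \<in> {0<..<1}. quantile_S m g t \<le> x}"
    by (auto simp: space_restrict_space)
  show "cdf (distr unif01 borel (quantile_S m g)) x = measure lborel {t \<in> {0<..<1}. quantile_S m g t \<le> x}"
    unfolding cdf_def by (subst measure_distr[OF quantile_S_measurable], simp, unfold e, rule measure_unif01) auto
  have "{t \<in> {0<..<1}. quantile_S m g t \<le> x} \<in> sets unif01"
    unfolding e[symmetric] by (rule measurable_sets[OF quantile_S_measurable]) auto
  then show "{t \<in> {0<..<1}. quantile_S m g t \<le> x} \<in> sets lborel"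
    by (subst (asm) sets_restrict_space_iff) auto
qed

lemma cdf_quantile_S_ge:
  assumes "0 < \<tau>" "\<tau> < 1" "quantile_S m g \<tau> \<le> x"
  shows "\<tau> \<le> cdf (distr unif01 borel (quantile_S m g)) x"
proof -
  have "measure lborel {0<..\<tau>} \<le> measure lborel {t \<in> {0<..<1}. quantile_S m g t \<le> x}"
  proof (rule measure_mono_fmeasurable)
    have "quantile_S m g t \<le> x" if "t \<le> \<tau>" for t
      using quantile_S_mono[OF that assms(2)] assms(3) by (rule order_trans)
    then show "{0<..\<tau>} \<subseteq> {t \<in> {0<..<1}. quantile_S m g t \<le> x}"
      using assms(2) by auto
    show "{t \<in> {0<..<1}. quantile_S m g t \<le> x} \<in> fmeasurable lborel"
    proof (rule fmeasurableI2)
      show "{0<..<1::real} \<in> fmeasurable lborel" by (simp add: fmeasurable_def)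
      show "{t \<in> {0<..<1}. quantile_S m g t \<le> x} \<in> sets lborel" by (rule cdf_quantile_S(2))
    qed blast
  qed auto
  then show ?thesis using assms by (simp add: cdf_quantile_S(1))
qed

lemma cdf_quantile_S_le:
  assumes "0 < \<tau>" "\<tau> < 1" "x < quantile_S m g \<tau>"
  shows "cdf (distr unif01 borel (quantile_S m g)) x \<le> \<tau>"
proof -
  have "measure lborel {t \<in> {0<..<1}. quantile_S m g t \<le> x} \<le> measure lborel {0<..<\<tau>}"
  proof (rule measure_mono_fmeasurable)
    have "t < \<tau>" if "t \<in> {0<..<1}" "quantile_S m g t \<le> x" for t
      using quantile_S_mono[of \<tau> t] that assms by (cases "\<tau> \<le> t") auto
    then show "{t \<in> {0<..<1}. quantile_S m g t \<le> x} \<subseteq> {0<..<\<tau>}" by auto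
    show "{t \<in> {0<..<1}. quantile_S m g t \<le> x} \<in> sets lborel" by (rule cdf_quantile_S(2))
    show "{0<..<\<tau>} \<in> fmeasurable lborel" using assms by (simp add: fmeasurable_def)
  qed
  then show ?thesis using assms by (simp add: cdf_quantile_S(1))
qed

section \<open>Distribution functions of the rescaled free powers\<close>

context
  fixes n :: nat and \<rho> :: "real measure"
  assumes n: "0 < n" and \<rho>: "has_S \<rho> m (\<lambda>t. g t powr real n)"
begin

text \<open>The equation for the S-transform of the n-th free power at s = 1 / y^n. The n-th root of
  t / (1 - t) tends to 1 for fixed t, so y must be close to the quantile at t; this is the mechanism
  of the limit theorem.\<close>

lemma stj_free_pow:
  fixes y :: real
  assumes "0 < y"
  defines "t \<equiv> stj \<rho> (1 / y ^ n)"
  shows "m < t" "t < 1" "y ^ n = quantile_S m g t ^ n * (t / (1 - t))"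
proof -
  have s: "0 < 1 / y ^ n" using assms by simp
  have t: "m < t" "t < 1" using has_S_stj(2)[OF \<rho> s] by (auto simp: t_def)
  then show "m < t" "t < 1" by auto
  have t0: "0 < t" using t(1) has_S_Rplus(3) by (metis le_less_trans measure_nonneg)
  obtain "0 < g (t - 1)" using has_S_pos[OF S, of "t - 1"] t by auto
  then have "g (t - 1) ^ n = 1 / y ^ n * t / (1 - t)"
    using has_S_stj(1)[OF \<rho> s] by (simp add: t_def[symmetric] powr_realpow)
  moreover have "quantile_S m g t = 1 / g (t - 1)" using t by (simp add: quantile_S_def)
  ultimately show "y ^ n = quantile_S m g t ^ n * (t / (1 - t))"
    using t t0 \<open>0 < g (t - 1)\<close> assms by (simp add: power_one_over)
qed

lemma cdf_free_pow:
  "cdf (pow_push (1 / real n) \<rho>) x = measure \<rho> {u. u powr (1 / real n) \<le> x}"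
proof -
  interpret real_distribution \<rho> using \<rho> by (simp add: has_S_def prob_RplusD)
  have "(\<lambda>u. u powr (1 / real n)) -` {..x} \<inter> space \<rho> = {u. u powr (1 / real n) \<le> x}" by auto
  then show ?thesis unfolding cdf_def pow_push_def by (subst measure_distr) auto
qed

lemma powr_le_iff_le_power:
  assumes "0 \<le> u" "0 \<le> x"
  shows "u powr (1 / real n) \<le> x \<longleftrightarrow> u \<le> x ^ n"
proof -
  have "u powr (1 / real n) = root n u" using assms n by (cases "u = 0") (auto simp: root_powr_inverse)
  moreover have "root n u \<le> root n (x ^ n) \<longleftrightarrow> u \<le> x ^ n" using n by (rule real_root_le_iff)
  ultimately show ?thesis using assms n by (simp add: real_root_power_cancel)
qed

text \<open>Markov-type bound: where the n-th root of u is at most x, the integrand of R is at least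
  1 / (1 + (x / y)^n).\<close>

lemma cdf_free_pow_le:
  assumes "0 \<le> x" "x < y"
  shows "cdf (pow_push (1 / real n) \<rho>) x \<le> (1 + (x / y) ^ n) * stj \<rho> (1 / y ^ n)"
proof -
  have R: "\<rho> \<in> prob_Rplus" using \<rho> by (simp add: has_S_def)
  interpret real_distribution \<rho> using R by (rule prob_RplusD)
  have y: "0 < y" using assms by simp
  have p: "0 < 1 + (x / y) ^ n" using assms y by (intro add_pos_nonneg) auto
  have "(LINT u|\<rho>. 1 / (1 + (x / y) ^ n) * indicator {u. u powr (1 / real n) \<le> x} u) \<le> stj \<rho> (1 / y ^ n)"
    unfolding stj_def
  proof (rule integral_mono_AE)
    show "integrable \<rho> (\<lambda>u. 1 / (1 + (x / y) ^ n) * indicator {u. u powr (1 / real n) \<le> x} u)"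
      by (intro integrable_mult_right integrable_real_indicator) (auto simp: emeasure_eq_measure)
    show "integrable \<rho> (\<lambda>u. 1 / (1 + 1 / y ^ n * u))" using R y by (intro stj_integrable) auto
    show "AE u in \<rho>. 1 / (1 + (x / y) ^ n) * indicator {u. u powr (1 / real n) \<le> x} u \<le> 1 / (1 + 1 / y ^ n * u)"
      using prob_RplusD(2)[OF R]
    proof eventually_elim
      case (elim u)
      show ?case
      proof (cases "u powr (1 / real n) \<le> x")
        case True
        then have "u \<le> x ^ n" using powr_le_iff_le_power elim assms by simp
        then have "1 / y ^ n * u \<le> (x / y) ^ n" using y by (simp add: power_divide divide_right_mono)
        moreover have "0 \<le> 1 / y ^ n * u" using elim y by simp
        ultimately show ?thesis using True by (auto intro!: divide_left_mono mult_pos_pos p)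
      next
        case False
        then show ?thesis using stj_kernel_bounds(1)[OF elim, of "1 / y ^ n"] y by simp
      qed
    qed
  qed
  then have "1 / (1 + (x / y) ^ n) * cdf (pow_push (1 / real n) \<rho>) x \<le> stj \<rho> (1 / y ^ n)"
    by (simp add: cdf_free_pow)
  then show ?thesis using p by (simp add: field_simps)
qed

text \<open>The integrand of R is at most 1 everywhere, and at most (y / x)^n where the n-th root of
  u exceeds x.\<close>

lemma cdf_free_pow_ge:
  assumes "0 < y" "y < x"
  shows "stj \<rho> (1 / y ^ n) - (y / x) ^ n \<le> cdf (pow_push (1 / real n) \<rho>) x"
proof -
  have R: "\<rho> \<in> prob_Rplus" using \<rho> by (simp add: has_S_def)
  interpret real_distribution \<rho> using R by (rule prob_RplusD)
  have x: "0 < x" using assms by simp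
  have "stj \<rho> (1 / y ^ n) \<le> (LINT u|\<rho>. indicator {u. u powr (1 / real n) \<le> x} u + (y / x) ^ n)"
    unfolding stj_def
  proof (rule integral_mono_AE)
    show "integrable \<rho> (\<lambda>u. indicator {u. u powr (1 / real n) \<le> x} u + (y / x) ^ n)"
      by (intro Bochner_Integration.integrable_add integrable_real_indicator) (auto simp: emeasure_eq_measure)
    show "integrable \<rho> (\<lambda>u. 1 / (1 + 1 / y ^ n * u))" using R assms by (intro stj_integrable) auto
    show "AE u in \<rho>. 1 / (1 + 1 / y ^ n * u) \<le> indicator {u. u powr (1 / real n) \<le> x} u + (y / x) ^ n"
      using prob_RplusD(2)[OF R]
    proof eventually_elim
      case (elim u)
      show ?case
      proof (cases "u powr (1 / real n) \<le> x")
        case True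
        then show ?thesis using stj_kernel_bounds(2)[OF elim, of "1 / y ^ n"] assms by (simp add: add_increasing2)
      next
        case False
        then have "x ^ n \<le> u" using powr_le_iff_le_power[of u x] elim x by simp
        then have "(x / y) ^ n \<le> 1 / y ^ n * u" using assms by (simp add: power_divide divide_right_mono)
        then have "1 / (1 + 1 / y ^ n * u) \<le> 1 / (x / y) ^ n"
          using assms x elim by (intro divide_left_mono mult_pos_pos add_pos_nonneg) (auto intro: zero_le_power)
        then show ?thesis using False by (simp add: power_divide)
      qed
    qed
  qed
  also have "\<dots> = cdf (pow_push (1 / real n) \<rho>) x + (y / x) ^ n"
    using prob_space by (subst Bochner_Integration.integral_add)
      (auto simp: cdf_free_pow emeasure_eq_measure intro!: integrable_real_indicator)
  finally show ?thesis by simp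
qed

end

text \<open>If R exceeded \<tau>, then \<open>stj_free_pow\<close> and monotonicity would bound (Q /
  y)^n by (1 - \<tau>) / \<tau>, where Q > y is the quantile at \<tau>. This fails for large
  n.\<close>

lemma eventually_stj_free_pow_le:
  assumes \<rho>: "\<And>n. 0 < n \<Longrightarrow> has_S (\<rho> n) m (\<lambda>t. g t powr real n)"
    and "0 < y" "0 < \<tau>" "\<tau> < 1" "y < quantile_S m g \<tau>"
  shows "\<forall>\<^sub>F n in sequentially. stj (\<rho> n) (1 / y ^ n) \<le> \<tau>"
proof -
  have "1 < quantile_S m g \<tau> / y" using assms by simp
  then obtain N where N: "(1 - \<tau>) / \<tau> < (quantile_S m g \<tau> / y) ^ N" using real_arch_pow by blast
  show ?thesis unfolding eventually_sequentially
  \<comment> \<open>\<open>Suc N\<close> instead of \<open>N\<close> makes n positive, as the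
    assumption on \<open>\<rho>\<close> demands.\<close>
  proof (intro exI[of _ "Suc N"] allI impI, rule ccontr)
    fix n assume n: "Suc N \<le> n" and "\<not> stj (\<rho> n) (1 / y ^ n) \<le> \<tau>"
    define t where "t = stj (\<rho> n) (1 / y ^ n)"
    have n0: "0 < n" using n by simp
    note t = stj_free_pow[OF n0 \<rho>[OF n0] \<open>0 < y\<close>, folded t_def]
    have \<tau>t: "\<tau> < t" using \<open>\<not> _\<close> by (simp add: t_def)
    have "quantile_S m g \<tau> ^ n * (\<tau> / (1 - \<tau>)) \<le> quantile_S m g t ^ n * (t / (1 - t))"
      using t assms \<tau>t by (intro mult_mono power_mono quantile_S_mono frac_le) (auto intro!: quantile_S_nonneg zero_le_power)
    also have "\<dots> = y ^ n" using t by simp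
    finally have "(quantile_S m g \<tau> / y) ^ n \<le> (1 - \<tau>) / \<tau>"
      using assms by (simp add: power_divide field_simps)
    moreover have "(quantile_S m g \<tau> / y) ^ N \<le> (quantile_S m g \<tau> / y) ^ n"
      using n \<open>1 < quantile_S m g \<tau> / y\<close> by (intro power_increasing) auto
    ultimately show False using N by linarith
  qed
qed

text \<open>The mirror image: Q / y < 1, so its powers fall below (1 - \<tau>) / \<tau>.\<close>

lemma eventually_stj_free_pow_ge:
  assumes \<rho>: "\<And>n. 0 < n \<Longrightarrow> has_S (\<rho> n) m (\<lambda>t. g t powr real n)"
    and "0 < y" "0 < \<tau>" "\<tau> < 1" "quantile_S m g \<tau> < y"
  shows "\<forall>\<^sub>F n in sequentially. \<tau> \<le> stj (\<rho> n) (1 / y ^ n)"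
proof -
  have "quantile_S m g \<tau> / y < 1" using assms by simp
  moreover have q0: "0 \<le> quantile_S m g \<tau> / y" using quantile_S_nonneg[OF \<open>\<tau> < 1\<close>] assms by simp
  moreover have "0 < (1 - \<tau>) / \<tau>" using assms by simp
  ultimately obtain N where N: "(quantile_S m g \<tau> / y) ^ N < (1 - \<tau>) / \<tau>" using real_arch_pow_inv by blast
  show ?thesis unfolding eventually_sequentially
  proof (intro exI[of _ "Suc N"] allI impI, rule ccontr)
    fix n assume n: "Suc N \<le> n" and "\<not> \<tau> \<le> stj (\<rho> n) (1 / y ^ n)"
    define t where "t = stj (\<rho> n) (1 / y ^ n)"
    have n0: "0 < n" using n by simp
    note t = stj_free_pow[OF n0 \<rho>[OF n0] \<open>0 < y\<close>, folded t_def]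
    have t\<tau>: "t < \<tau>" using \<open>\<not> _\<close> by (simp add: t_def)
    have m0: "0 \<le> m" using has_S_Rplus(3) measure_nonneg by metis
    have "y ^ n = quantile_S m g t ^ n * (t / (1 - t))" using t by simp
    also have "\<dots> \<le> quantile_S m g \<tau> ^ n * (\<tau> / (1 - \<tau>))"
      using t assms t\<tau> m0 by (intro mult_mono power_mono quantile_S_mono frac_le) (auto intro!: quantile_S_nonneg zero_le_power)
    finally have "(1 - \<tau>) / \<tau> \<le> (quantile_S m g \<tau> / y) ^ n"
      using assms by (simp add: power_divide field_simps)
    moreover have "(quantile_S m g \<tau> / y) ^ n \<le> (quantile_S m g \<tau> / y) ^ N"
      using n \<open>quantile_S m g \<tau> / y < 1\<close> q0 by (intro power_decreasing) auto
    ultimately show False using N by linarith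
  qed
qed

text \<open>Near a continuity point x, a point x' is chosen on one side where the limiting
  distribution function is still beyond the level a, then \<tau> between a and that value, and y
  between x' and x. The quantile comparison at \<tau> controls R at 1 / y^n, and the two bounds
  above carry this over to the distribution function at x.\<close>

lemma weak_conv_free_pow:
  assumes \<rho>: "\<And>n. 0 < n \<Longrightarrow> has_S (\<rho> n) m (\<lambda>t. g t powr real n)"
  shows "weak_conv_m (\<lambda>k. pow_push (1 / real (Suc k)) (\<rho> (Suc k))) (distr unif01 borel (quantile_S m g))"
proof -
  define D where "D = distr unif01 borel (quantile_S m g)"
  have DR: "D \<in> prob_Rplus" unfolding D_def by (rule distr_quantile_S_prob_Rplus)
  interpret D: real_distribution D using DR by (rule prob_RplusD)
  define F where "F n = cdf (pow_push (1 / real n) (\<rho> n))" for n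
  have FR: "pow_push (1 / real n) (\<rho> n) \<in> prob_Rplus" if "0 < n" for n
    using \<rho>[OF that] by (intro pow_push_prob_Rplus) (simp add: has_S_def)
  have F1: "0 \<le> F n x" "F n x \<le> 1" if "0 < n" for n x
  proof -
    interpret real_distribution "pow_push (1 / real n) (\<rho> n)" using FR[OF that] by (rule prob_RplusD)
    show "0 \<le> F n x" "F n x \<le> 1" unfolding F_def using cdf_nonneg cdf_bounded_prob by auto
  qed
  note neg = cdf_prob_Rplus_neg
  have "(\<lambda>n. F n x) \<longlonglongrightarrow> cdf D x" if cont: "isCont (cdf D) x" for x
  proof (rule order_tendstoI)
    fix a assume a: "a < cdf D x"
    show "\<forall>\<^sub>F n in sequentially. a < F n x"
    proof (cases "a < 0")
      case True
      then show ?thesis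
        using F1(1) by (auto intro!: eventually_mono[OF eventually_gt_at_top[of 0]] intro: less_le_trans)
    next
      case False
      \<comment> \<open>The limiting distribution function vanishes on the negative axis, and at x =
        0 by continuity, which contradicts 0 \<le> a < \<open>cdf D x\<close>.\<close>
      have x: "0 < x"
      proof (rule ccontr)
        assume "\<not> 0 < x"
        then have "cdf D x = 0"
        proof (cases "x = 0")
          case True
          have "((cdf D) \<longlongrightarrow> cdf D x) (at_left x)" using cont by (simp add: continuous_at_imp_continuous_at_within continuous_within[symmetric])
          moreover have "((cdf D) \<longlongrightarrow> 0) (at_left x)"
            by (rule tendsto_eventually) (auto simp: eventually_at_filter neg[OF DR] True)
          ultimately show ?thesis using tendsto_unique trivial_limit_at_left_real by blast
        qed (auto intro: neg[OF DR])
        then show False using a False by simp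
      qed
      have "\<forall>\<^sub>F z in at x. a < cdf D z" using cont a by (auto simp: isCont_def dest: order_tendstoD)
      then obtain d where d: "d > 0" "\<And>z. z \<noteq> x \<Longrightarrow> dist z x < d \<Longrightarrow> a < cdf D z"
        by (auto simp: eventually_at)
      \<comment> \<open>Halfway to the border of the neighbourhood, but not below x / 2, so that x'
        stays positive.\<close>
      define x' where "x' = max (x / 2) (x - d / 2)"
      have x': "0 < x'" "x' < x" "a < cdf D x'" using x d(1) by (auto simp: x'_def dist_real_def max_def intro!: d(2))
      define \<tau> where "\<tau> = (a + cdf D x') / 2"
      have \<tau>: "0 < \<tau>" "\<tau> < 1" "a < \<tau>" "\<tau> < cdf D x'"
        using x' False D.cdf_bounded_prob[of x'] by (auto simp: \<tau>_def)
      have q: "quantile_S m g \<tau> \<le> x'"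
        using cdf_quantile_S_le[OF \<tau>(1,2), of x'] \<tau> by (force simp: D_def)
      define y where "y = (x' + x) / 2"
      have y: "0 < y" "y < x" "quantile_S m g \<tau> < y" using x' q by (auto simp: y_def)
      have "(\<lambda>n. \<tau> - (y / x) ^ n) \<longlonglongrightarrow> \<tau> - 0"
        using x y by (intro tendsto_diff tendsto_const LIMSEQ_power_zero) auto
      then have "\<forall>\<^sub>F n in sequentially. a < \<tau> - (y / x) ^ n" using \<tau> by (intro order_tendstoD) auto
      moreover have "\<forall>\<^sub>F n in sequentially. \<tau> \<le> stj (\<rho> n) (1 / y ^ n)"
        by (rule eventually_stj_free_pow_ge) (use \<rho> y \<tau> in auto)
      moreover have "\<forall>\<^sub>F n::nat in sequentially. 0 < n" by (rule eventually_gt_at_top)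
      ultimately show ?thesis
      proof eventually_elim
        case (elim n)
        then show ?case using cdf_free_pow_ge[OF elim(3) \<rho>[OF elim(3)] y(1,2)] by (simp add: F_def)
      qed
    qed
  next
    fix a assume a: "cdf D x < a"
    show "\<forall>\<^sub>F n in sequentially. F n x < a"
    proof (cases "1 < a \<or> x < 0")
      case True
      have "F n x < a" if "0 < n" for n
        using True a F1(2)[OF that, of x] neg[OF FR[OF that], of x] D.cdf_nonneg[of x] by (auto simp: F_def)
      then show ?thesis by (rule eventually_mono[OF eventually_gt_at_top[of "0::nat"]])
    next
      \<comment> \<open>Now a \<le> 1 and 0 \<le> x, which places the level \<tau> chosen below in
        (0,1).\<close>
      case False
      have "\<forall>\<^sub>F z in at x. cdf D z < a" using cont a by (auto simp: isCont_def dest: order_tendstoD)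
      then obtain d where d: "d > 0" "\<And>z. z \<noteq> x \<Longrightarrow> dist z x < d \<Longrightarrow> cdf D z < a"
        by (auto simp: eventually_at)
      define x' where "x' = x + d / 2"
      have x': "x < x'" "cdf D x' < a" using d(1) by (auto simp: x'_def dist_real_def intro!: d(2))
      define \<tau> where "\<tau> = (a + cdf D x') / 2"
      have \<tau>: "0 < \<tau>" "\<tau> < 1" "\<tau> < a" "cdf D x' < \<tau>"
        using x' False D.cdf_nonneg[of x'] by (auto simp: \<tau>_def)
      have q: "x' < quantile_S m g \<tau>"
        using cdf_quantile_S_ge[OF \<tau>(1,2), of x'] \<tau> by (force simp: D_def)
      define y where "y = (x' + x) / 2"
      have y: "0 < y" "x < y" "y < quantile_S m g \<tau>" using x' q False by (auto simp: y_def)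
      have "(\<lambda>n. (1 + (x / y) ^ n) * \<tau>) \<longlonglongrightarrow> (1 + 0) * \<tau>"
        using False y by (intro tendsto_intros LIMSEQ_power_zero) auto
      then have "\<forall>\<^sub>F n in sequentially. (1 + (x / y) ^ n) * \<tau> < a" using \<tau> by (intro order_tendstoD) auto
      moreover have "\<forall>\<^sub>F n in sequentially. stj (\<rho> n) (1 / y ^ n) \<le> \<tau>"
        by (rule eventually_stj_free_pow_le) (use \<rho> y \<tau> in auto)
      moreover have "\<forall>\<^sub>F n::nat in sequentially. 0 < n" by (rule eventually_gt_at_top)
      ultimately show ?thesis
      proof eventually_elim
        case (elim n)
        have "F n x \<le> (1 + (x / y) ^ n) * stj (\<rho> n) (1 / y ^ n)"
          unfolding F_def by (rule cdf_free_pow_le[OF elim(3) \<rho>[OF elim(3)]]) (use False y in auto)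
        also have "\<dots> \<le> (1 + (x / y) ^ n) * \<tau>" using elim(2) False y by (intro mult_left_mono) auto
        also note elim(1)
        finally show ?case .
      qed
    qed
  qed
  note lim = LIMSEQ_Suc[OF this, unfolded F_def]
  show ?thesis unfolding weak_conv_m_def weak_conv_def D_def[symmetric]
    by (intro allI impI) (rule lim)
qed

lemma Phi_has_S: "Phi \<mu> = distr unif01 borel (quantile_S m g)"
proof (rule Phi_eqI[OF distr_quantile_S_prob_Rplus])
  have *: "has_S (free_mult_pow \<mu> (real n)) m (\<lambda>t. g t powr real n)" if "0 < n" for n
    using free_mult_pow_has_S[OF S, of "real n"] that by simp
  show "free_mult_pow \<mu> (real (Suc k)) \<in> prob_Rplus" for k using *[of "Suc k"] by (simp add: has_S_def)
  show "weak_conv_m (\<lambda>k. pow_push (1 / real (Suc k)) (free_mult_pow \<mu> (real (Suc k)))) (distr unif01 borel (quantile_S m g))"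
    by (rule weak_conv_free_pow) (rule *)
qed

end

text \<open>The quantile function is raised to the power r pointwise; up to level \<open>m\<close>
  both sides vanish because \<open>0 powr r = 0\<close>.\<close>

lemma Phi_powr:
  assumes S: "has_S \<mu> m g" and S': "has_S \<nu> m (\<lambda>t. g t powr r)"
  shows "Phi \<nu> = pow_push r (Phi \<mu>)"
proof -
  have "pow_push r (Phi \<mu>) = distr unif01 borel (\<lambda>t. quantile_S m g t powr r)"
    unfolding Phi_has_S[OF S] pow_push_def using quantile_S_measurable[OF S]
    by (subst distr_distr) (auto simp: o_def)
  also have "\<dots> = distr unif01 borel (quantile_S m (\<lambda>t. g t powr r))"
  proof (rule distr_cong)
    fix t assume "t \<in> space unif01"
    then have t: "t < 1" by (simp add: space_restrict_space)
    show "quantile_S m g t powr r = quantile_S m (\<lambda>t. g t powr r) t"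
    proof (cases "t \<le> m")
      case False
      then have "0 < g (t - 1)" using has_S_pos[OF S, of "t - 1"] t by auto
      then show ?thesis using False by (simp add: quantile_S_def powr_divide)
    qed (simp add: quantile_S_def)
  qed auto
  also have "\<dots> = Phi \<nu>" by (rule Phi_has_S[OF S', symmetric])
  finally show ?thesis by simp
qed

text \<open>If \<open>k\<close> inverts R - 1, the quantile at level R(w) is 1 / w, and 1 / w \<le>
  x means R(w) \<le> R(1 / x). The sublevel set at x is therefore an interval of length R(1 /
  x).\<close>

lemma cdf_Phi_inverse_stj:
  assumes \<mu>: "\<mu> \<in> prob_Rplus" "\<mu> \<noteq> delta0" and S: "has_S \<nu> (measure \<mu> {0}) k"
    and k: "\<And>s. 0 < s \<Longrightarrow> k (stj \<mu> s - 1) = s" and x: "0 < x"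
  shows "cdf (Phi \<nu>) x = stj \<mu> (1 / x)"
proof -
  define m where "m = measure \<mu> {0}"
  have sx: "m < stj \<mu> (1 / x)" "stj \<mu> (1 / x) < 1" "0 < stj \<mu> (1 / x)"
    using stj_greater_atom[OF \<mu>] stj_pos_less_1[OF \<mu>] x by (auto simp: m_def)
  have "quantile_S m k t \<le> x \<longleftrightarrow> t \<le> stj \<mu> (1 / x)" if t: "0 < t" "t < 1" for t
  proof (cases "t \<le> m")
    case True
    then show ?thesis using sx x by (simp add: quantile_S_def)
  next
    case False
    then obtain w where w: "0 < w" "stj \<mu> w = t" using stj_surj[OF \<mu>, of t] t by (auto simp: m_def)
    have "quantile_S m k t = 1 / w" using k[OF w(1)] w False by (simp add: quantile_S_def)
    moreover have "1 / w \<le> x \<longleftrightarrow> 1 / x \<le> w" using w x by (simp add: field_simps)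
    moreover have "1 / x \<le> w \<longleftrightarrow> t \<le> stj \<mu> (1 / x)"
      using stj_strict_antimono[OF \<mu>, of "1 / x" w] stj_strict_antimono[OF \<mu>, of w "1 / x"] w x
      by (cases w "1 / x" rule: linorder_cases) auto
    ultimately show ?thesis by simp
  qed
  then have "{t \<in> {0<..<1}. quantile_S m k t \<le> x} = {0<..stj \<mu> (1 / x)}" using sx by auto
  then show ?thesis using sx
    unfolding Phi_has_S[OF S] cdf_quantile_S(1)[OF S] unfolding m_def[symmetric] by simp
qed

section \<open>The Marchenko-Pastur law\<close>

text \<open>Improper form with one-sided limits at the ends: the Marchenko-Pastur density is
  unbounded at 0.\<close>

lemma has_bochner_integral_FTC_nonneg:
  fixes f F :: "real \<Rightarrow> real" and a b A B :: real
  assumes "a < b"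
    and F: "\<And>x. a < x \<Longrightarrow> x < b \<Longrightarrow> (F has_real_derivative f x) (at x)"
    and f: "\<And>x. a < x \<Longrightarrow> x < b \<Longrightarrow> isCont f x"
    and nn: "\<And>x. a < x \<Longrightarrow> x < b \<Longrightarrow> 0 \<le> f x"
    and A: "(F \<longlongrightarrow> A) (at_right a)" and B: "(F \<longlongrightarrow> B) (at_left b)"
  shows "has_bochner_integral lborel (\<lambda>x. indicator {a<..<b} x * f x) (B - A)"
proof -
  have e: "einterval (ereal a) (ereal b) = {a<..<b}" by (auto simp: einterval_def)
  have "set_integrable lborel (einterval a b) f" "(LBINT x=a..b. f x) = B - A"
    by (rule interval_integral_FTC_nonneg[of "ereal a" "ereal b" F f A B]; use assms in \<open>auto simp: ereal_tendsto_simps\<close>)+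
  then show ?thesis using \<open>a < b\<close>
    by (simp add: has_bochner_integral_iff set_integrable_def set_lebesgue_integral_def interval_lebesgue_integral_def e)
qed

text \<open>With x = 4 sin^2 \<theta> this is tan \<theta>, the substitution that turns the
  primitives into arctangents.\<close>

definition mp_ratio :: "real \<Rightarrow> real" where "mp_ratio x = sqrt (x / (4 - x))"

definition mp_density :: "real \<Rightarrow> real" where
  "mp_density x = indicator {0<..<4} x * (1 / (2 * pi * mp_ratio x))"

lemma mp_ratio_pos: "0 < x \<Longrightarrow> x < 4 \<Longrightarrow> 0 < mp_ratio x"
  by (simp add: mp_ratio_def)

lemma mp_ratio_sq: "0 < x \<Longrightarrow> x < 4 \<Longrightarrow> (mp_ratio x)\<^sup>2 = x / (4 - x)"
  by (simp add: mp_ratio_def)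

lemma mp_density_measurable [measurable]: "mp_density \<in> borel_measurable borel"
  unfolding mp_density_def mp_ratio_def by measurable

lemma mp_density_nonneg: "0 \<le> mp_density x"
  using mp_ratio_pos[of x] by (cases "0 < x \<and> x < 4") (auto simp: mp_density_def)

lemma marchenko_pastur_eq: "marchenko_pastur = density lborel (\<lambda>x. ennreal (mp_density x))"
proof -
  have "(if 0 < x \<and> x < 4 then sqrt (x * (4 - x)) / (2 * pi * x) else 0) = mp_density x" for x :: real
  proof (cases "0 < x \<and> x < 4")
    case True
    have "sqrt (x * (4 - x)) / x = 1 / mp_ratio x"
    proof -
      have "sqrt (x * (4 - x)) * mp_ratio x = sqrt (x * (4 - x) * (x / (4 - x)))"
        unfolding mp_ratio_def by (rule real_sqrt_mult[symmetric])
      also have "x * (4 - x) * (x / (4 - x)) = x\<^sup>2" using True by (simp add: power2_eq_square)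
      finally show ?thesis using True mp_ratio_pos[of x] by (simp add: field_simps)
    qed
    then have "sqrt (x * (4 - x)) / x / (2 * pi) = 1 / mp_ratio x / (2 * pi)" by simp
    then show ?thesis using True by (simp add: mp_density_def mult.commute)
  qed (auto simp: mp_density_def)
  then show ?thesis by (simp add: marchenko_pastur_def)
qed

lemma mp_ratio_deriv:
  assumes "0 < x" "x < 4"
  shows "(mp_ratio has_real_derivative 2 / (mp_ratio x * (4 - x)\<^sup>2)) (at x)"
proof -
  have d: "((\<lambda>x. x / (4 - x)) has_real_derivative 4 / (4 - x)\<^sup>2) (at x)"
    using assms by (auto intro!: derivative_eq_intros simp: power2_eq_square)
  have "((\<lambda>x. sqrt (x / (4 - x))) has_real_derivative inverse (sqrt (x / (4 - x))) / 2 * (4 / (4 - x)\<^sup>2)) (at x)"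
    by (rule DERIV_chain2[OF DERIV_real_sqrt d]) (use assms in simp)
  moreover have "inverse u / 2 * (4 / v) = 2 / (u * v)" for u v :: real by (simp add: inverse_eq_divide)
  ultimately show ?thesis unfolding mp_ratio_def[abs_def] by simp
qed

lemma mp_ratio_limits:
  "(mp_ratio \<longlongrightarrow> 0) (at_right 0)" "filterlim mp_ratio at_top (at_left 4)"
proof -
  have "((\<lambda>x. sqrt (x / (4 - x))) \<longlongrightarrow> sqrt (0 / (4 - 0))) (at_right 0)"
    by (intro tendsto_intros) auto
  then show "(mp_ratio \<longlongrightarrow> 0) (at_right 0)" by (simp add: mp_ratio_def[abs_def])
  show "filterlim mp_ratio at_top (at_left 4)"
    unfolding mp_ratio_def[abs_def] by real_asymp
qed

lemma mp_density_isCont: "0 < x \<Longrightarrow> x < 4 \<Longrightarrow> isCont (\<lambda>x. 1 / (2 * pi * mp_ratio x)) x"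
  unfolding mp_ratio_def by (intro continuous_intros) auto

lemma mp_total: "has_bochner_integral lborel mp_density 1"
proof -
  \<comment> \<open>In the angle \<theta> with tan \<theta> = \<open>mp_ratio x\<close> the
    integrand becomes (4 / pi) cos^2 \<theta>, with primitive (2 / pi) (\<theta> + sin \<theta> cos
    \<theta>).\<close>
  define F where "F x = 2 / pi * (arctan (mp_ratio x) + mp_ratio x * (4 - x) / 4)" for x
  have "has_bochner_integral lborel (\<lambda>x. indicator {0<..<4} x * (1 / (2 * pi * mp_ratio x))) (1 - 0)"
  proof (rule has_bochner_integral_FTC_nonneg[of 0 4 F])
    fix x :: real assume x: "0 < x" "x < 4"
    define r where "r = mp_ratio x"
    have r: "0 < r" "r\<^sup>2 = x / (4 - x)" using mp_ratio_pos mp_ratio_sq x by (auto simp: r_def)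
    have x4: "x = 4 * r\<^sup>2 / (1 + r\<^sup>2)" "4 - x = 4 / (1 + r\<^sup>2)" using x by (simp_all add: r(2) field_simps)
    have p: "0 < 1 + r\<^sup>2" by (simp add: add_pos_nonneg)
    have D: "(F has_real_derivative 2 / pi * (inverse (1 + r\<^sup>2) * (2 / (r * (4 - x)\<^sup>2)) + (2 / (r * (4 - x)\<^sup>2) * (4 - x) + (0 - 1) * r) / 4)) (at x)"
      unfolding F_def[abs_def] r_def
      by (rule DERIV_cmult[OF DERIV_add[OF DERIV_chain2[OF DERIV_arctan mp_ratio_deriv[OF x]]
            DERIV_cdivide[OF DERIV_mult[OF mp_ratio_deriv[OF x] DERIV_diff[OF DERIV_const DERIV_ident]]]]])
    have E: "inverse (1 + r\<^sup>2) * (2 / (r * (4 - x)\<^sup>2)) + (2 / (r * (4 - x)\<^sup>2) * (4 - x) + (0 - 1) * r) / 4 = 1 / (4 * r)"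
    proof -
      define d where "d = 1 + r\<^sup>2"
      have d: "0 < d" using p by (simp add: d_def)
      have "2 / (r * (4 / d)\<^sup>2) = d\<^sup>2 / (8 * r)" using d r by (simp add: power_divide)
      moreover have "inverse d * (d\<^sup>2 / (8 * r)) = d / (8 * r)" "d\<^sup>2 / (8 * r) * (4 / d) = d / (2 * r)"
        using d r by (simp_all add: power2_eq_square field_simps)
      moreover have "d / (8 * r) + (d / (2 * r) + (0 - 1) * r) / 4 = 1 / (4 * r)"
        using r(1) by (simp add: d_def power2_eq_square field_simps)
      ultimately show ?thesis unfolding x4(2) d_def[symmetric] by (simp only:)
    qed
    have "2 / pi * (1 / (4 * r)) = 1 / (2 * pi * mp_ratio x)" by (simp add: r_def)
    then show "(F has_real_derivative 1 / (2 * pi * mp_ratio x)) (at x)" using D unfolding E by (simp only:)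
    show "isCont (\<lambda>x. 1 / (2 * pi * mp_ratio x)) x" by (rule mp_density_isCont[OF x])
    show "0 \<le> 1 / (2 * pi * mp_ratio x)" using mp_ratio_pos[OF x] by simp
  next
    have "(F \<longlongrightarrow> 2 / pi * (arctan 0 + 0 * (4 - 0) / 4)) (at_right 0)"
      unfolding F_def[abs_def] by (intro tendsto_intros mp_ratio_limits) auto
    then show "(F \<longlongrightarrow> 0) (at_right 0)" by simp
    \<comment> \<open>At 4 the ratio tends to infinity while 4 - x tends to 0; their product equals
      the square root of x (4 - x).\<close>
    have "((\<lambda>x. sqrt (x * (4 - x)) / 4) \<longlongrightarrow> sqrt (4 * (4 - 4)) / 4) (at_left 4)"
      by (intro tendsto_intros) auto
    moreover have "\<forall>\<^sub>F x in at_left 4. 0 < x \<and> x < (4::real)"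
      using eventually_at_left_real[of 0 4] by (auto elim!: eventually_mono)
    then have "\<forall>\<^sub>F x in at_left 4. sqrt (x * (4 - x)) / 4 = mp_ratio x * (4 - x) / 4"
    proof eventually_elim
      case (elim x)
      have "mp_ratio x * (4 - x) = sqrt (x / (4 - x)) * sqrt ((4 - x)\<^sup>2)" using elim by (simp add: mp_ratio_def)
      also have "\<dots> = sqrt (x / (4 - x) * (4 - x)\<^sup>2)" by (rule real_sqrt_mult[symmetric])
      also have "x / (4 - x) * (4 - x)\<^sup>2 = x * (4 - x)" using elim by (simp add: power2_eq_square)
      finally show ?case by simp
    qed
    ultimately have "((\<lambda>x. mp_ratio x * (4 - x) / 4) \<longlongrightarrow> sqrt (4 * (4 - 4)) / 4) (at_left 4)"
      by (rule Lim_transform_eventually)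
    then have z: "((\<lambda>x. mp_ratio x * (4 - x) / 4) \<longlongrightarrow> 0) (at_left 4)" by simp
    have "((\<lambda>x. arctan (mp_ratio x)) \<longlongrightarrow> pi / 2) (at_left 4)"
      by (rule filterlim_compose[OF tendsto_arctan_at_top mp_ratio_limits(2)])
    from tendsto_mult[OF tendsto_const tendsto_add[OF this z], of "2 / pi"]
    show "(F \<longlongrightarrow> 1) (at_left 4)" by (simp add: F_def[abs_def])
  qed simp
  then show ?thesis by (simp add: mp_density_def[abs_def])
qed

lemma mp_stj:
  assumes s: "0 < s"
  shows "has_bochner_integral lborel (\<lambda>x. mp_density x * (1 / (1 + s * x))) ((sqrt (1 + 4 * s) - 1) / (2 * s))"
proof -
  define c where "c = sqrt (1 + 4 * s)"
  have c: "0 < c" "c\<^sup>2 = 1 + 4 * s" using s by (auto simp: c_def)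
  \<comment> \<open>With r = \<open>mp_ratio x\<close> one has 1 + s x = (1 + c^2 r^2) / (1 + r^2),
    which is where c^2 = 1 + 4 s comes from; partial fractions in r then give the two
    arctangents.\<close>
  define F where "F x = 1 / (pi * s) * (c * arctan (c * mp_ratio x) - arctan (mp_ratio x))" for x
  have "has_bochner_integral lborel (\<lambda>x. indicator {0<..<4} x * (1 / (2 * pi * mp_ratio x) * (1 / (1 + s * x)))) ((c - 1) / (2 * s) - 0)"
  proof (rule has_bochner_integral_FTC_nonneg[of 0 4 F])
    fix x :: real assume x: "0 < x" "x < 4"
    define r where "r = mp_ratio x"
    have r: "0 < r" "r\<^sup>2 = x / (4 - x)" using mp_ratio_pos mp_ratio_sq x by (auto simp: r_def)
    have x4: "4 - x = 4 / (1 + r\<^sup>2)" using x by (simp_all add: r(2) field_simps)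
    have p: "0 < 1 + r\<^sup>2" by (simp add: add_pos_nonneg)
    have sx: "0 < 1 + s * x" using s x by (intro add_pos_pos) auto
    have d1: "1 + (c * r)\<^sup>2 = 4 * (1 + s * x) / (4 - x)"
      using x by (simp add: power_mult_distrib c r field_simps)
    have d2: "1 + r\<^sup>2 = 4 / (4 - x)" using x by (simp add: r field_simps)
    have D: "(F has_real_derivative 1 / (pi * s) * (c * (inverse (1 + (c * r)\<^sup>2) * (c * (2 / (r * (4 - x)\<^sup>2)))) - inverse (1 + r\<^sup>2) * (2 / (r * (4 - x)\<^sup>2)))) (at x)"
      unfolding F_def[abs_def] r_def
      by (rule DERIV_cmult[OF DERIV_diff[OF DERIV_cmult[OF DERIV_chain2[OF DERIV_arctan DERIV_cmult[OF mp_ratio_deriv[OF x]]]]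
            DERIV_chain2[OF DERIV_arctan mp_ratio_deriv[OF x]]]])
    have E: "c * (inverse (1 + (c * r)\<^sup>2) * (c * (2 / (r * (4 - x)\<^sup>2)))) - inverse (1 + r\<^sup>2) * (2 / (r * (4 - x)\<^sup>2)) = s / (2 * r * (1 + s * x))"
    proof -
      have "c * (inverse (1 + (c * r)\<^sup>2) * (c * (2 / (r * (4 - x)\<^sup>2)))) - inverse (1 + r\<^sup>2) * (2 / (r * (4 - x)\<^sup>2)) =
          2 / (r * (4 - x)\<^sup>2) * (c\<^sup>2 / (1 + (c * r)\<^sup>2) - 1 / (1 + r\<^sup>2))"
        by (simp add: power2_eq_square right_diff_distrib divide_inverse)
      also have "c\<^sup>2 / (1 + (c * r)\<^sup>2) - 1 / (1 + r\<^sup>2) = (4 - x) / 4 * ((1 + 4 * s) / (1 + s * x) - 1)"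
        unfolding d1 d2 c(2) right_diff_distrib by simp
      also have "(1 + 4 * s) / (1 + s * x) - 1 = s * (4 - x) / (1 + s * x)"
        using sx by (simp add: field_simps)
      also have "2 / (r * (4 - x)\<^sup>2) * ((4 - x) / 4 * (s * (4 - x) / (1 + s * x))) = s / (2 * r * (1 + s * x))"
      proof -
        have "2 / (r * D\<^sup>2) * (D / 4 * (s * D / E)) = s / (2 * r * E)" if "D \<noteq> 0" "E \<noteq> 0" for D E :: real
          using r that by (simp add: power2_eq_square field_simps)
        then show ?thesis by this (use x sx in auto)
      qed
      finally show ?thesis .
    qed
    have "1 / (pi * s) * (s / (2 * r * (1 + s * x))) = 1 / (2 * pi * mp_ratio x) * (1 / (1 + s * x))"
      using s by (simp add: r_def)
    then show "(F has_real_derivative 1 / (2 * pi * mp_ratio x) * (1 / (1 + s * x))) (at x)" using D unfolding E by (simp only:)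
    show "isCont (\<lambda>x. 1 / (2 * pi * mp_ratio x) * (1 / (1 + s * x))) x"
      using sx by (intro continuous_intros mp_density_isCont[OF x, unfolded]) auto
    show "0 \<le> 1 / (2 * pi * mp_ratio x) * (1 / (1 + s * x))" using mp_ratio_pos[OF x] sx by simp
  next
    have "(F \<longlongrightarrow> 1 / (pi * s) * (c * arctan (c * 0) - arctan 0)) (at_right 0)"
      unfolding F_def[abs_def] by (intro tendsto_intros mp_ratio_limits)
    then show "(F \<longlongrightarrow> 0) (at_right 0)" by simp
    have a1: "((\<lambda>x. arctan (mp_ratio x)) \<longlongrightarrow> pi / 2) (at_left 4)"
      by (rule filterlim_compose[OF tendsto_arctan_at_top mp_ratio_limits(2)])
    have "filterlim (\<lambda>x. c * mp_ratio x) at_top (at_left 4)"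
      by (rule filterlim_tendsto_pos_mult_at_top[OF tendsto_const c(1) mp_ratio_limits(2)])
    then have a2: "((\<lambda>x. arctan (c * mp_ratio x)) \<longlongrightarrow> pi / 2) (at_left 4)"
      by (rule filterlim_compose[OF tendsto_arctan_at_top])
    have "(F \<longlongrightarrow> 1 / (pi * s) * (c * (pi / 2) - pi / 2)) (at_left 4)"
      unfolding F_def[abs_def] by (intro tendsto_intros a1 a2)
    also have "1 / (pi * s) * (c * (pi / 2) - pi / 2) = (c - 1) / (2 * s)" using s by (simp add: field_simps)
    finally show "(F \<longlongrightarrow> (c - 1) / (2 * s)) (at_left 4)" .
  qed simp
  then show ?thesis by (simp add: mp_density_def[abs_def] c_def mult.assoc)
qed

lemma density_prob_Rplus:
  fixes f :: "real \<Rightarrow> real"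
  assumes f: "has_bochner_integral lborel f 1" and nn: "\<And>x. 0 \<le> f x" and z: "\<And>x. x < 0 \<Longrightarrow> f x = 0"
    and [measurable]: "f \<in> borel_measurable borel"
  shows "density lborel f \<in> prob_Rplus" "measure (density lborel f) {0} = 0"
proof -
  have "(\<integral>\<^sup>+x. ennreal (f x) \<partial>lborel) = ennreal 1"
    using f nn by (subst nn_integral_eq_integral) (auto simp: has_bochner_integral_iff)
  then have "emeasure (density lborel f) (space (density lborel f)) = 1" by (simp add: emeasure_density)
  then interpret prob_space "density lborel f" by (rule prob_spaceI)
  show "density lborel f \<in> prob_Rplus"
  proof (rule prob_RplusI)
    show "real_distribution (density lborel f)" by unfold_locales auto
    show "AE x in density lborel f. 0 \<le> x" by (subst AE_density) (simp, rule AE_I2, rule impI, rule ccontr, simp add: z)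
  qed
  have "emeasure (density lborel f) {0} = (\<integral>\<^sup>+x. 0 \<partial>lborel)"
    by (subst emeasure_density) (auto intro!: nn_integral_cong_AE eventually_mono[OF AE_lborel_singleton[of 0]])
  then show "measure (density lborel f) {0} = 0" by (simp add: measure_def)
qed

lemma mp_prob_Rplus: "marchenko_pastur \<in> prob_Rplus" "measure marchenko_pastur {0} = 0"
proof -
  have "mp_density x = 0" if "x < 0" for x using that by (simp add: mp_density_def)
  note D = density_prob_Rplus[OF mp_total mp_density_nonneg this mp_density_measurable]
  show "marchenko_pastur \<in> prob_Rplus" "measure marchenko_pastur {0} = 0"
    unfolding marchenko_pastur_eq using D by auto
qed

lemma neq_delta0: "measure \<mu> {0} = 0 \<Longrightarrow> \<mu> \<noteq> delta0"
  by (auto simp: measure_return)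

lemma stj_mp: "0 < s \<Longrightarrow> stj marchenko_pastur s = (sqrt (1 + 4 * s) - 1) / (2 * s)"
  unfolding stj_def marchenko_pastur_eq
  by (subst integral_density) (use mp_stj[of s] in \<open>auto simp: has_bochner_integral_iff mp_density_nonneg\<close>)

text \<open>The closed form is the positive root of s R^2 + R - 1 = 0. Used in this form, the
  equation gives s R / (1 - R) = 1 / R at once.\<close>

lemma stj_mp_quadratic:
  assumes "0 < s"
  shows "s * (stj marchenko_pastur s)\<^sup>2 = 1 - stj marchenko_pastur s"
proof -
  define q where "q = sqrt (1 + 4 * s)"
  have q: "q\<^sup>2 = 1 + 4 * s" using assms by (simp add: q_def)
  have "s * ((q - 1) / (2 * s))\<^sup>2 = (q\<^sup>2 - 2 * q + 1) / (4 * s)"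
    using assms by (simp add: power2_eq_square field_simps)
  also have "q\<^sup>2 - 2 * q + 1 = 2 * (2 * s) - 2 * (q - 1)" unfolding q by simp
  also have "\<dots> / (4 * s) = 1 - (q - 1) / (2 * s)" using assms by (simp add: diff_divide_distrib)
  finally show ?thesis by (simp add: stj_mp[OF assms] q_def)
qed

lemma has_S_mp: "has_S marchenko_pastur 0 (\<lambda>t. 1 / (1 + t))"
proof (rule has_SI_stj[OF mp_prob_Rplus(1) neq_delta0[OF mp_prob_Rplus(2)] mp_prob_Rplus(2)])
  fix s :: real assume s: "0 < s"
  define R where "R = stj marchenko_pastur s"
  have R: "0 < R" "R < 1" "s * R\<^sup>2 = 1 - R"
    using stj_pos_less_1[OF mp_prob_Rplus(1) neq_delta0[OF mp_prob_Rplus(2)] s] stj_mp_quadratic[OF s]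
    by (auto simp: R_def)
  have "s * R / (1 - R) = 1 / R" using R by (simp add: field_simps power2_eq_square)
  then show "s * stj marchenko_pastur s / (1 - stj marchenko_pastur s) = 1 / (1 + (stj marchenko_pastur s - 1))"
    by (simp add: R_def)
qed

section \<open>The inverse Marchenko-Pastur law and the maps Theta and Xi\<close>

lemma pow_push_inverse_facts:
  assumes \<mu>: "\<mu> \<in> prob_Rplus" "measure \<mu> {0} = 0"
  shows "measure (pow_push (- 1) \<mu>) {0} = 0"
    and "0 < s \<Longrightarrow> stj (pow_push (- 1) \<mu>) s = 1 - stj \<mu> (1 / s)"
proof -
  interpret real_distribution \<mu> using \<mu>(1) by (rule prob_RplusD)
  \<comment> \<open>By the convention \<open>0 powr - 1 = 0\<close> the preimage of {0} is {0}, a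
    null set here.\<close>
  have "(\<lambda>x::real. x powr - 1) -` {0} \<inter> space \<mu> = {0}" by auto
  then show "measure (pow_push (- 1) \<mu>) {0} = 0"
    unfolding pow_push_def by (subst measure_distr) (auto simp: \<mu>)
  have "AE u in \<mu>. u \<noteq> 0" using \<mu>(2) by (intro AE_I[of _ _ "{0}"]) (auto simp: emeasure_eq_measure)
  then have pos: "AE u in \<mu>. 0 < u" using prob_RplusD(2)[OF \<mu>(1)] by eventually_elim auto
  show "stj (pow_push (- 1) \<mu>) s = 1 - stj \<mu> (1 / s)" if s: "0 < s"
  proof -
    have "stj (pow_push (- 1) \<mu>) s = (LINT u|\<mu>. 1 / (1 + s * (u powr - 1)))"
      unfolding stj_def pow_push_def by (subst integral_distr) auto
    also have "\<dots> = (LINT u|\<mu>. 1 - 1 / (1 + 1 / s * u))"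
    proof (rule integral_cong_AE)
      show "AE u in \<mu>. 1 / (1 + s * (u powr - 1)) = 1 - 1 / (1 + 1 / s * u)"
        using pos by eventually_elim (use s in \<open>simp add: powr_minus divide_simps add_pos_pos\<close>)
    qed auto
    also have "\<dots> = 1 - stj \<mu> (1 / s)"
      unfolding stj_def using stj_integrable[OF \<mu>(1), of "1 / s"] s prob_space by simp
    finally show ?thesis .
  qed
qed

abbreviation mp_inv :: "real measure" where "mp_inv \<equiv> pow_push (- 1) marchenko_pastur"

lemma has_S_mp_inv: "has_S mp_inv 0 (\<lambda>t. - t)"
proof -
  note f = pow_push_inverse_facts[OF mp_prob_Rplus]
  show ?thesis
  proof (rule has_SI_stj[OF pow_push_prob_Rplus[OF mp_prob_Rplus(1)] neq_delta0[OF f(1)] f(1)])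
    fix s :: real assume s: "0 < s"
    define R where "R = stj marchenko_pastur (1 / s)"
    have "0 < R" "1 / s * R\<^sup>2 = 1 - R"
      using stj_pos_less_1[OF mp_prob_Rplus(1) neq_delta0[OF mp_prob_Rplus(2)], of "1 / s"]
        stj_mp_quadratic[of "1 / s"] s by (auto simp: R_def)
    then have "s * (1 - R) / (1 - (1 - R)) = - (1 - R - 1)"
      using s by (simp add: field_simps power2_eq_square)
    then show "s * stj mp_inv s / (1 - stj mp_inv s) = - (stj mp_inv s - 1)"
      unfolding f(2)[OF s] R_def .
  qed
qed

text \<open>The unit of free convolution, from which the free stable law is built by multiplying the
  S-transform by a power of -t.\<close>

lemma has_S_delta1: "has_S (return borel 1) 0 (\<lambda>_. 1)"
proof (rule has_SI_stj)
  show "return borel 1 \<in> prob_Rplus"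
    by (intro prob_RplusI) (auto simp: AE_return real_distribution_def real_distribution_axioms_def prob_space_return)
  show "measure (return borel (1::real)) {0} = 0" by (simp add: measure_return)
  then show "return borel 1 \<noteq> delta0" by (rule neq_delta0)
  fix s :: real assume s: "0 < s"
  then have "1 - 1 / (1 + s) = s / (1 + s)" by (simp add: field_simps)
  then show "s * stj (return borel 1) s / (1 - stj (return borel 1) s) = 1"
    using s by (simp add: stj_def integral_return)
qed

lemma has_S_free_stable_law:
  assumes "0 < \<alpha>" "\<alpha> < 1"
  shows "has_S (free_stable_law \<alpha>) 0 (\<lambda>t. (- t) powr ((1 - \<alpha>) / \<alpha>))"
proof -
  obtain \<rho> where "has_S \<rho> 0 (\<lambda>t. 1 * (- t) powr ((1 - \<alpha>) / \<alpha>))"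
    using has_S_mult_neg_powr[OF has_S_delta1, of "(1 - \<alpha>) / \<alpha>"] assms by auto
  then have \<rho>: "has_S \<rho> 0 (\<lambda>t. (- t) powr ((1 - \<alpha>) / \<alpha>))" by simp
  from measure_of_S_eqI[OF \<rho>] \<rho> show ?thesis by (simp add: free_stable_law_def)
qed

lemma has_S_mp_inv_conv:
  assumes "has_S \<mu> m g"
  shows "has_S (mp_inv \<boxtimes> \<mu>) m (\<lambda>t. - t * g t)"
proof -
  obtain \<rho> where "has_S \<rho> m (\<lambda>t. g t * (- t) powr 1)"
    using has_S_mult_neg_powr[OF assms, of 1] by auto
  then have "has_S \<rho> m (\<lambda>t. - t * g t)" by (rule has_S_cong) auto
  from free_mult_conv_has_S[OF has_S_mp_inv assms this] show ?thesis .
qed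

lemma Theta_F_map:
  assumes \<alpha>: "0 < \<alpha>" "\<alpha> < 1" and \<mu>: "\<mu> \<in> prob_Rplus"
  shows "Theta (F_map \<alpha> \<mu>) = pow_push (1 / \<alpha>) (Theta \<mu>)"
proof (cases "\<mu> = delta0")
  case True
  then show ?thesis
    by (simp add: Theta_def F_map_def free_mult_pow_def free_mult_conv_def Phi_delta0 pow_push_delta0)
next
  case False
  define m where "m = measure \<mu> {0}"
  define g where "g = S_transform \<mu>"
  have S: "has_S \<mu> m g" unfolding m_def g_def using has_S_self[OF \<mu> False] .
  have pos: "0 < g t" "t < 0" if "t \<in> {- 1 + m<..<0}" for t using has_S_pos[OF S that] that by auto
  have "has_S (free_mult_pow \<mu> (1 / \<alpha>)) m (\<lambda>t. g t powr (1 / \<alpha>))"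
    by (rule free_mult_pow_has_S[OF S]) (use \<alpha> in auto)
  note P = this
  obtain \<rho> where "has_S \<rho> m (\<lambda>t. g t powr (1 / \<alpha>) * (- t) powr ((1 - \<alpha>) / \<alpha>))"
    using has_S_mult_neg_powr[OF P, of "(1 - \<alpha>) / \<alpha>"] \<alpha> by auto
  then have "has_S \<rho> m (\<lambda>t. (- t) powr ((1 - \<alpha>) / \<alpha>) * g t powr (1 / \<alpha>))" by (simp add: mult.commute)
  from free_mult_conv_has_S[OF has_S_free_stable_law[OF \<alpha>] P this]
  have "has_S (F_map \<alpha> \<mu>) m (\<lambda>t. (- t) powr ((1 - \<alpha>) / \<alpha>) * g t powr (1 / \<alpha>))"
    by (simp add: F_map_def)
  from has_S_mp_inv_conv[OF this]
  have "has_S (mp_inv \<boxtimes> F_map \<alpha> \<mu>) m (\<lambda>t. (- t * g t) powr (1 / \<alpha>))"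
  proof (rule has_S_cong)
    fix t assume "t \<in> {- 1 + m<..<0}"
    note p = pos[OF this]
    \<comment> \<open>The factor -t of the inverse Marchenko-Pastur law completes the exponent of
      the free stable law to 1 / \<alpha>.\<close>
    have "1 + (1 - \<alpha>) / \<alpha> = 1 / \<alpha>" using \<alpha> by (simp add: field_simps)
    then have "- t * (- t) powr ((1 - \<alpha>) / \<alpha>) = (- t) powr (1 / \<alpha>)"
      using powr_add[of "- t" 1 "(1 - \<alpha>) / \<alpha>"] p by simp
    then show "- t * ((- t) powr ((1 - \<alpha>) / \<alpha>) * g t powr (1 / \<alpha>)) = (- t * g t) powr (1 / \<alpha>)"
      using p powr_mult[of "- t" "g t" "1 / \<alpha>"] by (simp add: mult.assoc[symmetric])
  qed
  from Phi_powr[OF has_S_mp_inv_conv[OF S] this] show ?thesis by (simp add: Theta_def)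
qed

text \<open>The three factors give S-transform -t / (1 + t) times that of \<open>\<mu>\<close>. At t
  = R - 1 this is (1 - R) / R times s R / (1 - R), which is s, so it inverts R - 1. For
  \<open>delta0\<close> both sides are 1.\<close>

lemma Xi_cdf:
  assumes \<mu>: "\<mu> \<in> prob_Rplus"
  shows "Xi \<mu> \<in> prob_Rplus" "0 < x \<Longrightarrow> cdf (Xi \<mu>) x = stj \<mu> (1 / x)"
proof -
  have "Xi \<mu> \<in> prob_Rplus \<and> (\<forall>x>0. cdf (Xi \<mu>) x = stj \<mu> (1 / x))"
  proof (cases "\<mu> = delta0")
    case True
    then have "Xi \<mu> = delta0" by (simp add: Xi_def free_mult_conv_def Phi_delta0)
    then show ?thesis using True delta0_prob_Rplus by (simp add: cdf_def stj_def integral_return measure_return)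
  next
    case False
    define m where "m = measure \<mu> {0}"
    define g where "g = S_transform \<mu>"
    have S: "has_S \<mu> m g" unfolding m_def g_def using has_S_self[OF \<mu> False] .
    define k where "k t = - t * (1 / (1 + t)) * g t" for t
    obtain \<rho> where "has_S \<rho> m (\<lambda>t. - t * g t * (1 / (1 + t)))"
      by (rule has_S_divide_one_plus[OF has_S_mp_inv_conv[OF S]])
    then have \<rho>: "has_S \<rho> m k" by (rule has_S_cong) (simp add: k_def)
    have "has_S (mp_inv \<boxtimes> marchenko_pastur \<boxtimes> \<mu>) m k"
      unfolding k_def by (rule free_mult_conv_has_S[OF has_S_mp_inv_conv[OF has_S_mp] S]) (use \<rho> in \<open>simp add: k_def[abs_def]\<close>)
    note S' = this
    have "k (stj \<mu> s - 1) = s" if "0 < s" for s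
      using has_S_stj(1)[OF S that] stj_pos_less_1[OF \<mu> False that] by (simp add: k_def)
    from cdf_Phi_inverse_stj[OF \<mu> False S'[unfolded m_def] this]
    have "cdf (Xi \<mu>) x = stj \<mu> (1 / x)" if "0 < x" for x using that by (simp add: Xi_def)
    moreover have "Xi \<mu> \<in> prob_Rplus"
      unfolding Xi_def Phi_has_S[OF S'] by (rule distr_quantile_S_prob_Rplus[OF S'])
    ultimately show ?thesis by simp
  qed
  then show "Xi \<mu> \<in> prob_Rplus" "0 < x \<Longrightarrow> cdf (Xi \<mu>) x = stj \<mu> (1 / x)" by auto
qed

section \<open>The boolean stable law\<close>

text \<open>Used to move horizontal edges onto the real axis, where contour integrals become
  ordinary ones.\<close>

lemma contour_integral_linepath_translate:
  "contour_integral (linepath (a + h) (b + h)) f = contour_integral (linepath a b) (\<lambda>z. f (z + h))"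
proof -
  have "linepath (a + h) (b + h) t = linepath a b t + h" for t
    by (simp add: linepath_def scaleR_conv_of_real algebra_simps)
  then show ?thesis by (simp add: contour_integral_integral)
qed

text \<open>The boundary values on \<open>Im w = \<plusminus> pi\<close> of the integrand \<open>\<phi> w / (x - exp w)\<close>, where
  \<open>\<phi> (ln u) = u powr \<alpha> / (1 + u powr \<alpha>)\<close>, produce the density of the boolean stable law.\<close>

locale boolean_contour =
  fixes \<alpha> x :: real
  assumes \<alpha>: "0 < \<alpha>" "\<alpha> < 1" and x: "0 < x"
begin

definition \<phi> :: "complex \<Rightarrow> complex" where "\<phi> w = exp (of_real \<alpha> * w) / (1 + exp (of_real \<alpha> * w))"

text \<open>An open neighbourhood of the closed strip of half-width pi. The bound 3 pi / 2 leaves ln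
  x as the only solution of exp w = x, and pi / \<alpha> excludes zeros of 1 + exp(\<alpha>
  w).\<close>

definition strip :: "complex set" where "strip = {w. \<bar>Im w\<bar> < min (3 * pi / 2) (pi / \<alpha>)}"

text \<open>Under u = exp y this is pi times the integrand of the Stieltjes integral of the boolean
  stable density, Jacobian included.\<close>

definition p :: "real \<Rightarrow> real" where
  "p y = exp (\<alpha> * y) * sin (pi * \<alpha>) / (exp (\<alpha> * y) ^ 2 + 2 * exp (\<alpha> * y) * cos (pi * \<alpha>) + 1) / (x + exp y)"

lemma strip_bound: "w \<in> strip \<Longrightarrow> \<bar>Im w\<bar> < 3 * pi / 2" "w \<in> strip \<Longrightarrow> \<bar>\<alpha> * Im w\<bar> < pi"
proof -
  show "w \<in> strip \<Longrightarrow> \<bar>Im w\<bar> < 3 * pi / 2" by (simp add: strip_def)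
  assume "w \<in> strip"
  then have "\<bar>Im w\<bar> < pi / \<alpha>" by (simp add: strip_def)
  then have "\<alpha> * \<bar>Im w\<bar> < pi" using \<alpha>(1) by (simp add: field_simps)
  then show "\<bar>\<alpha> * Im w\<bar> < pi" using \<alpha>(1) by (simp add: abs_mult)
qed

lemma strip_facts: "open strip" "convex strip"
proof -
  have e: "strip = {w. Im w < min (3 * pi / 2) (pi / \<alpha>)} \<inter> {w. Im w > - min (3 * pi / 2) (pi / \<alpha>)}"
    by (auto simp: strip_def)
  show "open strip" unfolding e by (intro open_Int open_halfspace_Im_lt open_halfspace_Im_gt)
  show "convex strip" unfolding e by (intro convex_Int convex_halfspace_Im_lt convex_halfspace_Im_gt)
qed

lemma strip_pi: "\<bar>Im w\<bar> \<le> pi \<Longrightarrow> w \<in> strip"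
proof -
  assume w: "\<bar>Im w\<bar> \<le> pi"
  have "pi < pi / \<alpha>" using \<alpha> by (simp add: field_simps)
  then show "w \<in> strip" using w pi_gt_zero
    unfolding strip_def mem_Collect_eq min_less_iff_conj by (intro conjI) linarith+
qed

lemma one_plus_exp_nonzero:
  assumes "w \<in> strip"
  shows "1 + exp (of_real \<alpha> * w) \<noteq> 0"
proof
  assume "1 + exp (of_real \<alpha> * w) = 0"
  then have e: "exp (of_real \<alpha> * w) = - 1" by (simp add: eq_neg_iff_add_eq_0 add.commute)
  have im: "exp (\<alpha> * Re w) * sin (\<alpha> * Im w) = 0" using arg_cong[OF e, of Im] unfolding Im_exp by simp
  have re: "exp (\<alpha> * Re w) * cos (\<alpha> * Im w) = - 1" using arg_cong[OF e, of Re] unfolding Re_exp by simp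
  have "- pi < \<alpha> * Im w" "\<alpha> * Im w < pi" using strip_bound(2)[OF assms] unfolding abs_less_iff by linarith+
  moreover have "sin (\<alpha> * Im w) = 0" using im by (simp only: mult_eq_0_iff exp_not_eq_zero simp_thms)
  ultimately have "\<alpha> * Im w = 0" by (rule sin_eq_0_pi)
  with re have "exp (\<alpha> * Re w) = - 1" by (simp only: cos_zero mult_1_right)
  then show False using exp_gt_zero[of "\<alpha> * Re w"] by linarith
qed

lemma exp_eq_x:
  assumes "w \<in> strip" "exp w = of_real x"
  shows "w = of_real (ln x)"
proof -
  have "exp w = exp (of_real (ln x))" using assms(2) x by (simp add: exp_of_real)
  then obtain n :: int where n: "w = of_real (ln x) + of_int (2 * n) * of_real pi * \<i>"
    by (auto simp: exp_eq)
  then have "Im w = 2 * n * pi" by simp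
  then have "\<bar>real_of_int n\<bar> * (2 * pi) < 3 / 4 * (2 * pi)" using strip_bound(1)[OF assms(1)] by (simp add: abs_mult)
  then have "\<bar>real_of_int n\<bar> < 3 / 4" using pi_gt_zero by (simp only: mult_less_cancel_right)
  then have "n = 0" by linarith
  then show ?thesis using n by simp
qed

lemma \<phi>_holomorphic: "\<phi> holomorphic_on strip"
  unfolding \<phi>_def[abs_def] using one_plus_exp_nonzero by (intro holomorphic_intros) auto

lemma F_holomorphic: "(\<lambda>w. \<phi> w / (of_real x - exp w)) holomorphic_on strip - {of_real (ln x)}"
  using exp_eq_x by (intro holomorphic_intros holomorphic_on_subset[OF \<phi>_holomorphic]) auto

lemma \<phi>_ln: "\<phi> (of_real (ln x)) = of_real (x powr \<alpha> / (1 + x powr \<alpha>))"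
  using x by (simp add: \<phi>_def powr_def mult.commute flip: exp_of_real of_real_mult)

lemma residue_F: "residue (\<lambda>w. \<phi> w / (of_real x - exp w)) (of_real (ln x)) = - of_real (x powr \<alpha> / (1 + x powr \<alpha>) / x)"
proof -
  have s: "complex_of_real (ln x) \<in> strip" by (rule strip_pi) simp
  have e: "exp (complex_of_real (ln x)) = of_real x" using x by (simp add: exp_of_real)
  have "residue (\<lambda>w. \<phi> w / (of_real x - exp w)) (of_real (ln x)) = \<phi> (of_real (ln x)) / (0 - exp (of_real (ln x)))"
  proof (rule residue_simple_pole_deriv[OF \<phi>_holomorphic _ strip_facts(1) convex_connected[OF strip_facts(2)] s])
    show "(\<lambda>w. of_real x - exp w) holomorphic_on strip" by (intro holomorphic_intros)
    show "((\<lambda>w. of_real x - exp w) has_field_derivative 0 - exp (of_real (ln x))) (at (of_real (ln x)))"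
      by (intro DERIV_diff DERIV_const DERIV_exp)
    have "0 < x powr \<alpha> / (1 + x powr \<alpha>)" using x by (intro divide_pos_pos add_pos_pos) auto
    then show "\<phi> (of_real (ln x)) \<noteq> 0" unfolding \<phi>_ln by (metis less_irrefl of_real_eq_0_iff)
  qed (use x e in auto)
  then show ?thesis by (simp add: e \<phi>_ln)
qed

text \<open>On both lines exp w = -exp y, and the two values of \<open>\<phi>\<close> are complex
  conjugates; the difference is therefore -2i times the imaginary part of \<open>\<phi>\<close> on
  the upper line, over x + exp y.\<close>

lemma boundary_difference:
  "\<phi> (of_real y + of_real (- pi) * \<i>) / (of_real x - exp (of_real y + of_real (- pi) * \<i>))
    - \<phi> (of_real y + of_real pi * \<i>) / (of_real x - exp (of_real y + of_real pi * \<i>)) = - 2 * \<i> * of_real (p y)"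
proof -
  define E where "E = exp (\<alpha> * y)"
  have E: "0 < E" by (simp add: E_def)
  have eg: "exp (of_real a + of_real t * \<i>) = of_real (exp a) * Complex (cos t) (sin t)" for a t :: real
    by (rule complex_eqI) (simp_all add: Re_exp Im_exp)
  have ex: "exp (of_real y + of_real (- pi) * \<i>) = - of_real (exp y)" "exp (of_real y + of_real pi * \<i>) = - of_real (exp y)"
    unfolding eg by (rule complex_eqI; simp)+
  have ea: "exp (of_real \<alpha> * (of_real y + of_real t * \<i>)) = of_real E * Complex (cos (\<alpha> * t)) (sin (\<alpha> * t))" for t
  proof -
    have "of_real \<alpha> * (of_real y + of_real t * \<i>) = of_real (\<alpha> * y) + of_real (\<alpha> * t) * \<i>"
      by (simp add: algebra_simps)
    then show ?thesis unfolding E_def by (simp only: eg)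
  qed
  define c where "c = cos (pi * \<alpha>)"
  define s where "s = sin (pi * \<alpha>)"
  have cs: "c\<^sup>2 + s\<^sup>2 = 1" by (simp add: c_def s_def)
  have D: "(1 + E * c)\<^sup>2 + (E * s)\<^sup>2 = E\<^sup>2 + 2 * E * c + 1"
  proof -
    have "(1 + E * c)\<^sup>2 + (E * s)\<^sup>2 = 1 + 2 * E * c + E\<^sup>2 * (c\<^sup>2 + s\<^sup>2)" by (simp add: power2_eq_square algebra_simps)
    then show ?thesis by (simp add: cs)
  qed
  have p1: "\<phi> (of_real y + of_real pi * \<i>) = of_real E * Complex c s / (1 + of_real E * Complex c s)"
    unfolding \<phi>_def ea by (simp add: c_def s_def mult.commute)
  have p2: "\<phi> (of_real y + of_real (- pi) * \<i>) = of_real E * Complex c (- s) / (1 + of_real E * Complex c (- s))"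
    unfolding \<phi>_def ea by (simp add: c_def s_def mult.commute)
  have "cnj (of_real E * Complex c s / (1 + of_real E * Complex c s)) = of_real E * Complex c (- s) / (1 + of_real E * Complex c (- s))"
    by (simp add: complex_cnj)
  then have "\<phi> (of_real y + of_real (- pi) * \<i>) - \<phi> (of_real y + of_real pi * \<i>) =
      - 2 * \<i> * of_real (Im (of_real E * Complex c s / (1 + of_real E * Complex c s)))"
    unfolding p1 p2 by (metis complex_diff_cnj minus_diff_eq mult_minus_left mult.commute mult.assoc of_real_mult of_real_numeral)
  moreover have "Im (of_real E * Complex c s / (1 + of_real E * Complex c s)) = E * s / (E\<^sup>2 + 2 * E * c + 1)"
  proof -
    have "Im (of_real E * Complex c s / (1 + of_real E * Complex c s)) =
        (E * s * (1 + E * c) - E * c * (E * s)) / ((1 + E * c)\<^sup>2 + (E * s)\<^sup>2)"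
      unfolding Im_divide by simp
    also have "E * s * (1 + E * c) - E * c * (E * s) = E * s" by (simp add: algebra_simps)
    finally show ?thesis unfolding D .
  qed
  ultimately have "\<phi> (of_real y + of_real (- pi) * \<i>) - \<phi> (of_real y + of_real pi * \<i>) = - 2 * \<i> * of_real (E * s / (E\<^sup>2 + 2 * E * c + 1))"
    by simp
  moreover have "of_real x - - of_real (exp y) = complex_of_real (x + exp y)" by simp
  ultimately show ?thesis
    unfolding ex by (simp add: p_def E_def[symmetric] c_def s_def diff_divide_distrib[symmetric])
qed

lemma sin_pos: "0 < sin (pi * \<alpha>)"
  using \<alpha> pi_gt_zero by (intro sin_gt_zero) auto

lemma denom_pos: "0 < v \<Longrightarrow> 0 < v\<^sup>2 + 2 * v * cos (pi * \<alpha>) + 1"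
proof -
  assume v: "0 < v"
  have "v\<^sup>2 + 2 * v * cos (pi * \<alpha>) + 1 = (v + cos (pi * \<alpha>))\<^sup>2 + (sin (pi * \<alpha>))\<^sup>2"
    using sin_cos_squared_add[of "pi * \<alpha>"] by (simp add: power2_eq_square algebra_simps)
  moreover have "0 < (sin (pi * \<alpha>))\<^sup>2" using sin_pos by simp
  ultimately show ?thesis by (simp add: add_nonneg_pos)
qed

lemma p_continuous: "continuous_on A p"
proof -
  have "exp (\<alpha> * y) ^ 2 + 2 * exp (\<alpha> * y) * cos (pi * \<alpha>) + 1 \<noteq> 0" "x + exp y \<noteq> 0" for y
    using denom_pos[of "exp (\<alpha> * y)"] x by (auto simp: add_pos_pos less_imp_neq[symmetric])
  then show ?thesis unfolding p_def[abs_def] by (intro continuous_intros) auto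
qed

lemma p_nonneg: "0 \<le> p y"
proof -
  have "0 < x + exp y" using x by (intro add_pos_pos) auto
  then show ?thesis unfolding p_def using denom_pos[of "exp (\<alpha> * y)"] sin_pos
    by (intro divide_nonneg_nonneg mult_nonneg_nonneg less_imp_le) auto
qed

text \<open>The first summand bounds the left edge, where \<open>\<phi>\<close> decays; the second
  bounds the right edge, where 1 / (x - exp w) decays. Their sum serves for both.\<close>

lemma vertical_bounds:
  assumes N: "\<bar>ln x\<bar> < N" and w: "Re w = N \<or> Re w = - N"
  shows "norm (\<phi> w / (of_real x - exp w)) \<le>
    exp (- \<alpha> * N) / (1 - exp (- \<alpha> * N)) * (1 / (x - exp (- N)))
      + 1 / (1 - exp (- \<alpha> * N)) * (exp (- N) / (1 - x * exp (- N)))" (is "_ \<le> ?L + ?R")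
proof -
  define b where "b = exp (- \<alpha> * N)"
  define d where "d = exp (- N)"
  have N0: "0 < N" using N by simp
  have b: "0 < b" "b < 1" using N0 \<alpha> by (auto simp: b_def)
  have "d < exp (ln x)" unfolding d_def using N by (subst exp_less_cancel_iff) auto
  then have d: "0 < d" "d < x" using x by (auto simp: d_def)
  have "x * d < 1"
  proof -
    have "exp (ln x) * d = exp (ln x - N)" by (simp add: d_def exp_diff exp_minus divide_inverse)
    also have "\<dots> < 1" using N by simp
    finally show ?thesis using x by simp
  qed
  have na: "norm (exp (of_real \<alpha> * w)) = exp (\<alpha> * Re w)" and nw: "norm (exp w) = exp (Re w)"
    by (simp_all add: norm_exp_eq_Re)
  have nn: "0 \<le> ?L" "0 \<le> ?R" unfolding b_def[symmetric] d_def[symmetric] using b d \<open>x * d < 1\<close> by auto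
  from w show ?thesis
  proof
    assume r: "Re w = N"
    have 1: "norm (\<phi> w) \<le> 1 / (1 - b)"
    proof -
      have "exp (\<alpha> * N) - 1 \<le> norm (1 + exp (of_real \<alpha> * w))"
        using norm_triangle_ineq2[of "exp (of_real \<alpha> * w)" "- 1"] na r by (simp add: add.commute)
      moreover have "1 < exp (\<alpha> * N)" using N0 \<alpha> by simp
      ultimately have "norm (\<phi> w) \<le> exp (\<alpha> * N) / (exp (\<alpha> * N) - 1)"
        unfolding \<phi>_def norm_divide na r by (intro divide_left_mono mult_pos_pos) auto
      also have "\<dots> = 1 / (1 - b)" using \<open>1 < exp (\<alpha> * N)\<close> by (simp add: b_def exp_minus field_simps)
      finally show ?thesis .
    qed
    have 2: "1 / norm (of_real x - exp w) \<le> d / (1 - x * d)"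
    proof -
      have "exp N - x \<le> norm (of_real x - exp w)"
        using norm_triangle_ineq2[of "exp w" "of_real x"] nw r x by (simp add: norm_minus_commute)
      moreover have "exp N - x = (1 - x * d) / d" by (simp add: d_def exp_minus field_simps)
      moreover have "0 < (1 - x * d) / d" using \<open>x * d < 1\<close> d by simp
      ultimately have "1 / norm (of_real x - exp w) \<le> 1 / ((1 - x * d) / d)" by (intro divide_left_mono mult_pos_pos) auto
      then show ?thesis by simp
    qed
    have "norm (\<phi> w) * (1 / norm (of_real x - exp w)) \<le> ?R"
      unfolding b_def[symmetric] d_def[symmetric] using 1 2 b by (intro mult_mono) auto
    then show ?thesis using nn by (simp add: norm_divide)
  next
    assume r: "Re w = - N"
    have 1: "norm (\<phi> w) \<le> b / (1 - b)"
    proof -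
      have "1 - b \<le> norm (1 + exp (of_real \<alpha> * w))"
        using norm_triangle_ineq2[of 1 "- exp (of_real \<alpha> * w)"] na r by (simp add: b_def)
      then show ?thesis unfolding \<phi>_def norm_divide na r using b
        by (intro frac_le) (auto simp: b_def)
    qed
    have 2: "1 / norm (of_real x - exp w) \<le> 1 / (x - d)"
    proof -
      have "x - d \<le> norm (of_real x - exp w)"
        using norm_triangle_ineq2[of "of_real x" "exp w"] nw r x by (simp add: d_def)
      then show ?thesis using d by (intro divide_left_mono mult_pos_pos) auto
    qed
    have "norm (\<phi> w) * (1 / norm (of_real x - exp w)) \<le> ?L"
      unfolding b_def[symmetric] d_def[symmetric] using 1 2 b by (intro mult_mono) auto
    then show ?thesis using nn by (simp add: norm_divide)
  qed
qed

text \<open>Residue theorem on the rectangle with corners \<plusminus>N \<plusminus> i pi: the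
  horizontal edges contribute -2i times the integral of \<open>p\<close>, the residue at ln x
  contributes the main term, and the vertical edges, each of length 2 pi, give the error.\<close>

lemma integral_p_estimate:
  assumes N: "\<bar>ln x\<bar> < N"
  shows "\<bar>integral {- N..N} p - pi * (x powr \<alpha> / (1 + x powr \<alpha>) / x)\<bar> \<le>
    (exp (- \<alpha> * N) / (1 - exp (- \<alpha> * N)) * (1 / (x - exp (- N)))
      + 1 / (1 - exp (- \<alpha> * N)) * (exp (- N) / (1 - x * exp (- N)))) * (2 * pi)" (is "_ \<le> ?M * _")
proof -
  define F where "F w = \<phi> w / (of_real x - exp w)" for w
  define a1 where "a1 = Complex (- N) (- pi)"
  define a2 where "a2 = Complex N (- pi)"
  define a3 where "a3 = Complex N pi"
  define a4 where "a4 = Complex (- N) pi"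
  define w0 where "w0 = complex_of_real (ln x)"
  have N0: "0 < N" using N by simp
  have cb: "cbox a1 a3 \<subseteq> strip"
    by (auto simp: in_cbox_complex_iff a1_def a3_def intro!: strip_pi)
  have box: "w0 \<in> box a1 a3" using N pi_gt_zero by (auto simp: in_box_complex_iff a1_def a3_def w0_def)
  have pim: "path_image (rectpath a1 a3) = cbox a1 a3 - box a1 a3"
    using N0 pi_gt_zero by (intro path_image_rectpath_cbox_minus_box) (auto simp: a1_def a3_def)
  then have sub: "path_image (rectpath a1 a3) \<subseteq> strip - {w0}" using cb box by auto
  have holo: "F holomorphic_on strip - {w0}" unfolding F_def[abs_def] w0_def by (rule F_holomorphic)
  have rp: "rectpath a1 a3 = linepath a1 a2 +++ linepath a2 a3 +++ linepath a3 a4 +++ linepath a4 a1"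
    by (simp add: rectpath_def Let_def a1_def a2_def a3_def a4_def)
  have op: "open (strip - {w0})" using strip_facts(1) by auto
  have ci: "F contour_integrable_on linepath a1 a2" "F contour_integrable_on linepath a2 a3"
    "F contour_integrable_on linepath a3 a4" "F contour_integrable_on linepath a4 a1"
    using sub unfolding rp
    by (auto intro!: contour_integrable_holomorphic_simple[OF holo op] simp: path_image_join)
  have "contour_integral (rectpath a1 a3) F = 2 * pi * \<i> * (\<Sum>q\<in>{w0}. winding_number (rectpath a1 a3) q * residue F q)"
  proof (rule Residue_theorem[OF strip_facts(1) convex_connected[OF strip_facts(2)] _ holo _ _ sub])
    show "\<forall>z. z \<notin> strip \<longrightarrow> winding_number (rectpath a1 a3) z = 0"
      using cb N0 pi_gt_zero by (auto intro!: winding_number_rectpath_outside simp: a1_def a3_def)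
  qed auto
  also have "\<dots> = - 2 * pi * \<i> * of_real (x powr \<alpha> / (1 + x powr \<alpha>) / x)"
    using winding_number_rectpath[OF box] residue_F by (simp add: F_def[abs_def] w0_def)
  finally have total: "contour_integral (linepath a1 a2) F + contour_integral (linepath a2 a3) F
      + contour_integral (linepath a3 a4) F + contour_integral (linepath a4 a1) F
      = - 2 * pi * \<i> * of_real (x powr \<alpha> / (1 + x powr \<alpha>) / x)"
    unfolding rp using ci by (simp add: add.assoc)
  have hor: "contour_integral (linepath (Complex (- N) t) (Complex N t)) F = integral {- N..N} (\<lambda>y. F (of_real y + of_real t * \<i>))" for t
  proof -
    have "Complex r t = of_real r + of_real t * \<i>" for r by (simp add: complex_eq_iff)
    note e = this[of "- N"] this[of N]
    show ?thesis unfolding e contour_integral_linepath_translate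
      using N0 by (subst contour_integral_linepath_Reals_eq) simp_all
  qed
  have Fc: "continuous_on {- N..N} (\<lambda>y. F (of_real y + of_real t * \<i>))" if "\<bar>t\<bar> = pi" for t
  proof (rule continuous_on_compose2[OF holomorphic_on_imp_continuous_on[OF holo]])
    show "continuous_on {- N..N} (\<lambda>y. of_real y + of_real t * \<i>)" by (intro continuous_intros)
    have "t \<noteq> 0" using that pi_gt_zero by auto
    then show "(\<lambda>y. of_real y + of_real t * \<i>) ` {- N..N} \<subseteq> strip - {w0}"
      using that by (auto intro!: strip_pi simp: w0_def complex_eq_iff)
  qed
  \<comment> \<open>The top edge is traversed from right to left, so the two horizontal edges
    combine to a difference of boundary values.\<close>
  have "contour_integral (linepath a1 a2) F + contour_integral (linepath a3 a4) F =
      contour_integral (linepath a1 a2) F - contour_integral (linepath a4 a3) F"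
    using contour_integral_reversepath[of "linepath a4 a3" F] by simp
  also have "\<dots> = integral {- N..N} (\<lambda>y. F (of_real y + of_real (- pi) * \<i>)) - integral {- N..N} (\<lambda>y. F (of_real y + of_real pi * \<i>))"
    unfolding a1_def a2_def a3_def a4_def by (simp only: hor)
  also have "\<dots> = integral {- N..N} (\<lambda>y. F (of_real y + of_real (- pi) * \<i>) - F (of_real y + of_real pi * \<i>))"
    by (intro Henstock_Kurzweil_Integration.integral_diff[symmetric] integrable_continuous_interval Fc) auto
  also have "\<dots> = integral {- N..N} (\<lambda>y. - 2 * \<i> * of_real (p y))"
    unfolding F_def boundary_difference ..
  also have "\<dots> = - 2 * \<i> * of_real (integral {- N..N} p)"
    using integral_linear[OF integrable_continuous_interval[OF p_continuous] bounded_linear_of_real, of "- N" N]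
    by (simp add: o_def)
  finally have hh: "contour_integral (linepath a1 a2) F + contour_integral (linepath a3 a4) F = - 2 * \<i> * of_real (integral {- N..N} p)" .
  have vb: "norm (F w) \<le> ?M" if "Re w = N \<or> Re w = - N" for w
    unfolding F_def by (rule vertical_bounds[OF N that])
  have M0: "0 \<le> ?M" using order_trans[OF norm_ge_zero vb[of "of_real N"]] by simp
  have v1: "norm (contour_integral (linepath a2 a3) F) \<le> ?M * norm (a3 - a2)"
  proof (rule contour_integral_bound_linepath[OF ci(2) M0 vb])
    fix w assume "w \<in> closed_segment a2 a3"
    then have "Re w = N" by (auto simp: a2_def a3_def closed_segment_same_Re)
    then show "Re w = N \<or> Re w = - N" by simp
  qed
  have v2: "norm (contour_integral (linepath a4 a1) F) \<le> ?M * norm (a1 - a4)"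
  proof (rule contour_integral_bound_linepath[OF ci(4) M0 vb])
    fix w assume "w \<in> closed_segment a4 a1"
    then have "Re w = - N" by (auto simp: a1_def a4_def closed_segment_same_Re)
    then show "Re w = N \<or> Re w = - N" by simp
  qed
  have nrm: "norm (a3 - a2) = 2 * pi" "norm (a1 - a4) = 2 * pi"
    by (simp_all add: a1_def a2_def a3_def a4_def cmod_def real_sqrt_mult)
  have "contour_integral (linepath a2 a3) F + contour_integral (linepath a4 a1) F =
      2 * \<i> * of_real (integral {- N..N} p - pi * (x powr \<alpha> / (1 + x powr \<alpha>) / x))"
  proof -
    define c where "c = x powr \<alpha> / (1 + x powr \<alpha>) / x"
    have "B + D = T - H" if "A + B + C + D = T" "A + C = H" for A B C D T H :: complex
    proof -
      have "B + D = (A + B + C + D) - (A + C)" by simp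
      then show ?thesis unfolding that .
    qed
    from this[OF total hh, folded c_def]
    show ?thesis unfolding c_def[symmetric] by (simp add: right_diff_distrib)
  qed
  then have "norm (contour_integral (linepath a2 a3) F + contour_integral (linepath a4 a1) F) =
      2 * \<bar>integral {- N..N} p - pi * (x powr \<alpha> / (1 + x powr \<alpha>) / x)\<bar>"
    by (simp only: norm_mult norm_of_real) simp
  moreover have "norm (contour_integral (linepath a2 a3) F + contour_integral (linepath a4 a1) F) \<le> ?M * (2 * pi) + ?M * (2 * pi)"
    using v1 v2 unfolding nrm by (rule norm_triangle_mono)
  moreover have "b \<le> k" if "a = 2 * b" "a \<le> k + k" for a b k :: real using that by linarith
  ultimately show ?thesis by blast
qed

lemma integral_p_limit:
  "(\<lambda>n. integral {- real n..real n} p) \<longlonglongrightarrow> pi * (x powr \<alpha> / (1 + x powr \<alpha>) / x)"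
proof -
  define M where "M N = (exp (- \<alpha> * N) / (1 - exp (- \<alpha> * N)) * (1 / (x - exp (- N)))
      + 1 / (1 - exp (- \<alpha> * N)) * (exp (- N) / (1 - x * exp (- N)))) * (2 * pi)" for N :: real
  have e1: "(\<lambda>n. exp (- real n)) \<longlonglongrightarrow> 0" by real_asymp
  have e2: "(\<lambda>n. exp (- \<alpha> * real n)) \<longlonglongrightarrow> 0" using \<alpha>(1) by real_asymp
  have "(\<lambda>n. M (real n)) \<longlonglongrightarrow> (0 / (1 - 0) * (1 / (x - 0)) + 1 / (1 - 0) * (0 / (1 - x * 0))) * (2 * pi)"
    unfolding M_def using x by (intro tendsto_add tendsto_mult tendsto_divide tendsto_diff tendsto_const e1 e2) auto
  then have M: "(\<lambda>n. M (real n)) \<longlonglongrightarrow> 0" by simp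
  obtain n0 where n0: "\<bar>ln x\<bar> < real n0" using reals_Archimedean2 by blast
  have "\<forall>\<^sub>F n in sequentially. norm (integral {- real n..real n} p - pi * (x powr \<alpha> / (1 + x powr \<alpha>) / x)) \<le> M (real n)"
    unfolding eventually_sequentially
  proof (intro exI allI impI)
    fix n assume "n0 \<le> n"
    then have "\<bar>ln x\<bar> < real n" using n0 by linarith
    from integral_p_estimate[OF this] show "norm (integral {- real n..real n} p - pi * (x powr \<alpha> / (1 + x powr \<alpha>) / x)) \<le> M (real n)"
      by (simp add: M_def)
  qed
  from LIM_zero_cancel[OF Lim_null_comparison[OF this M]] show ?thesis .
qed

section \<open>The Stieltjes integral of the boolean stable density\<close>

definition bs_density :: "real \<Rightarrow> real" where
  "bs_density u = (if 0 < u then sin (pi * \<alpha>) / pi * (u powr (\<alpha> - 1) / (u powr (2 * \<alpha>) + 2 * u powr \<alpha> * cos (pi * \<alpha>) + 1)) else 0)"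

lemma bs_density_measurable [measurable]: "bs_density \<in> borel_measurable borel"
  unfolding bs_density_def by measurable

lemma bs_density_nonneg: "0 \<le> bs_density u"
proof (cases "0 < u")
  case True
  have "u powr (2 * \<alpha>) = (u powr \<alpha>)\<^sup>2" using True by (simp add: powr_power mult.commute)
  then show ?thesis unfolding bs_density_def using True denom_pos[of "u powr \<alpha>"] sin_pos by simp
qed (simp add: bs_density_def)

lemma bs_density_exp: "bs_density (exp y) / (x + exp y) * exp y = p y / pi"
proof -
  have "exp y powr (2 * \<alpha>) = (exp (\<alpha> * y))\<^sup>2" "exp y powr \<alpha> = exp (\<alpha> * y)" "exp y powr (\<alpha> - 1) * exp y = exp (\<alpha> * y)"
    by (simp_all add: powr_def exp_double[symmetric] exp_add[symmetric] algebra_simps)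
  note e = this
  have "bs_density (exp y) / (x + exp y) * exp y = sin (pi * \<alpha>) / pi * ((exp y powr (\<alpha> - 1) * exp y) / (exp y powr (2 * \<alpha>) + 2 * exp y powr \<alpha> * cos (pi * \<alpha>) + 1)) / (x + exp y)"
    by (simp add: bs_density_def)
  also have "\<dots> = p y / pi" unfolding e p_def by (simp add: mult_ac)
  finally show ?thesis .
qed

text \<open>The substitution u = exp y on [exp(-n), exp n] gives the integral of \<open>p\<close>
  over [-n, n]; monotone convergence then reaches the whole half-line.\<close>

lemma nn_integral_bs_density:
  "(\<integral>\<^sup>+u. ennreal (bs_density u / (x + u)) \<partial>lborel) = ennreal (x powr \<alpha> / (1 + x powr \<alpha>) / x)"
proof -
  define f where "f n u = ennreal (bs_density u / (x + u)) * indicator {exp (- real n)..exp (real n)} u" for n u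
  have fint: "(\<integral>\<^sup>+u. f n u \<partial>lborel) = ennreal (integral {- real n..real n} p / pi)" for n
  proof (cases "n = 0")
    \<comment> \<open>For n = 0 the interval shrinks to the null set {1}; the substitution rule is
      applied to proper intervals only.\<close>
    case True
    have "(\<integral>\<^sup>+u. f n u \<partial>lborel) = (\<integral>\<^sup>+u. 0 \<partial>(lborel :: real measure))"
      unfolding f_def True by (intro nn_integral_cong_AE eventually_mono[OF AE_lborel_singleton[of 1]]) auto
    then show ?thesis by (simp add: True)
  next
    case False
    have "(\<integral>\<^sup>+u. f n u \<partial>lborel) = (\<integral>\<^sup>+y. ennreal (bs_density (exp y) / (x + exp y)) * ennreal (exp y) * indicator {- real n..real n} y \<partial>lborel)"
      unfolding f_def by (rule nn_integral_substitution_aux)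
        (use False in \<open>auto intro!: derivative_eq_intros continuous_intros\<close>)
    also have "\<dots> = (\<integral>\<^sup>+y. ennreal (indicator {- real n..real n} y *\<^sub>R (p y / pi)) \<partial>lborel)"
    proof (rule nn_integral_cong)
      fix y
      have "0 \<le> bs_density (exp y) / (x + exp y)" using bs_density_nonneg x by (simp add: add_pos_pos less_imp_le)
      then have "ennreal (bs_density (exp y) / (x + exp y)) * ennreal (exp y) = ennreal (bs_density (exp y) / (x + exp y) * exp y)"
        by (intro ennreal_mult[symmetric]) auto
      then have "ennreal (bs_density (exp y) / (x + exp y)) * ennreal (exp y) = ennreal (p y / pi)"
        unfolding bs_density_exp .
      then show "ennreal (bs_density (exp y) / (x + exp y)) * ennreal (exp y) * indicator {- real n..real n} y = ennreal (indicator {- real n..real n} y *\<^sub>R (p y / pi))"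
        by (simp add: indicator_def)
    qed
    also have "\<dots> = ennreal (LINT y|lborel. indicator {- real n..real n} y *\<^sub>R (p y / pi))"
    proof (rule nn_integral_eq_integral)
      have "set_integrable lborel {- real n..real n} (\<lambda>y. p y / pi)"
        by (rule borel_integrable_atLeastAtMost') (auto intro!: continuous_intros p_continuous)
      then show "integrable lborel (\<lambda>y. indicator {- real n..real n} y *\<^sub>R (p y / pi))" by (simp add: set_integrable_def)
    qed (use p_nonneg in auto)
    also have "(LINT y|lborel. indicator {- real n..real n} y *\<^sub>R (p y / pi)) = integral {- real n..real n} (\<lambda>y. p y / pi)"
      unfolding set_lebesgue_integral_def[symmetric]
      by (rule set_borel_integral_eq_integral(2), rule borel_integrable_atLeastAtMost')
        (auto intro!: continuous_intros p_continuous)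
    also have "\<dots> = integral {- real n..real n} p / pi" by simp
    finally show ?thesis .
  qed
  have "(\<lambda>n. \<integral>\<^sup>+u. f n u \<partial>lborel) \<longlonglongrightarrow> (\<integral>\<^sup>+u. ennreal (bs_density u / (x + u)) \<partial>lborel)"
  proof (rule nn_integral_LIMSEQ)
    show "incseq f"
    proof (intro incseq_SucI le_funI)
      fix n u
      show "f n u \<le> f (Suc n) u" unfolding f_def
        by (intro mult_left_mono) (auto simp: indicator_def intro: order_trans[of _ "exp (- real n)"] order_trans[of _ "exp (real n)"])
    qed
    show "f n \<in> borel_measurable lborel" for n unfolding f_def by measurable
    show "(\<lambda>n. f n u) \<longlonglongrightarrow> ennreal (bs_density u / (x + u))" for u
    proof (cases "0 < u")
      case True
      obtain n0 where n0: "\<bar>ln u\<bar> < real n0" using reals_Archimedean2 by blast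
      have "f n u = ennreal (bs_density u / (x + u))" if "n0 \<le> n" for n
      proof -
        have "\<bar>ln u\<bar> < real n" using n0 that by linarith
        then have "exp (- real n) \<le> exp (ln u)" "exp (ln u) \<le> exp (real n)" unfolding exp_le_cancel_iff by auto
        then show ?thesis using True by (simp add: f_def)
      qed
      then show ?thesis by (intro tendsto_eventually) (auto simp: eventually_sequentially)
    qed (simp add: f_def bs_density_def)
  qed
  moreover have "(\<lambda>n. ennreal (integral {- real n..real n} p / pi)) \<longlonglongrightarrow> ennreal (pi * (x powr \<alpha> / (1 + x powr \<alpha>) / x) / pi)"
    by (intro tendsto_ennrealI tendsto_divide integral_p_limit tendsto_const) auto
  ultimately show ?thesis unfolding fint using LIMSEQ_unique by fastforce
qed

end

text \<open>Multiplying the Stieltjes integral by x and letting x grow gives total mass 1, so the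
  normalisation needs no separate integral; taking x = 1 / s gives R.\<close>

lemma boolean_stable_facts:
  assumes \<alpha>: "0 < \<alpha>" "\<alpha> < 1"
  shows "boolean_stable_law \<alpha> \<in> prob_Rplus" "0 < s \<Longrightarrow> stj (boolean_stable_law \<alpha>) s = 1 / (1 + s powr \<alpha>)"
proof -
  \<comment> \<open>The density does not involve the parameter x of the locale, so the instance x =
    1 names it for all x.\<close>
  interpret B: boolean_contour \<alpha> 1 by unfold_locales (use \<alpha> in auto)
  define f where "f = B.bs_density"
  have fm[measurable]: "f \<in> borel_measurable borel" and fn: "0 \<le> f u" for u
    unfolding f_def by (auto intro: B.bs_density_nonneg)
  have int: "(\<integral>\<^sup>+u. ennreal (f u / (x + u)) \<partial>lborel) = ennreal (x powr \<alpha> / (1 + x powr \<alpha>) / x)" if "0 < x" for x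
  proof -
    interpret boolean_contour \<alpha> x by unfold_locales (use \<alpha> that in auto)
    show ?thesis using nn_integral_bs_density unfolding f_def B.bs_density_def bs_density_def .
  qed
  have neg: "f u = 0" if "u \<le> 0" for u using that by (simp add: f_def B.bs_density_def)
  have int': "(\<integral>\<^sup>+u. ennreal (f u * (x / (x + u))) \<partial>lborel) = ennreal (x powr \<alpha> / (1 + x powr \<alpha>))" if x: "0 < x" for x
  proof -
    have "(\<integral>\<^sup>+u. ennreal (f u * (x / (x + u))) \<partial>lborel) = (\<integral>\<^sup>+u. ennreal x * ennreal (f u / (x + u)) \<partial>lborel)"
    proof (rule nn_integral_cong)
      fix u
      show "ennreal (f u * (x / (x + u))) = ennreal x * ennreal (f u / (x + u))"
        using x fn[of u] neg[of u] by (cases "u \<le> 0") (auto simp: ennreal_mult[symmetric] mult.commute)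
    qed
    also have "\<dots> = ennreal x * ennreal (x powr \<alpha> / (1 + x powr \<alpha>) / x)"
      by (subst nn_integral_cmult) (auto simp: int[OF x])
    also have "\<dots> = ennreal (x powr \<alpha> / (1 + x powr \<alpha>))" using x by (simp add: ennreal_mult[symmetric])
    finally show ?thesis .
  qed
  have "(\<lambda>n. \<integral>\<^sup>+u. ennreal (f u * ((real n + 1) / (real n + 1 + u))) \<partial>lborel) \<longlonglongrightarrow> (\<integral>\<^sup>+u. ennreal (f u) \<partial>lborel)"
  proof (rule nn_integral_LIMSEQ)
    show "incseq (\<lambda>n u. ennreal (f u * ((real n + 1) / (real n + 1 + u))))"
    proof (intro incseq_SucI le_funI)
      fix n u
      show "ennreal (f u * ((real n + 1) / (real n + 1 + u))) \<le> ennreal (f u * ((real (Suc n) + 1) / (real (Suc n) + 1 + u)))"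
      proof (cases "u \<le> 0")
        case False
        then show ?thesis using fn by (intro ennreal_leI mult_left_mono) (auto simp: divide_simps algebra_simps)
      qed (simp add: neg)
    qed
    show "(\<lambda>n. ennreal (f u * ((real n + 1) / (real n + 1 + u)))) \<longlonglongrightarrow> ennreal (f u)" for u
    proof -
      have "(\<lambda>n. (real n + 1) / (real n + 1 + u)) \<longlonglongrightarrow> 1" by real_asymp
      from tendsto_mult[OF tendsto_const this, of "f u"] show ?thesis by (intro tendsto_ennrealI) simp
    qed
  qed simp
  moreover have "(\<lambda>n. ennreal ((real n + 1) powr \<alpha> / (1 + (real n + 1) powr \<alpha>))) \<longlonglongrightarrow> ennreal 1"
    by (intro tendsto_ennrealI) (use \<alpha>(1) in real_asymp)
  ultimately have "(\<integral>\<^sup>+u. ennreal (f u) \<partial>lborel) = ennreal 1"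
    using int'[of "real n + 1" for n] LIMSEQ_unique by (simp add: add_pos_pos)
  then have "has_bochner_integral lborel f 1"
    using fn by (intro has_bochner_integral_nn_integral) auto
  from density_prob_Rplus[OF this fn neg fm]
  have "density lborel (\<lambda>u. ennreal (f u)) \<in> prob_Rplus" by auto
  moreover have beq: "boolean_stable_law \<alpha> = density lborel (\<lambda>u. ennreal (f u))"
    unfolding boolean_stable_law_def f_def B.bs_density_def ..
  ultimately show "boolean_stable_law \<alpha> \<in> prob_Rplus" by simp
  show "stj (boolean_stable_law \<alpha>) s = 1 / (1 + s powr \<alpha>)" if s: "0 < s"
  proof -
    have "has_bochner_integral lborel (\<lambda>u. f u * (1 / s / (1 / s + u))) ((1 / s) powr \<alpha> / (1 + (1 / s) powr \<alpha>))"
    proof (rule has_bochner_integral_nn_integral)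
      have "0 \<le> f u * (1 / s / (1 / s + u))" for u using s fn[of u] neg[of u] by (cases "u \<le> 0") auto
      then show "AE u in lborel. 0 \<le> f u * (1 / s / (1 / s + u))" by simp
      show "0 \<le> (1 / s) powr \<alpha> / (1 + (1 / s) powr \<alpha>)" by (auto intro!: divide_nonneg_nonneg add_nonneg_nonneg)
    qed (use int'[of "1 / s"] s in auto)
    moreover have "1 / s / (1 / s + u) = 1 / (1 + s * u)" for u using s by (simp add: field_simps)
    moreover have "(1 / s) powr \<alpha> / (1 + (1 / s) powr \<alpha>) = 1 / (1 + s powr \<alpha>)"
    proof -
      have e: "(1 / s) powr \<alpha> = 1 / s powr \<alpha>" using s by (simp add: powr_divide)
      have "0 < s powr \<alpha>" using s by simp
      then show ?thesis unfolding e by (simp add: divide_simps)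
    qed
    ultimately have "has_bochner_integral lborel (\<lambda>u. f u * (1 / (1 + s * u))) (1 / (1 + s powr \<alpha>))" by simp
    then show ?thesis unfolding stj_def beq
      by (subst integral_density) (auto simp: has_bochner_integral_iff fn)
  qed
qed

section \<open>The classical stable law\<close>

text \<open>The value at 0 follows from right continuity, and negative arguments give 0.\<close>

lemma prob_Rplus_eqI_cdf:
  assumes \<mu>: "\<mu> \<in> prob_Rplus" and \<nu>: "\<nu> \<in> prob_Rplus" and eq: "\<And>x. 0 < x \<Longrightarrow> cdf \<mu> x = cdf \<nu> x"
  shows "\<mu> = \<nu>"
proof -
  interpret M: real_distribution \<mu> using \<mu> by (rule prob_RplusD)
  interpret N: real_distribution \<nu> using \<nu> by (rule prob_RplusD)
  note neg = cdf_prob_Rplus_neg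
  have lim: "(cdf \<mu> \<longlongrightarrow> cdf \<mu> 0) (at_right 0)" "(cdf \<nu> \<longlongrightarrow> cdf \<nu> 0) (at_right 0)"
    using M.cdf_is_right_cont[of 0] N.cdf_is_right_cont[of 0] by (simp_all add: continuous_within)
  have "\<forall>\<^sub>F x in at_right 0. cdf \<mu> x = cdf \<nu> x"
    by (rule eventually_mono[OF eventually_at_right_less]) (rule eq)
  from Lim_transform_eventually[OF lim(1) this] lim(2) have zero: "cdf \<mu> 0 = cdf \<nu> 0"
    by (rule tendsto_unique[OF trivial_limit_at_right_real])
  have "cdf \<mu> x = cdf \<nu> x" for x
    using eq[of x] neg[OF \<mu>, of x] neg[OF \<nu>, of x] zero by (cases x "0::real" rule: linorder_cases) auto
  then show ?thesis using cdf_unique[OF M.real_distribution_axioms N.real_distribution_axioms] by auto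
qed

section \<open>Products of independent variables and Laplace transforms\<close>

lemma
  assumes M: "M \<in> prob_Rplus" and N: "N \<in> prob_Rplus" and g[measurable]: "(\<lambda>(x, y). g x y) \<in> borel_measurable (borel \<Otimes>\<^sub>M borel)"
  shows Rplus_distr_pair: "(\<And>x y. 0 \<le> x \<Longrightarrow> 0 \<le> y \<Longrightarrow> 0 \<le> g x y) \<Longrightarrow> distr (M \<Otimes>\<^sub>M N) borel (\<lambda>(x, y). g x y) \<in> prob_Rplus"
    and Rplus_integral_pair: "(\<And>x y. \<bar>h (g x y)\<bar> \<le> B) \<Longrightarrow> h \<in> borel_measurable borel \<Longrightarrow>
      (LINT z|distr (M \<Otimes>\<^sub>M N) borel (\<lambda>(x, y). g x y). h z) = (LINT y|N. LINT x|M. h (g x y :: real) :: real)"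
proof -
  interpret M: real_distribution M using M by (rule prob_RplusD)
  interpret N: real_distribution N using N by (rule prob_RplusD)
  interpret P: pair_prob_space M N ..
  have sets[measurable_cong]: "sets (M \<Otimes>\<^sub>M N) = sets (borel \<Otimes>\<^sub>M borel)" by (rule sets_pair_measure_cong) auto
  have gm: "(\<lambda>(x, y). g x y) \<in> borel_measurable (M \<Otimes>\<^sub>M N)"
    using g by (simp cong: measurable_cong_sets[OF sets refl])
  have AE: "AE z in M \<Otimes>\<^sub>M N. 0 \<le> fst z \<and> 0 \<le> snd z"
  proof (rule P.AE_pair_measure)
    show "{z \<in> space (M \<Otimes>\<^sub>M N). 0 \<le> fst z \<and> 0 \<le> snd z} \<in> sets (M \<Otimes>\<^sub>M N)" by measurable
    show "AE x in M. AE y in N. 0 \<le> fst (x, y) \<and> 0 \<le> snd (x, y)"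
      using prob_RplusD(2)[OF M] by eventually_elim (use prob_RplusD(2)[OF N] in \<open>auto elim!: eventually_mono\<close>)
  qed
  show "distr (M \<Otimes>\<^sub>M N) borel (\<lambda>(x, y). g x y) \<in> prob_Rplus" if nn: "\<And>x y. 0 \<le> x \<Longrightarrow> 0 \<le> y \<Longrightarrow> 0 \<le> g x y"
    by (rule prob_Rplus_distr[OF P.prob_space_axioms gm], rule eventually_mono[OF AE]) (use nn in \<open>auto split: prod.splits\<close>)
  \<comment> \<open>The bound is for all real arguments; functions controlled only on the half-line
    are first truncated by \<open>max 0\<close>.\<close>
  assume B: "\<And>x y. \<bar>h (g x y)\<bar> \<le> B" and h[measurable]: "h \<in> borel_measurable borel"
  have hm: "(\<lambda>z. h (case z of (x, y) \<Rightarrow> g x y)) \<in> borel_measurable (M \<Otimes>\<^sub>M N)"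
    by (rule measurable_compose[OF gm h])
  have i: "integrable (M \<Otimes>\<^sub>M N) (\<lambda>z. h (case z of (x, y) \<Rightarrow> g x y))"
    by (rule P.integrable_const_bound[of _ B]) (use B hm in \<open>auto split: prod.splits\<close>)
  have e: "(\<lambda>z. h (case z of (x, y) \<Rightarrow> g x y)) = (\<lambda>(x, y). h (g x y))" by auto
  have "(LINT z|distr (M \<Otimes>\<^sub>M N) borel (\<lambda>(x, y). g x y). h z) = (LINT z|(M \<Otimes>\<^sub>M N). h (case z of (x, y) \<Rightarrow> g x y))"
    by (rule integral_distr[OF gm h])
  also have "\<dots> = (LINT y|N. LINT x|M. h (g x y))"
    using i unfolding e by (rule P.integral_snd[symmetric])
  finally show "(LINT z|distr (M \<Otimes>\<^sub>M N) borel (\<lambda>(x, y). g x y). h z) = (LINT y|N. LINT x|M. h (g x y))" .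
qed

lemma mult_conv_prob_Rplus: "M \<in> prob_Rplus \<Longrightarrow> N \<in> prob_Rplus \<Longrightarrow> M \<circledast> N \<in> prob_Rplus"
  unfolding mult_conv_def by (rule Rplus_distr_pair) auto

lemma integral_mult_conv:
  fixes h :: "real \<Rightarrow> real"
  assumes M: "M \<in> prob_Rplus" and N: "N \<in> prob_Rplus" and [measurable]: "h \<in> borel_measurable borel"
    and B: "\<And>x. 0 \<le> x \<Longrightarrow> \<bar>h x\<bar> \<le> B"
  shows "(LINT z|(M \<circledast> N). h z) = (LINT y|N. LINT x|M. h (x * y))"
proof -
  interpret M: real_distribution M using M by (rule prob_RplusD)
  interpret N: real_distribution N using N by (rule prob_RplusD)
  interpret C: real_distribution "M \<circledast> N" using mult_conv_prob_Rplus[OF M N] by (rule prob_RplusD)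
  define h' where "h' x = h (max 0 x)" for x
  have [measurable]: "h' \<in> borel_measurable borel" unfolding h'_def by measurable
  have "(LINT z|(M \<circledast> N). h z) = (LINT z|(M \<circledast> N). h' z)"
    using prob_RplusD(2)[OF mult_conv_prob_Rplus[OF M N]]
    by (intro integral_cong_AE) (auto elim!: eventually_mono simp: h'_def)
  also have "\<dots> = (LINT y|N. LINT x|M. h' (x * y))"
    unfolding mult_conv_def by (rule Rplus_integral_pair[OF M N, where B=B]) (auto simp: h'_def intro: B)
  also have "\<dots> = (LINT y|N. LINT x|M. h (x * y))"
  proof (rule integral_cong_AE)
    show "AE y in N. (LINT x|M. h' (x * y)) = (LINT x|M. h (x * y))"
      using prob_RplusD(2)[OF N]
    proof eventually_elim
      case (elim y)
      show ?case
        using prob_RplusD(2)[OF M] elim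
        by (intro integral_cong_AE) (auto elim!: eventually_mono simp: h'_def)
    qed
  qed measurable
  finally show ?thesis .
qed

lemma integral_pow_push:
  fixes h :: "real \<Rightarrow> real"
  assumes "\<mu> \<in> prob_Rplus" and [measurable]: "h \<in> borel_measurable borel"
  shows "(LINT z|pow_push c \<mu>. h z) = (LINT u|\<mu>. h (u powr c))"
proof -
  interpret real_distribution \<mu> using assms by (rule_tac prob_RplusD)
  show ?thesis unfolding pow_push_def by (rule integral_distr) auto
qed

lemma cdf_pow_push:
  assumes \<mu>: "\<mu> \<in> prob_Rplus" and c: "0 < c" and x: "0 < x"
  shows "cdf (pow_push c \<mu>) x = cdf \<mu> (x powr (1 / c))"
proof -
  interpret real_distribution \<mu> using \<mu> by (rule prob_RplusD)
  have "(\<lambda>u. u powr c) -` {..x} \<inter> space \<mu> = {u. u powr c \<le> x}" by auto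
  then have "cdf (pow_push c \<mu>) x = prob {u. u powr c \<le> x}"
    unfolding cdf_def pow_push_def by (subst measure_distr) auto
  also have "\<dots> = prob {..x powr (1 / c)}"
  proof (rule measure_eq_AE)
    show "AE u in \<mu>. (u \<in> {u. u powr c \<le> x}) = (u \<in> {..x powr (1 / c)})"
      using prob_RplusD(2)[OF \<mu>]
    proof eventually_elim
      case (elim u)
      have "u powr c \<le> x \<longleftrightarrow> u powr c \<le> (x powr (1 / c)) powr c" using c x by (simp add: powr_powr)
      also have "\<dots> \<longleftrightarrow> u \<le> x powr (1 / c)"
        using powr_less_mono2[OF c elim, of "x powr (1 / c)"] powr_less_mono2[OF c, of "x powr (1 / c)" u]
        by (cases u "x powr (1 / c)" rule: linorder_cases) auto
      finally show ?case by simp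
    qed
  qed auto
  finally show ?thesis by (simp add: cdf_def)
qed

definition lap :: "real measure \<Rightarrow> real \<Rightarrow> real" where
  "lap \<mu> s = (LINT u|\<mu>. exp (- s * u))"

text \<open>The image of the law under u to exp(-u) lives on [0,1], and its k-th moment is the
  Laplace transform at k.\<close>

lemma lap_eqI:
  assumes \<mu>: "\<mu> \<in> prob_Rplus" and \<nu>: "\<nu> \<in> prob_Rplus"
    and eq: "\<And>s. 0 < s \<Longrightarrow> lap \<mu> s = lap \<nu> s"
  shows "\<mu> = \<nu>"
proof -
  have U: "unit_dist (distr N borel (\<lambda>u. exp (- u)))" and
      B: "distr (distr N borel (\<lambda>u. exp (- u))) borel (\<lambda>y. - ln y) = N" and
      I: "(LINT y|distr N borel (\<lambda>u. exp (- u)). y ^ k) = lap N (real k)"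
    if N: "N \<in> prob_Rplus" for N and k :: nat
  proof -
    interpret real_distribution N using N by (rule prob_RplusD)
    show "unit_dist (distr N borel (\<lambda>u. exp (- u)))" unfolding unit_dist_def
      using prob_RplusD(2)[OF N] by (auto simp: AE_distr_iff)
    show "distr (distr N borel (\<lambda>u. exp (- u))) borel (\<lambda>y. - ln y) = N"
      by (subst distr_distr) (auto simp: o_def intro: distr_id2)
    show "(LINT y|distr N borel (\<lambda>u. exp (- u)). y ^ k) = lap N (real k)"
      unfolding lap_def by (subst integral_distr) (auto simp: exp_of_nat_mult[symmetric])
  qed
  have l0: "lap N 0 = 1" if "N \<in> prob_Rplus" for N
  proof -
    interpret real_distribution N using that by (rule prob_RplusD)
    show ?thesis using prob_space by (simp add: lap_def)
  qed
  have "lap \<mu> (real k) = lap \<nu> (real k)" for k using eq[of "real k"] l0 \<mu> \<nu> by (cases "k = 0") auto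
  then have "distr \<mu> borel (\<lambda>u. exp (- u)) = distr \<nu> borel (\<lambda>u. exp (- u))"
    by (intro unit_dist_eqI U \<mu> \<nu>) (simp add: I \<mu> \<nu>)
  then show ?thesis using B[OF \<mu>] B[OF \<nu>] by metis
qed

lemma exp_law_facts:
  shows exp_law_prob_Rplus: "exp_law \<in> prob_Rplus" and exp_law_atom: "measure exp_law {0} = 0"
    and exp_law_tail: "0 \<le> a \<Longrightarrow> measure exp_law {a..} = exp (- a)"
    and lap_exp_law: "0 \<le> s \<Longrightarrow> lap exp_law s = 1 / (1 + s)"
proof -
  have hb: "has_bochner_integral lborel (exponential_density l) 1" if l: "0 < l" for l
  proof (rule has_bochner_integral_nn_integral)
    interpret prob_space "density lborel (exponential_density l)" by (rule prob_space_exponential_density[OF l])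
    show "(\<integral>\<^sup>+x. ennreal (exponential_density l x) \<partial>lborel) = ennreal 1"
      using emeasure_space_1 by (simp add: emeasure_density)
    show "AE x in lborel. 0 \<le> exponential_density l x" using exponential_density_nonneg[OF l] by simp
  qed auto
  have nn: "0 \<le> exponential_density 1 x" for x by (rule exponential_density_nonneg) simp
  have z: "exponential_density 1 x = 0" if "x < 0" for x using that by (simp add: exponential_density_def)
  note D = density_prob_Rplus[OF hb[of 1, simplified] nn z, simplified]
  show R: "exp_law \<in> prob_Rplus" "measure exp_law {0} = 0" unfolding exp_law_def using D by auto
  interpret real_distribution exp_law using R(1) by (rule prob_RplusD)
  show "measure exp_law {a..} = exp (- a)" if a: "0 \<le> a" for a
  proof -
    have "emeasure exp_law {a} = (\<integral>\<^sup>+x. 0 \<partial>(lborel :: real measure))"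
      unfolding exp_law_def by (subst emeasure_density)
        (auto intro!: nn_integral_cong_AE eventually_mono[OF AE_lborel_singleton[of a]])
    then have "AE x in exp_law. x \<noteq> a" by (intro AE_I[of _ _ "{a}"]) auto
    then have "prob {a..} = prob (space exp_law - {..a})"
      by (intro measure_eq_AE) (auto elim!: eventually_mono)
    also have "\<dots> = 1 - prob {..a}" by (rule prob_compl) auto
    also have "prob {..a} = 1 - exp (- a)"
      using emeasure_erlang_density[of 1 0 a] a unfolding exp_law_def measure_def by (simp add: erlang_CDF_0)
    finally show ?thesis by simp
  qed
  show "lap exp_law s = 1 / (1 + s)" if s: "0 \<le> s" for s
  proof -
    \<comment> \<open>Tilting by exp(-s x) produces, up to the factor 1 / (1 + s), the exponential
      density of rate 1 + s.\<close>
    have "exponential_density 1 x * exp (- s * x) = 1 / (1 + s) * exponential_density (1 + s) x" for x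
    proof (cases "x < 0")
      case False
      have e: "exp (- x) * exp (- s * x) = exp (- x * (1 + s))" by (simp add: exp_add[symmetric] algebra_simps)
      have "exponential_density 1 x = exp (- x)" "exponential_density (1 + s) x = (1 + s) * exp (- x * (1 + s))"
        using False by (simp_all add: exponential_density_def)
      then show ?thesis using s by (simp only: e) simp
    qed (simp add: exponential_density_def)
    then have "lap exp_law s = (LINT x|lborel. 1 / (1 + s) * exponential_density (1 + s) x)"
      unfolding lap_def exp_law_def by (subst integral_density) (auto simp: nn)
    also have "\<dots> = 1 / (1 + s)"
      using hb[of "1 + s"] s by (simp add: has_bochner_integral_iff)
    finally show ?thesis .
  qed
qed

lemma lap_mult_conv:
  assumes M: "M \<in> prob_Rplus" and N: "N \<in> prob_Rplus" and s: "0 \<le> s"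
  shows "lap (M \<circledast> N) s = (LINT y|N. lap M (s * y))"
proof -
  have "lap (M \<circledast> N) s = (LINT y|N. LINT x|M. exp (- s * (x * y)))"
    unfolding lap_def by (rule integral_mult_conv[OF M N, where B=1]) (use s in auto)
  then show ?thesis by (simp add: lap_def mult_ac)
qed

lemma stj_mult_conv:
  assumes M: "M \<in> prob_Rplus" and N: "N \<in> prob_Rplus" and s: "0 \<le> s"
  shows "stj (M \<circledast> N) s = (LINT y|N. stj M (s * y))"
proof -
  have "stj (M \<circledast> N) s = (LINT y|N. LINT x|M. 1 / (1 + s * (x * y)))"
    unfolding stj_def by (rule integral_mult_conv[OF M N, where B=1]) (use stj_kernel_bounds[OF _ s] in auto)
  then show ?thesis by (simp add: stj_def mult_ac)
qed

text \<open>For E exponential and Z independent with law \<open>N\<close>, the event Z / E \<le> x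
  is E \<ge> Z / x, of conditional probability exp(-Z / x).\<close>

lemma cdf_inverse_exp_mult_conv:
  assumes N: "N \<in> prob_Rplus" and x: "0 < x"
  shows "cdf (pow_push (- 1) exp_law \<circledast> N) x = lap N (1 / x)"
proof -
  note E = exp_law_prob_Rplus
  interpret E: real_distribution exp_law using E by (rule prob_RplusD)
  interpret N: real_distribution N using N by (rule prob_RplusD)
  interpret C: real_distribution "pow_push (- 1) exp_law \<circledast> N"
    using mult_conv_prob_Rplus[OF pow_push_prob_Rplus[OF E] N] by (rule prob_RplusD)
  have pos: "AE w in exp_law. 0 < w"
  proof -
    have "AE w in exp_law. w \<noteq> 0" using exp_law_atom by (intro AE_I[of _ _ "{0}"]) (auto simp: E.emeasure_eq_measure)
    then show ?thesis using prob_RplusD(2)[OF E] by eventually_elim auto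
  qed
  have inner: "(LINT e|pow_push (- 1) exp_law. indicator {..x} (e * z)) = exp (- (1 / x) * z)" if z: "0 \<le> z" for z
  proof -
    have "(LINT e|pow_push (- 1) exp_law. indicator {..x} (e * z)) = (LINT w|exp_law. indicator {..x} (w powr - 1 * z) :: real)"
      by (rule integral_pow_push[OF E]) measurable
    also have "\<dots> = (LINT w|exp_law. indicator {z / x..} w)"
    proof (rule integral_cong_AE)
      show "AE w in exp_law. indicator {..x} (w powr - 1 * z) = (indicator {z / x..} w :: real)"
        using pos by eventually_elim (use x in \<open>auto simp: indicator_def powr_minus divide_simps mult.commute\<close>)
    qed measurable
    also have "\<dots> = measure exp_law {z / x..}" by simp
    also have "\<dots> = exp (- (1 / x) * z)" using x z by (subst exp_law_tail) auto
    finally show ?thesis .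
  qed
  have "cdf (pow_push (- 1) exp_law \<circledast> N) x = (LINT z|(pow_push (- 1) exp_law \<circledast> N). indicator {..x} z)"
    by (simp add: cdf_def)
  also have "\<dots> = (LINT z|N. LINT e|pow_push (- 1) exp_law. indicator {..x} (e * z))"
    by (rule integral_mult_conv[OF pow_push_prob_Rplus[OF E] N, where B=1]) (auto simp: indicator_def)
  also have "\<dots> = (LINT z|N. exp (- (1 / x) * z))"
  proof -
    interpret PE: real_distribution "pow_push (- 1) exp_law" using pow_push_prob_Rplus[OF E] by (rule prob_RplusD)
    show ?thesis
      by (rule integral_cong_AE) (use inner prob_RplusD(2)[OF N] in \<open>auto elim!: eventually_mono\<close>)
  qed
  finally show ?thesis by (simp add: lap_def)
qed

text \<open>The law of a sum of independent variables. The truncation \<open>max 0\<close> is the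
  identity almost surely and keeps the exponentials bounded everywhere.\<close>

lemma lap_add_conv:
  assumes M: "M \<in> prob_Rplus" and N: "N \<in> prob_Rplus"
  obtains K where "K \<in> prob_Rplus" "\<And>s. 0 \<le> s \<Longrightarrow> lap K s = lap M s * lap N s"
proof -
  interpret M: real_distribution M using M by (rule prob_RplusD)
  interpret N: real_distribution N using N by (rule prob_RplusD)
  define K where "K = distr (M \<Otimes>\<^sub>M N) borel (\<lambda>(x, y). max 0 x + max 0 y)"
  have K: "K \<in> prob_Rplus" unfolding K_def by (rule Rplus_distr_pair[OF M N]) auto
  show ?thesis
  proof (rule that[OF K])
    fix s :: real assume s: "0 \<le> s"
    have "lap K s = (LINT y|N. LINT x|M. exp (- s * (max 0 x + max 0 y)))"
      unfolding lap_def K_def by (rule Rplus_integral_pair[OF M N, where B=1]) (use s in auto)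
    also have "\<dots> = (LINT y|N. (LINT x|M. exp (- s * max 0 x)) * exp (- s * max 0 y))"
    proof -
      have "exp (- s * (a + b)) = exp (- s * a) * exp (- s * b)" for a b :: real
        by (simp add: exp_add[symmetric] algebra_simps)
      then show ?thesis by (simp only: integral_mult_left_zero)
    qed
    also have "\<dots> = (LINT x|M. exp (- s * max 0 x)) * (LINT y|N. exp (- s * max 0 y))"
      by (rule integral_mult_right_zero)
    also have "(LINT x|M. exp (- s * max 0 x)) = lap M s"
      unfolding lap_def
      by (rule integral_cong_AE, measurable, measurable, rule eventually_mono[OF prob_RplusD(2)[OF M]]) simp
    also have "(LINT x|N. exp (- s * max 0 x)) = lap N s"
      unfolding lap_def
      by (rule integral_cong_AE, measurable, measurable, rule eventually_mono[OF prob_RplusD(2)[OF N]]) simp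
    finally show "lap K s = lap M s * lap N s" .
  qed
qed

lemma lap_power:
  assumes M: "M \<in> prob_Rplus"
  shows "\<exists>K\<in>prob_Rplus. \<forall>s\<ge>0. lap K s = lap M s ^ n"
proof (induction n)
  case 0
  have "\<forall>s\<ge>0. lap delta0 s = 1" by (simp add: lap_def integral_return)
  then show ?case using delta0_prob_Rplus by auto
next
  case (Suc n)
  then obtain K where K: "K \<in> prob_Rplus" "\<forall>s\<ge>0. lap K s = lap M s ^ n" by blast
  obtain L where "L \<in> prob_Rplus" "\<And>s. 0 \<le> s \<Longrightarrow> lap L s = lap M s * lap K s" using lap_add_conv[OF M K(1)] by blast
  then show ?case using K(2) by (intro bexI[of _ L]) auto
qed

text \<open>Since \<open>1 + s powr \<alpha> / n\<close> is a complete Bernstein function, \<open>1 / (1 + s powr \<alpha> / n)\<close> is the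
  Laplace transform of a scale mixture of exponential laws; its \<open>n\<close>-th power converges to
  \<open>exp (- s powr \<alpha>)\<close>.\<close>

lemma lap_approx_stable:
  assumes \<alpha>: "0 < \<alpha>" "\<alpha> < 1" and n: "0 < n"
  shows "\<exists>K\<in>prob_Rplus. \<forall>s>0. lap K s = (1 / (1 + s powr \<alpha> / real n)) ^ n"
proof -
  define G where "G s = 1 / (1 + s powr \<alpha> / real n)" for s :: real
  have pos: "0 \<le> s powr \<alpha> / real n" for s by simp
  have "cbf (\<lambda>s. 1 + 1 / real n * s powr \<alpha>)"
    using n \<alpha> by (intro cbf_add cbf_const cbf_scale cbf_powr[OF cbf_id]) auto
  from cbf_recip[OF this] have "cbf (\<lambda>s. s * G s)" by (simp add: G_def)
  then obtain \<mu> where \<mu>: "\<mu> \<in> prob_Rplus" "\<And>s. 0 < s \<Longrightarrow> stj \<mu> s = G s"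
  proof (rule stj_exists)
    show "G s \<le> 1" if "0 < s" for s using pos[of s] by (simp add: G_def divide_simps add_pos_nonneg)
    fix \<epsilon> :: real assume "0 < \<epsilon>"
    have "((\<lambda>s. 1 / (1 + s powr \<alpha> / real n)) \<longlongrightarrow> 1 / (1 + 0 / real n)) (at_right 0)"
      using \<alpha> n by (intro tendsto_intros) (auto intro!: tendsto_eq_intros simp: eventually_at_filter)
    then have "\<forall>\<^sub>F s in at_right 0. 1 - \<epsilon> < G s" using \<open>0 < \<epsilon>\<close> unfolding G_def by (intro order_tendstoD(1)) auto
    then have "\<forall>\<^sub>F s in at_right 0. 0 < s \<and> 1 - \<epsilon> < G s" using eventually_at_right_less by (rule eventually_conj[rotated])
    then show "\<exists>s>0. 1 - \<epsilon> < G s" using eventually_happens'[OF trivial_limit_at_right_real] by blast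
  qed blast
  have C: "exp_law \<circledast> \<mu> \<in> prob_Rplus" by (rule mult_conv_prob_Rplus[OF exp_law_prob_Rplus \<mu>(1)])
  have lapC: "lap (exp_law \<circledast> \<mu>) s = G s" if s: "0 < s" for s
  proof -
    interpret real_distribution \<mu> using \<mu>(1) by (rule prob_RplusD)
    interpret E: real_distribution exp_law using exp_law_prob_Rplus by (rule prob_RplusD)
    have "lap (exp_law \<circledast> \<mu>) s = (LINT y|\<mu>. lap exp_law (s * y))"
      using s by (intro lap_mult_conv exp_law_prob_Rplus \<mu>(1)) auto
    also have "\<dots> = stj \<mu> s"
      unfolding stj_def
    proof (rule integral_cong_AE)
      show "AE y in \<mu>. lap exp_law (s * y) = 1 / (1 + s * y)"
        using prob_RplusD(2)[OF \<mu>(1)] by eventually_elim (use s in \<open>simp add: lap_exp_law\<close>)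
    qed (unfold lap_def, measurable)
    finally show ?thesis using \<mu>(2)[OF s] by simp
  qed
  obtain K where "K \<in> prob_Rplus" "\<forall>s\<ge>0. lap K s = lap (exp_law \<circledast> \<mu>) s ^ n" using lap_power[OF C] by blast
  then show ?thesis using lapC by (intro bexI[of _ K]) (auto simp: G_def)
qed

text \<open>In the variable y = exp(-u) the Laplace transform at s > 0 is the integral of y^s,
  continuous on [0,1], so compactness of laws on [0,1] yields a limit of the approximations.\<close>

lemma stable_law_exists:
  assumes \<alpha>: "0 < \<alpha>" "\<alpha> < 1"
  shows "\<exists>\<rho>\<in>prob_Rplus. \<forall>s>0. lap \<rho> s = exp (- (s powr \<alpha>))"
proof -
  have "\<forall>n. \<exists>K. K \<in> prob_Rplus \<and> (\<forall>s>0. lap K s = (1 / (1 + s powr \<alpha> / real (Suc n))) ^ Suc n)"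
    using lap_approx_stable[OF \<alpha>] by blast
  from choice[OF this] obtain K where K: "\<And>n. K n \<in> prob_Rplus"
    "\<And>n s. 0 < s \<Longrightarrow> lap (K n) s = (1 / (1 + s powr \<alpha> / real (Suc n))) ^ Suc n" by blast
  define \<sigma> where "\<sigma> n = distr (K n) borel (\<lambda>u. exp (- u))" for n
  have U: "unit_dist (\<sigma> n)" for n
  proof -
    interpret real_distribution "K n" using K(1) by (rule prob_RplusD)
    show ?thesis unfolding unit_dist_def \<sigma>_def using prob_RplusD(2)[OF K(1)] by (auto simp: AE_distr_iff)
  qed
  have \<sigma>int: "(LINT y|\<sigma> n. y powr s) = lap (K n) s" for n s
  proof -
    interpret real_distribution "K n" using K(1) by (rule prob_RplusD)
    show ?thesis unfolding \<sigma>_def lap_def by (subst integral_distr) (auto simp: powr_def)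
  qed
  obtain r :: "nat \<Rightarrow> nat" and \<tau> where r: "strict_mono r" "unit_dist \<tau>"
    "\<forall>f\<in>borel_measurable borel. continuous_on {0..1} f \<longrightarrow>
      (\<lambda>n. (LINT x|\<sigma> (r n). f x)) \<longlonglongrightarrow> (LINT x|\<tau>. f x :: real)"
    by (rule unit_dist_compact[of \<sigma>, OF U])
  interpret T: real_distribution \<tau> using r(2) by (simp add: unit_dist_def)
  have \<tau>int: "(LINT y|\<tau>. y powr s) = exp (- (s powr \<alpha>))" if s: "0 < s" for s
  proof -
    have "continuous_on {0..1} (\<lambda>y::real. y powr s)"
      using s by (intro continuous_on_powr' continuous_intros) auto
    then have "(\<lambda>n. lap (K (r n)) s) \<longlonglongrightarrow> (LINT y|\<tau>. y powr s)"
      using r(3) by (simp add: \<sigma>int[symmetric])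
    moreover have "(\<lambda>n. lap (K n) s) \<longlonglongrightarrow> exp (- (s powr \<alpha>))"
    proof -
      have "(\<lambda>n. 1 / (1 + s powr \<alpha> / real (Suc n)) ^ Suc n) \<longlonglongrightarrow> 1 / exp (s powr \<alpha>)"
        by (intro tendsto_divide tendsto_const LIMSEQ_Suc[OF tendsto_exp_limit_sequentially]) auto
      moreover have "lap (K n) s = 1 / (1 + s powr \<alpha> / real (Suc n)) ^ Suc n" for n
        by (simp only: K(2)[OF s] power_one_over)
      moreover have "1 / exp (s powr \<alpha>) = exp (- (s powr \<alpha>))" by (simp add: exp_minus divide_inverse)
      ultimately show ?thesis by (simp only:)
    qed
    from LIMSEQ_subseq_LIMSEQ[OF this r(1)] have "(\<lambda>n. lap (K (r n)) s) \<longlonglongrightarrow> exp (- (s powr \<alpha>))"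
      by (simp add: o_def)
    ultimately show ?thesis by (rule LIMSEQ_unique)
  qed
  \<comment> \<open>An atom at y = 0 would be mass of u lost at infinity. The integral of y^s is at
    most 1 minus this atom, while exp(-s^\<alpha>) tends to 1 as s tends to 0.\<close>
  have "measure \<tau> {0} = 0"
  proof -
    have le: "exp (- ((1 / (real n + 1)) powr \<alpha>)) \<le> 1 - measure \<tau> {0}" for n
    proof -
      have "(LINT y|\<tau>. y powr (1 / (real n + 1))) \<le> (LINT y|\<tau>. indicat_real (UNIV - {0}) y)"
      proof (rule integral_mono_AE)
        show "integrable \<tau> (\<lambda>y. y powr (1 / (real n + 1)))"
        proof (rule unit_dist_integrable[OF r(2)])
          have "0 < 1 / (real n + 1)" by simp
          then show "continuous_on {0..1} (\<lambda>y. y powr (1 / (real n + 1)))"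
            by (intro continuous_on_powr' continuous_intros) auto
        qed measurable
        show "integrable \<tau> (\<lambda>y. indicat_real (UNIV - {0}) y)"
          by (rule T.integrable_const_bound[of _ 1]) (auto simp: indicator_def)
        show "AE y in \<tau>. y powr (1 / (real n + 1)) \<le> indicat_real (UNIV - {0}) y"
          by (rule unit_dist_AE[OF r(2)]) (auto simp: indicator_def powr_le1)
      qed
      also have "\<dots> = 1 - measure \<tau> {0}" using T.prob_compl[of "{0}"] by simp
      finally show ?thesis by (simp add: \<tau>int)
    qed
    have "(\<lambda>n. exp (- ((1 / (real n + 1)) powr \<alpha>))) \<longlonglongrightarrow> exp (- 0)"
    proof (intro tendsto_intros)
      show "(\<lambda>n. (1 / (real n + 1)) powr \<alpha>) \<longlonglongrightarrow> 0" using \<alpha>(1) by real_asymp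
    qed
    from LIMSEQ_le_const2[OF this] le have "exp (- 0) \<le> 1 - measure \<tau> {0}" by blast
    then show ?thesis using measure_nonneg[of \<tau> "{0}"] by simp
  qed
  then have "AE y in \<tau>. y \<noteq> 0" by (intro AE_I[of _ _ "{0}"]) (auto simp: T.emeasure_eq_measure)
  moreover have "AE y in \<tau>. y \<in> {0..1}" using r(2) by (simp add: unit_dist_def)
  ultimately have AE: "AE y in \<tau>. 0 < y \<and> y \<le> 1" by eventually_elim auto
  define \<rho> where "\<rho> = distr \<tau> borel (\<lambda>y. - ln y)"
  show ?thesis
  proof (intro bexI[of _ \<rho>] allI impI)
    show "\<rho> \<in> prob_Rplus" unfolding \<rho>_def
      by (rule prob_Rplus_distr[OF T.prob_space_axioms]) (auto intro: eventually_mono[OF AE])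
    fix s :: real assume s: "0 < s"
    have "lap \<rho> s = (LINT y|\<tau>. exp (- s * - ln y))" unfolding lap_def \<rho>_def by (rule integral_distr) auto
    also have "\<dots> = (LINT y|\<tau>. y powr s)"
      by (rule integral_cong_AE, measurable, rule eventually_mono[OF AE]) (simp add: powr_def)
    also have "\<dots> = exp (- (s powr \<alpha>))" by (rule \<tau>int[OF s])
    finally show "lap \<rho> s = exp (- (s powr \<alpha>))" .
  qed
qed

lemma stable_law_facts:
  assumes \<alpha>: "0 < \<alpha>" "\<alpha> < 1"
  shows stable_law_prob_Rplus: "stable_law \<alpha> \<in> prob_Rplus"
    and lap_stable_law: "0 < s \<Longrightarrow> lap (stable_law \<alpha>) s = exp (- (s powr \<alpha>))"
proof -
  obtain \<rho> where \<rho>: "\<rho> \<in> prob_Rplus" "\<And>s. 0 < s \<Longrightarrow> lap \<rho> s = exp (- (s powr \<alpha>))"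
    using stable_law_exists[OF \<alpha>] by blast
  have e: "(LINT u|N. exp (t * u)) = lap N (- t)" for N t by (simp add: lap_def)
  have "stable_law \<alpha> = \<rho>"
    unfolding stable_law_def
  proof (rule the_equality)
    show "\<rho> \<in> prob_Rplus \<and> (\<forall>t\<le>0. ln (LINT u|\<rho>. exp (t * u)) = - ((- t) powr \<alpha>))"
    proof (intro conjI \<rho>(1) allI impI)
      interpret real_distribution \<rho> using \<rho>(1) by (rule prob_RplusD)
      fix t :: real assume "t \<le> 0"
      then show "ln (LINT u|\<rho>. exp (t * u)) = - ((- t) powr \<alpha>)"
        using \<rho>(2)[of "- t"] prob_space unfolding e by (cases "t = 0") (auto simp: lap_def)
    qed
    fix \<nu> assume n: "\<nu> \<in> prob_Rplus \<and> (\<forall>t\<le>0. ln (LINT u|\<nu>. exp (t * u)) = - ((- t) powr \<alpha>))"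
    show "\<nu> = \<rho>"
    proof (rule lap_eqI)
      fix s :: real assume s: "0 < s"
      interpret real_distribution \<nu> using n prob_RplusD(1) by blast
      have i: "integrable \<nu> (\<lambda>u. exp (- s * u))"
        by (rule integrable_const_bound[of _ 1])
          (use prob_RplusD(2)[of \<nu>] n s in \<open>auto elim!: eventually_mono\<close>)
      \<comment> \<open>The definition prescribes only the total function \<open>ln\<close> of the
        transform; positivity is what allows it to be inverted by \<open>exp\<close>.\<close>
      have "0 < lap \<nu> s"
      proof -
        have "0 \<le> lap \<nu> s" unfolding lap_def by simp
        moreover have "lap \<nu> s \<noteq> 0"
        proof
          assume "lap \<nu> s = 0"
          then have "AE u in \<nu>. exp (- s * u) = 0"
            using i unfolding lap_def by (subst (asm) integral_nonneg_eq_0_iff_AE) auto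
          then show False by simp
        qed
        ultimately show ?thesis by simp
      qed
      moreover have "ln (lap \<nu> s) = - (s powr \<alpha>)" using n s unfolding e by (auto dest!: spec[of _ "- s"])
      ultimately have "lap \<nu> s = exp (- (s powr \<alpha>))" by (metis exp_ln)
      then show "lap \<nu> s = lap \<rho> s" using \<rho>(2)[OF s] by simp
    qed (use n \<rho> in auto)
  qed
  then show "stable_law \<alpha> \<in> prob_Rplus" "0 < s \<Longrightarrow> lap (stable_law \<alpha>) s = exp (- (s powr \<alpha>))" using \<rho> by auto
qed

section \<open>The identities for the maps Omega-tilde and Xi\<close>

lemma Omega_tilde_S_map:
  assumes \<alpha>: "0 < \<alpha>" "\<alpha> < 1" and \<mu>: "\<mu> \<in> prob_Rplus"
  shows "Omega_tilde (S_map \<alpha> \<mu>) = pow_push (1 / \<alpha>) (Omega_tilde \<mu>)"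
proof (rule prob_Rplus_eqI_cdf)
  have PE: "pow_push (- 1) exp_law \<in> prob_Rplus" by (rule pow_push_prob_Rplus[OF exp_law_prob_Rplus])
  have P: "pow_push (1 / \<alpha>) \<mu> \<in> prob_Rplus" by (rule pow_push_prob_Rplus[OF \<mu>])
  have SR: "S_map \<alpha> \<mu> \<in> prob_Rplus"
    unfolding S_map_def by (intro mult_conv_prob_Rplus stable_law_prob_Rplus \<alpha> P)
  have O: "Omega_tilde N \<in> prob_Rplus" if "N \<in> prob_Rplus" for N
    unfolding Omega_tilde_def by (intro mult_conv_prob_Rplus PE that)
  show "Omega_tilde (S_map \<alpha> \<mu>) \<in> prob_Rplus" by (rule O[OF SR])
  show "pow_push (1 / \<alpha>) (Omega_tilde \<mu>) \<in> prob_Rplus" by (intro pow_push_prob_Rplus O \<mu>)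
  fix x :: real assume x: "0 < x"
  interpret M: real_distribution \<mu> using \<mu> by (rule prob_RplusD)
  interpret S: real_distribution "stable_law \<alpha>" using stable_law_prob_Rplus[OF \<alpha>] by (rule prob_RplusD)
  have "cdf (Omega_tilde (S_map \<alpha> \<mu>)) x = lap (S_map \<alpha> \<mu>) (1 / x)"
    unfolding Omega_tilde_def by (rule cdf_inverse_exp_mult_conv[OF SR x])
  also have "\<dots> = (LINT y|pow_push (1 / \<alpha>) \<mu>. lap (stable_law \<alpha>) (1 / x * y))"
    unfolding S_map_def using x by (intro lap_mult_conv stable_law_prob_Rplus \<alpha> P) auto
  also have "\<dots> = (LINT v|\<mu>. lap (stable_law \<alpha>) (1 / x * v powr (1 / \<alpha>)))"
    by (rule integral_pow_push[OF \<mu>]) (unfold lap_def, measurable)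
  \<comment> \<open>Self-similarity of the stable law: its transform at v^(1/\<alpha>) / x is exp(-v
    / x^\<alpha>). The point v = 0 is separate because the stable transform is stated for positive
    arguments.\<close>
  also have "\<dots> = lap \<mu> (1 / (x powr \<alpha>))"
    unfolding lap_def[of \<mu>]
  proof (rule integral_cong_AE)
    show "AE v in \<mu>. lap (stable_law \<alpha>) (1 / x * v powr (1 / \<alpha>)) = exp (- (1 / x powr \<alpha>) * v)"
      using prob_RplusD(2)[OF \<mu>]
    proof eventually_elim
      case (elim v)
      show ?case
      proof (cases "v = 0")
        case True
        then show ?thesis using S.prob_space by (simp add: lap_def)
      next
        case False
        then have v: "0 < v" using elim by simp
        then have "lap (stable_law \<alpha>) (1 / x * v powr (1 / \<alpha>)) = exp (- ((1 / x * v powr (1 / \<alpha>)) powr \<alpha>))"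
          using x by (intro lap_stable_law \<alpha>) auto
        also have "(1 / x * v powr (1 / \<alpha>)) powr \<alpha> = 1 / x powr \<alpha> * v"
          using x v \<alpha> by (simp add: powr_divide powr_powr)
        finally show ?thesis by simp
      qed
    qed
  qed (unfold lap_def, measurable)
  also have "\<dots> = cdf (Omega_tilde \<mu>) (x powr \<alpha>)"
    unfolding Omega_tilde_def by (rule cdf_inverse_exp_mult_conv[OF \<mu>, symmetric]) (use x in simp)
  also have "\<dots> = cdf (pow_push (1 / \<alpha>) (Omega_tilde \<mu>)) x"
    using \<alpha> x by (subst cdf_pow_push[OF O[OF \<mu>]]) auto
  finally show "cdf (Omega_tilde (S_map \<alpha> \<mu>)) x = cdf (pow_push (1 / \<alpha>) (Omega_tilde \<mu>)) x" .
qed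

text \<open>The same computation as for the classical stable law, with 1 / (1 + s^\<alpha>) in place
  of exp(-s^\<alpha>) and R in place of the Laplace transform.\<close>

lemma Xi_B_map:
  assumes \<alpha>: "0 < \<alpha>" "\<alpha> < 1" and \<mu>: "\<mu> \<in> prob_Rplus"
  shows "Xi (B_map \<alpha> \<mu>) = pow_push (1 / \<alpha>) (Xi \<mu>)"
proof (rule prob_Rplus_eqI_cdf)
  note b = boolean_stable_facts[OF \<alpha>]
  have P: "pow_push (1 / \<alpha>) \<mu> \<in> prob_Rplus" by (rule pow_push_prob_Rplus[OF \<mu>])
  have B: "B_map \<alpha> \<mu> \<in> prob_Rplus" unfolding B_map_def by (rule mult_conv_prob_Rplus[OF b(1) P])
  show "Xi (B_map \<alpha> \<mu>) \<in> prob_Rplus" by (rule Xi_cdf(1)[OF B])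
  show "pow_push (1 / \<alpha>) (Xi \<mu>) \<in> prob_Rplus" by (rule pow_push_prob_Rplus[OF Xi_cdf(1)[OF \<mu>]])
  fix x :: real assume x: "0 < x"
  interpret M: real_distribution \<mu> using \<mu> by (rule prob_RplusD)
  interpret L: real_distribution "boolean_stable_law \<alpha>" using b(1) by (rule prob_RplusD)
  have "cdf (Xi (B_map \<alpha> \<mu>)) x = stj (B_map \<alpha> \<mu>) (1 / x)" by (rule Xi_cdf(2)[OF B x])
  also have "\<dots> = (LINT y|pow_push (1 / \<alpha>) \<mu>. stj (boolean_stable_law \<alpha>) (1 / x * y))"
    unfolding B_map_def using x by (intro stj_mult_conv b(1) P) auto
  also have "\<dots> = (LINT v|\<mu>. stj (boolean_stable_law \<alpha>) (1 / x * v powr (1 / \<alpha>)))"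
    by (rule integral_pow_push[OF \<mu>]) (unfold stj_def, measurable)
  also have "\<dots> = stj \<mu> (1 / x powr \<alpha>)"
    unfolding stj_def[of \<mu>]
  proof (rule integral_cong_AE)
    show "AE v in \<mu>. stj (boolean_stable_law \<alpha>) (1 / x * v powr (1 / \<alpha>)) = 1 / (1 + 1 / x powr \<alpha> * v)"
      using prob_RplusD(2)[OF \<mu>]
    proof eventually_elim
      case (elim v)
      show ?case
      proof (cases "v = 0")
        case True
        then show ?thesis using stj_0[OF b(1)] by simp
      next
        case False
        then have v: "0 < v" using elim by simp
        then have "stj (boolean_stable_law \<alpha>) (1 / x * v powr (1 / \<alpha>)) = 1 / (1 + (1 / x * v powr (1 / \<alpha>)) powr \<alpha>)"
          using x by (intro b(2)) auto
        also have "(1 / x * v powr (1 / \<alpha>)) powr \<alpha> = 1 / x powr \<alpha> * v"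
          using x v \<alpha> by (simp add: powr_divide powr_powr)
        finally show ?thesis .
      qed
    qed
  qed (unfold stj_def, measurable)
  also have "\<dots> = cdf (Xi \<mu>) (x powr \<alpha>)"
    by (rule Xi_cdf(2)[OF \<mu>, symmetric]) (use x in simp)
  also have "\<dots> = cdf (pow_push (1 / \<alpha>) (Xi \<mu>)) x"
    using \<alpha> x by (subst cdf_pow_push[OF Xi_cdf(1)[OF \<mu>]]) auto
  finally show "cdf (Xi (B_map \<alpha> \<mu>)) x = cdf (pow_push (1 / \<alpha>) (Xi \<mu>)) x" .
qed

theorem proposition4p6:
  fixes \<alpha> :: real
  assumes "0 < \<alpha>" and "\<alpha> < 1"
  shows "(\<forall>\<mu>\<in>prob_Rplus. (Omega_tilde \<circ> S_map \<alpha>) \<mu> = (pow_push (1 / \<alpha>) \<circ> Omega_tilde) \<mu>) \<and>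
         (\<forall>\<mu>\<in>prob_Rplus. (Theta \<circ> F_map \<alpha>) \<mu> = (pow_push (1 / \<alpha>) \<circ> Theta) \<mu>) \<and>
         (\<forall>\<mu>\<in>prob_Rplus. (Xi \<circ> B_map \<alpha>) \<mu> = (pow_push (1 / \<alpha>) \<circ> Xi) \<mu>)"
  using Omega_tilde_S_map[OF assms] Theta_F_map[OF assms] Xi_B_map[OF assms] by simp

end
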